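(* Let $S_j$ be local potentials satisfying (A)–(E), let $\omega\in\mathbb{Q}^d$ and let $(p_1,q_1),\dots,(p_d,q_d)$ be principal periods for $\omega$. Then there exists a sequence of families of local potentials $S_j^n$, $n\in\mathbb{N}$, such that: (1) each family $S_j^n$ satisfies (A)–(E); (2) the interaction ranges of the $S_j^n$ are bounded uniformly in $n$; (3) for every $n$ the periodic action $W^n_{p,q}=\sum_{j\in B_p}S_j^n$ is a Morse function on $\mathbb{X}_{p,q}$; (4) $\lim_{n\to\infty}\|\nabla S_0^n-\nabla S_0\|_{C^1(\mathbb{R}^{\mathbb{Z}^d})}=0$; (5) $S_j^n\to S_j$ uniformly on $\mathcal{B}\cap\mathbb{X}_{p,q}$.
   Context: Notation: $\|i\|=\sum_{k=1}^d|i_k|$, $B_j^r=\{k:\|k-j\|\le r\}$, $(\tau_{k,l}x)_i=x_{i+k}+l$. Local potentials $S_j:\mathbb{R}^{\mathbb{Z}^d}\to\mathbb{R}$, $j\in\mathbb{Z}^d$, satisfy: (A) there is $r\in(0,\infty)$ (the interaction range) and $C^2$ functions $s_j:\mathbb{R}^{B_j^r}\to\mathbb{R}$ with $S_j(x)=s_j(x|_{B_j^r})$; (B) $S_j(\tau_{k,l}x)=S_{j+k}(x)$; (C) each $S_j$ is bounded below and $S_j(x)\to\infty$ as $|x_k-x_j|\to\infty$ whenever $\|k-j\|=1$; (D) $\partial_{i,k}S_j\le0$ for $i\ne k$, and $\partial_{i,k}S_i<0$ when $\|i-k\|=1$; (E) $|\partial_{i,k}S_j|\le C$ uniformly. $(p_1,q_1),\dots,(p_d,q_d)$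 are principal periods for $\omega$ if they form a $\mathbb{Z}$-basis of $I_\omega=\{(k,l)\in\mathbb{Z}^d\times\mathbb{Z}:\langle k,\omega\rangle+l=0\}$. With $p$ the matrix with columns $p_j$: $B_p=p([0,1)^d)\cap\mathbb{Z}^d$, $\mathbb{X}_{p,q}=\{x:\tau_{p_j,q_j}x=x\ \forall j\}$ (a finite-dimensional space identified with $\mathbb{R}^{B_p}$ by restriction). A $C^2$ function on $\mathbb{X}_{p,q}$ is Morse if its Hessian is nondegenerate at each critical point. $\mathcal{B}$ is the set of Birkhoff configurations ($\tau_{k,l}x\ge x$ or $\tau_{k,l}x\le x$ pointwise for every $(k,l)$). For $S(x)=s(x|_B)$ with $B$ finite and $s\in C^{m+1}$, $\|\nabla S\|_{C^m(\mathbb{R}^{\mathbb{Z}^d})}=\sum_{1\le k\le m+1}\sum_{j_1,\dots,j_k\in\mathbb{Z}^d}\sup_x|\partial_{j_1\dots j_k}S(x)|$. *)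

theory Defs
  imports "HOL-Analysis.Analysis"
begin

type_synonym 'd config = "(int ^ 'd) \<Rightarrow> real"
type_synonym 'd potentials = "(int ^ 'd) \<Rightarrow> 'd config \<Rightarrow> real"

definition l1norm :: "int ^ 'd::finite \<Rightarrow> int" where
  "l1norm i = (\<Sum>m\<in>UNIV. \<bar>i $ m\<bar>)"

definition ball1 :: "int ^ 'd::finite \<Rightarrow> real \<Rightarrow> (int ^ 'd) set" where
  "ball1 j r = {k. real_of_int (l1norm (k - j)) \<le> r}"

definition shift :: "int ^ 'd::finite \<Rightarrow> int \<Rightarrow> 'd config \<Rightarrow> 'd config" where
  "shift k l x = (\<lambda>i. x (i + k) + real_of_int l)"

definition pd :: "int ^ 'd::finite \<Rightarrow> ('d config \<Rightarrow> real) \<Rightarrow> 'd config \<Rightarrow> real" where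
  "pd i f x = deriv (\<lambda>t. f (x(i := x i + t))) 0"

definition C2 :: "('d::finite config \<Rightarrow> real) \<Rightarrow> bool" where
  "C2 f \<longleftrightarrow> continuous_on UNIV f
     \<and> (\<forall>i x. (\<lambda>t. f (x(i := x i + t))) differentiable (at 0))
     \<and> (\<forall>i. continuous_on UNIV (pd i f))
     \<and> (\<forall>i k x. (\<lambda>t. pd k f (x(i := x i + t))) differentiable (at 0))
     \<and> (\<forall>i k. continuous_on UNIV (pd i (pd k f)))"

definition local_potentials :: "'d::finite potentials \<Rightarrow> real \<Rightarrow> bool" where
  "local_potentials S r \<longleftrightarrow>
     \<comment> \<open>(A)\<close>
     0 < r
     \<and> (\<forall>j x y. (\<forall>k\<in>ball1 j r. x k = y k) \<longrightarrow> S j x = S j y)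
     \<and> (\<forall>j. C2 (S j))
     \<comment> \<open>(B)\<close>
     \<and> (\<forall>j k l x. S j (shift k l x) = S (j + k) x)
     \<comment> \<open>(C)\<close>
     \<and> (\<forall>j. bdd_below (range (S j)))
     \<and> (\<forall>j k. l1norm (k - j) = 1 \<longrightarrow>
            (\<forall>M. \<exists>R. \<forall>x. \<bar>x k - x j\<bar> > R \<longrightarrow> S j x > M))
     \<comment> \<open>(D)\<close>
     \<and> (\<forall>i k j x. i \<noteq> k \<longrightarrow> pd i (pd k (S j)) x \<le> 0)
     \<and> (\<forall>i k x. l1norm (i - k) = 1 \<longrightarrow> pd i (pd k (S i)) x < 0)
     \<comment> \<open>(E)\<close>
     \<and> (\<exists>C. \<forall>i k j x. \<bar>pd i (pd k (S j)) x\<bar> \<le> C)"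

definition inner_int :: "int ^ 'd::finite \<Rightarrow> real ^ 'd \<Rightarrow> real" where
  "inner_int k \<omega> = (\<Sum>m\<in>UNIV. real_of_int (k $ m) * \<omega> $ m)"

definition I_omega :: "real ^ 'd::finite \<Rightarrow> ((int ^ 'd) \<times> int) set" where
  "I_omega \<omega> = {(k, l). inner_int k \<omega> + real_of_int l = 0}"

definition principal_periods :: "real ^ 'd::finite \<Rightarrow> ('d \<Rightarrow> int ^ 'd) \<Rightarrow> ('d \<Rightarrow> int) \<Rightarrow> bool" where
  "principal_periods \<omega> p q \<longleftrightarrow>
     (\<forall>m. (p m, q m) \<in> I_omega \<omega>)
     \<and> (\<forall>(k, l) \<in> I_omega \<omega>. \<exists>!c :: 'd \<Rightarrow> int.
           k = (\<Sum>m\<in>UNIV. c m *s p m) \<and> l = (\<Sum>m\<in>UNIV. c m * q m))"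

definition Bp :: "('d::finite \<Rightarrow> int ^ 'd) \<Rightarrow> (int ^ 'd) set" where
  "Bp p = {k. \<exists>t :: 'd \<Rightarrow> real. (\<forall>m. 0 \<le> t m \<and> t m < 1)
              \<and> (\<forall>i. real_of_int (k $ i) = (\<Sum>m\<in>UNIV. t m * real_of_int (p m $ i)))}"

definition Xpq :: "('d::finite \<Rightarrow> int ^ 'd) \<Rightarrow> ('d \<Rightarrow> int) \<Rightarrow> 'd config set" where
  "Xpq p q = {x. \<forall>m. shift (p m) (q m) x = x}"

text \<open>tangent space of the affine space Xpq\<close>
definition Vp :: "('d::finite \<Rightarrow> int ^ 'd) \<Rightarrow> 'd config set" where
  "Vp p = {v. \<forall>m i. v (i + p m) = v i}"

definition dderiv :: "('d::finite config \<Rightarrow> real) \<Rightarrow> 'd config \<Rightarrow> 'd config \<Rightarrow> real" where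
  "dderiv f x v = deriv (\<lambda>t. f (\<lambda>i. x i + t * v i)) 0"

definition morse_on_X :: "('d::finite \<Rightarrow> int ^ 'd) \<Rightarrow> ('d \<Rightarrow> int) \<Rightarrow> ('d config \<Rightarrow> real) \<Rightarrow> bool" where
  "morse_on_X p q W \<longleftrightarrow>
     (\<forall>x\<in>Xpq p q. (\<forall>v\<in>Vp p. dderiv W x v = 0) \<longrightarrow>
        (\<forall>v\<in>Vp p. (\<forall>w\<in>Vp p. dderiv (\<lambda>y. dderiv W y w) x v = 0) \<longrightarrow> v = (\<lambda>i. 0)))"

definition birkhoff :: "'d::finite config set" where
  "birkhoff = {x. \<forall>k l. (\<forall>i. shift k l x i \<ge> x i) \<or> (\<forall>i. shift k l x i \<le> x i)}"

text \<open>|| grad f ||_{C^1}: sum over orders 1 and 2 of sup-norms of all partial derivatives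
  (infinite sums of nonnegative terms, as supremum over finite index sets, in ennreal).\<close>
definition C1_grad_norm :: "('d::finite config \<Rightarrow> real) \<Rightarrow> ennreal" where
  "C1_grad_norm f = (SUP F\<in>{F :: (int ^ 'd) set. finite F}.
      (\<Sum>j\<in>F. SUP x. ennreal \<bar>pd j f x\<bar>)
    + (\<Sum>(j1, j2)\<in>F \<times> F. SUP x. ennreal \<bar>pd j1 (pd j2 f) x\<bar>))"

end

theory Submission
  imports Defs
begin

text \<open>
  On the affine space \<^term>\<open>Xpq p q\<close> the group of translations acts freely modulo the periods: this is
  what principality of the periods gives. Hence the points \<^term>\<open>shift j 0 x\<close>, \<^term>\<open>j \<in> Bp p\<close>, are
  separated by finitely many bounded functions of the configuration that are invariant under
  \<open>x \<mapsto> x + 1\<close>, and finitely many monomials \<open>f\<close> in these functions suffice for the gradients of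
  the periodic sums of \<open>f\<close> to span the cotangent space at every point of \<^term>\<open>Xpq p q\<close>. By a
  parametric Sard argument combined with the Baire category theorem, arbitrarily small linear
  combinations of the monomials make the periodic action a Morse function on the whole noncompact
  space.

  The mixed second derivatives of the monomials have no sign. They decay like
  \<open>1 / (1 + (x i - x k)\<^sup>2)\<close>, so a sum of convex pair potentials with exactly this second derivative
  dominates them and restores the twist condition. These pair potentials are unbounded, but their
  gradients are bounded and so are the oscillations of periodic Birkhoff configurations.
\<close>

section \<open>Counting degenerate parameters\<close>

text \<open>Condition (D) leaves no slack: mixed derivatives may vanish for distant sites and are
  not bounded away from zero even for neighbours. A perturbation of indefinite sign therefore cannot
  be absorbed by \<open>S\<close>, however small it is; the pair potentials must supply all the
  negativity. Their gradients have to be bounded, so their second derivatives must be integrable.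
  This is the origin of the weight \<open>1 / (1 + u\<^sup>2)\<close>, and it rules out, for
  instance, products of trigonometric functions of different sites, whose mixed derivatives do not
  decay. The perturbation is a factor tending to 0 times the sum of the pair potentials and a
  combination of monomials, so the coefficients need only be small relative to the pair potentials,
  by a bound independent of \<open>n\<close>.

  Even modulo integer translations the periodic space is noncompact, and the spanning of gradients
  need not be uniform on it; Baire category needs it only locally. The potentials are merely
  \<open>C2\<close>, so the critical point equation is a C^1 map between spaces of equal dimension,
  which is just enough for Sard's theorem. That theorem is obtained by counting grid points, without
  measure theory.\<close>

lemma card_slab_le:
  fixes b :: "'i \<Rightarrow> real" and Z :: "('i \<Rightarrow> nat) set" and m0 :: "'i \<Rightarrow> nat" and c :: nat
  assumes I: "finite I" "i \<in> I" and b: "\<bar>b i\<bar> \<ge> 1"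
    and Z: "Z \<subseteq> extensional I"
    and box: "\<And>m k. m \<in> Z \<Longrightarrow> k \<in> I \<Longrightarrow> \<bar>real (m k) - real (m0 k)\<bar> \<le> real c"
    and slab: "\<And>m. m \<in> Z \<Longrightarrow> \<bar>\<Sum>k\<in>I. b k * (real (m k) - real (m0 k))\<bar> \<le> 1"
  shows "card Z \<le> 3 * (2 * c + 1) ^ (card I - 1)"
proof -
  \<comment> \<open>Once the other coordinates are fixed, the slab confines coordinate
    \<open>i\<close> to values at distance at most 2 from each other, because
    \<open>\<bar>b i\<bar> \<ge> 1\<close>. The residue modulo 3 then identifies it, whence the
    factor 3.\<close>
  define h where "h m = (restrict m (I - {i}), m i mod 3)" for m :: "'i \<Rightarrow> nat"
  define R where "R = PiE (I - {i}) (\<lambda>k. {m0 k - c..m0 k + c}) \<times> {..<3::nat}"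
  have inj: "inj_on h Z"
  proof (rule inj_onI)
    fix m m' assume m: "m \<in> Z" "m' \<in> Z" and eq: "h m = h m'"
    have oth: "m k = m' k" if "k \<in> I" "k \<noteq> i" for k
    proof -
      have "restrict m (I - {i}) k = restrict m' (I - {i}) k" using eq by (simp add: h_def)
      then show ?thesis using that by simp
    qed
    have sp: "(\<Sum>k\<in>I. b k * (real (u k) - real (m0 k))) =
        b i * (real (u i) - real (m0 i)) + (\<Sum>k\<in>I-{i}. b k * (real (u k) - real (m0 k)))" for u :: "'i \<Rightarrow> nat"
      using I by (simp add: sum.remove)
    have "(\<Sum>k\<in>I-{i}. b k * (real (m k) - real (m0 k))) = (\<Sum>k\<in>I-{i}. b k * (real (m' k) - real (m0 k)))"
      by (rule sum.cong) (auto simp: oth)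
    then have "b i * (real (m i) - real (m' i)) =
        (\<Sum>k\<in>I. b k * (real (m k) - real (m0 k))) - (\<Sum>k\<in>I. b k * (real (m' k) - real (m0 k)))"
      by (simp only: sp) (simp add: algebra_simps)
    then have "\<bar>b i * (real (m i) - real (m' i))\<bar> \<le> 2"
      using slab[OF m(1)] slab[OF m(2)] by linarith
    moreover have "\<bar>real (m i) - real (m' i)\<bar> \<le> \<bar>b i\<bar> * \<bar>real (m i) - real (m' i)\<bar>"
      using b by (simp add: mult_le_cancel_right1)
    ultimately have le2: "\<bar>real (m i) - real (m' i)\<bar> \<le> 2" by (simp add: abs_mult)
    have "m i mod 3 = m' i mod 3" using eq by (simp add: h_def)
    moreover have "m i \<le> m' i + 2" "m' i \<le> m i + 2" using le2 by linarith+
    ultimately have "m i = m' i" by presburger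
    then show "m = m'"
      using oth m Z by (metis extensionalityI subsetD)
  qed
  have sub: "h ` Z \<subseteq> R"
  proof
    fix z assume "z \<in> h ` Z"
    then obtain m where m: "m \<in> Z" "z = h m" by auto
    have "m k \<in> {m0 k - c..m0 k + c}" if "k \<in> I" for k
      using box[OF m(1) that] by auto
    then show "z \<in> R" using m by (auto simp: R_def h_def)
  qed
  have fin: "finite R" using I by (auto simp: R_def intro!: finite_PiE)
  have "card Z = card (h ` Z)" by (simp add: card_image inj)
  also have "\<dots> \<le> card R" by (rule card_mono[OF fin sub])
  also have "\<dots> = (\<Prod>k\<in>I-{i}. card {m0 k - c..m0 k + c}) * 3"
    using I by (simp add: R_def card_cartesian_product card_PiE)
  also have "\<dots> \<le> (\<Prod>k\<in>I-{i}. 2 * c + 1) * 3"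
    by (intro mult_right_mono prod_mono) auto
  also have "\<dots> = 3 * (2 * c + 1) ^ (card I - 1)" using I by simp
  finally show ?thesis .
qed

text \<open>A counting form of Sard's theorem. The parameters belonging to one small cell lie in a
  box of size proportional to the cell and, inside it, in a much thinner slab; all cells together
  then account for too little of the cube. \<open>Y\<close> will come from an arbitrary choice of
  degenerate zeros, so fibres are counted on a grid instead of being measured.\<close>

lemma no_degenerate_cube_parametrisation:
  fixes Y :: "('i \<Rightarrow> real) \<Rightarrow> 'i \<Rightarrow> real" and I :: "'i set"
  defines "cube \<equiv> {\<mu>. \<forall>i\<in>I. 0 \<le> \<mu> i \<and> \<mu> i \<le> 1}"
  assumes I: "finite I" "I \<noteq> {}" and C: "C > 0"
    and bd: "\<And>\<mu> i. \<mu> \<in> cube \<Longrightarrow> i \<in> I \<Longrightarrow> \<bar>Y \<mu> i\<bar> \<le> R"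
    and loc: "\<And>\<epsilon>. \<epsilon> > 0 \<Longrightarrow> \<exists>\<delta>>0. \<forall>\<mu>\<in>cube. \<exists>b. (\<exists>i\<in>I. \<bar>b i\<bar> \<ge> 1) \<and>
       (\<forall>\<mu>'\<in>cube. \<forall>d. 0 < d \<and> d \<le> \<delta> \<and> (\<forall>i\<in>I. \<bar>Y \<mu>' i - Y \<mu> i\<bar> \<le> d) \<longrightarrow>
          (\<forall>i\<in>I. \<bar>\<mu>' i - \<mu> i\<bar> \<le> C * d) \<and> \<bar>\<Sum>i\<in>I. b i * (\<mu>' i - \<mu> i)\<bar> \<le> \<epsilon> * d)"
  shows False
proof -
  define N where "N = card I"
  have N: "N > 0" using I by (simp add: N_def card_gt_0_iff)
  have R0: "R \<ge> 0"
  proof -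
    have "(\<lambda>_. 0) \<in> cube" by (simp add: cube_def)
    with bd I show ?thesis by fastforce
  qed
  \<comment> \<open>The slack 1 keeps \<open>Y \<mu> i + R\<close> strictly below \<open>D\<close>,
    so that only cell indices below \<open>n\<close> occur.\<close>
  define D where "D = 2 * R + 1"
  have D: "D > 0" using R0 by (simp add: D_def)
  define C1 where "C1 = nat \<lceil>C * D\<rceil> + 1"
  have C1: "C * D \<le> real C1" "C1 \<ge> 1" by (simp_all add: C1_def) linarith
  \<comment> \<open>The \<open>(n * T) ^ N\<close> grid points fall into \<open>n ^ N\<close> cells,
    each receiving at most \<open>3 * (3 * C1 * T) ^ (N - 1)\<close> of them. This is one power of
    \<open>T\<close> short as soon as \<open>T\<close> exceeds
    \<open>3 * (3 * C1) ^ (N - 1)\<close>. The choice of \<open>\<epsilon>\<close> below turns the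
    slab condition into a bound by 1 in grid units.\<close>
  define T where "T = 3 * (3 * C1) ^ (N - 1) + 1"
  have T: "T \<ge> 1" by (simp add: T_def)
  define \<epsilon> where "\<epsilon> = 1 / (real T * D)"
  have eps: "\<epsilon> > 0" using T D by (simp add: \<epsilon>_def)
  obtain \<delta> where \<delta>: "\<delta> > 0" and *: "\<forall>\<mu>\<in>cube. \<exists>b. (\<exists>i\<in>I. \<bar>b i\<bar> \<ge> 1) \<and>
       (\<forall>\<mu>'\<in>cube. \<forall>d. 0 < d \<and> d \<le> \<delta> \<and> (\<forall>i\<in>I. \<bar>Y \<mu>' i - Y \<mu> i\<bar> \<le> d) \<longrightarrow>
          (\<forall>i\<in>I. \<bar>\<mu>' i - \<mu> i\<bar> \<le> C * d) \<and> \<bar>\<Sum>i\<in>I. b i * (\<mu>' i - \<mu> i)\<bar> \<le> \<epsilon> * d)"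
    using loc[OF eps] by blast
  from bchoice[OF *] obtain b where b1: "\<And>\<mu>. \<mu> \<in> cube \<Longrightarrow> \<exists>i\<in>I. \<bar>b \<mu> i\<bar> \<ge> 1"
    and b2: "\<And>\<mu> \<mu>' d. \<mu> \<in> cube \<Longrightarrow> \<mu>' \<in> cube \<Longrightarrow> 0 < d \<Longrightarrow> d \<le> \<delta> \<Longrightarrow> (\<And>i. i \<in> I \<Longrightarrow> \<bar>Y \<mu>' i - Y \<mu> i\<bar> \<le> d) \<Longrightarrow>
          (\<forall>i\<in>I. \<bar>\<mu>' i - \<mu> i\<bar> \<le> C * d) \<and> \<bar>\<Sum>i\<in>I. b \<mu> i * (\<mu>' i - \<mu> i)\<bar> \<le> \<epsilon> * d"
    by blast
  \<comment> \<open>The number of cells per coordinate depends on the uncontrolled modulus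
    \<open>\<delta>\<close>, but it cancels in the final comparison. \<open>T\<close> was fixed
    before it.\<close>
  define n where "n = nat \<lceil>D / \<delta>\<rceil> + 1"
  have n: "n \<ge> 1" "D / real n \<le> \<delta>"
  proof -
    show 1: "n \<ge> 1" by (simp add: n_def)
    have "D / \<delta> \<le> real n" unfolding n_def by linarith
    then have "D \<le> \<delta> * real n" using \<delta> by (simp add: pos_divide_le_eq mult.commute)
    then show "D / real n \<le> \<delta>" using 1 by (simp add: pos_divide_le_eq)
  qed
  define d where "d = D / real n"
  have d: "d > 0" "d \<le> \<delta>" using n D by (simp_all add: d_def)
  define P where "P = n * T"
  have P: "P > 0" using n T by (simp add: P_def)
  define G where "G = PiE I (\<lambda>_. {..<P})"
  define pt where "pt m i = real (m i) / real P" for m :: "'i \<Rightarrow> nat" and i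
  have pt: "pt m \<in> cube" if "m \<in> G" for m
    using that P by (auto simp: cube_def pt_def G_def PiE_def Pi_def divide_le_eq intro: less_imp_le)
  define cell where "cell m = restrict (\<lambda>i. nat \<lfloor>(Y (pt m) i + R) / d\<rfloor>) I" for m
  define Q where "Q = PiE I (\<lambda>_. {..<n})"
  have cellQ: "cell m \<in> Q" if "m \<in> G" for m
  proof -
    have "nat \<lfloor>(Y (pt m) i + R) / d\<rfloor> < n" if "i \<in> I" for i
    proof -
      have "\<bar>Y (pt m) i\<bar> \<le> R" using bd pt \<open>m \<in> G\<close> that by blast
      then have "Y (pt m) i + R < D" "0 \<le> Y (pt m) i + R" by (simp_all add: D_def)
      then have "(Y (pt m) i + R) / d < D / d" using d by (simp add: divide_strict_right_mono)
      also have "D / d = real n" using D by (simp add: d_def)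
      finally have "(Y (pt m) i + R) / d < real n" .
      then have "\<lfloor>(Y (pt m) i + R) / d\<rfloor> < int n" by (simp add: floor_less_iff)
      then show ?thesis using n(1) by linarith
    qed
    then show ?thesis by (simp add: cell_def Q_def)
  qed
  have close: "\<bar>Y (pt m) i - Y (pt m') i\<bar> \<le> d" if "m \<in> G" "m' \<in> G" "cell m = cell m'" "i \<in> I" for m m' i
  proof -
    have "nat \<lfloor>(Y (pt m) i + R) / d\<rfloor> = nat \<lfloor>(Y (pt m') i + R) / d\<rfloor>"
      using that by (metis cell_def restrict_apply')
    moreover have "(Y (pt m) i + R) / d \<ge> 0" "(Y (pt m') i + R) / d \<ge> 0"
      using bd[OF pt[OF that(1)] that(4)] bd[OF pt[OF that(2)] that(4)] d by auto
    ultimately have "\<lfloor>(Y (pt m) i + R) / d\<rfloor> = \<lfloor>(Y (pt m') i + R) / d\<rfloor>"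
      by (metis eq_nat_nat_iff zero_le_floor)
    then have "\<bar>(Y (pt m) i + R) / d - (Y (pt m') i + R) / d\<bar> \<le> 1" by linarith
    then show ?thesis using d by (simp add: diff_divide_distrib[symmetric] abs_divide divide_le_eq)
  qed
  have fin: "finite G" "finite Q" using I by (auto simp: G_def Q_def intro!: finite_PiE)
  have fibre: "card {m \<in> G. cell m = z} \<le> 3 * (2 * (C1 * T) + 1) ^ (N - 1)" for z
  proof (cases "{m \<in> G. cell m = z} = {}")
    case True
    then show ?thesis by (metis card.empty le0)
  next
    case False
    then obtain m0 where m0: "m0 \<in> G" "cell m0 = z" by blast
    obtain i where i: "i \<in> I" "\<bar>b (pt m0) i\<bar> \<ge> 1" using b1 pt m0 by blast
    have est: "(\<forall>i\<in>I. \<bar>pt m i - pt m0 i\<bar> \<le> C * d) \<and> \<bar>\<Sum>i\<in>I. b (pt m0) i * (pt m i - pt m0 i)\<bar> \<le> \<epsilon> * d"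
      if "m \<in> G" "cell m = z" for m
    proof (rule b2)
      show "\<bar>Y (pt m) i - Y (pt m0) i\<bar> \<le> d" if "i \<in> I" for i
        using close[OF \<open>m \<in> G\<close> m0(1) _ that] \<open>cell m = z\<close> m0(2) by simp
    qed (use that m0 pt d in blast)+
    have df: "real (m k) - real (m0 k) = real P * (pt m k - pt m0 k)" for m k
      using P by (simp add: pt_def field_simps)
    have Pd: "real P * d = real T * D" using n by (simp add: P_def d_def)
    show ?thesis unfolding N_def
    proof (rule card_slab_le[where b = "b (pt m0)" and i = i and ?m0.0 = m0])
      fix m k assume m: "m \<in> {m \<in> G. cell m = z}" and k: "k \<in> I"
      have "\<bar>real (m k) - real (m0 k)\<bar> \<le> real P * (C * d)"
        unfolding df abs_mult using est[of m] m k by (auto intro!: mult_left_mono)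
      also have "\<dots> = C * D * real T" using Pd by (metis mult.assoc mult.commute)
      also have "\<dots> \<le> real C1 * real T" using C1 by (intro mult_right_mono) auto
      finally show "\<bar>real (m k) - real (m0 k)\<bar> \<le> real (C1 * T)" by simp
    next
      fix m assume m: "m \<in> {m \<in> G. cell m = z}"
      have "(\<Sum>k\<in>I. b (pt m0) k * (real (m k) - real (m0 k))) = real P * (\<Sum>k\<in>I. b (pt m0) k * (pt m k - pt m0 k))"
        unfolding df sum_distrib_left by (simp add: mult_ac)
      then have "\<bar>\<Sum>k\<in>I. b (pt m0) k * (real (m k) - real (m0 k))\<bar> \<le> real P * (\<epsilon> * d)"
        using est[of m] m by (auto simp: abs_mult intro!: mult_left_mono)
      also have "\<dots> = \<epsilon> * (real T * D)" using Pd by (metis mult.left_commute)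
      also have "\<dots> = 1" using T D by (simp add: \<epsilon>_def)
      finally show "\<bar>\<Sum>k\<in>I. b (pt m0) k * (real (m k) - real (m0 k))\<bar> \<le> 1" .
    qed (use I i in \<open>auto simp: G_def PiE_def\<close>)
  qed
  have "card G = card (\<Union>z\<in>Q. {m \<in> G. cell m = z})"
    using cellQ by (intro arg_cong[where f = card]) auto
  also have "\<dots> \<le> (\<Sum>z\<in>Q. card {m \<in> G. cell m = z})"
    using fin(2) by (rule card_UN_le)
  also have "\<dots> \<le> (\<Sum>z\<in>Q. 3 * (2 * (C1 * T) + 1) ^ (N - 1))" by (intro sum_mono fibre)
  also have "\<dots> = n ^ N * (3 * (2 * (C1 * T) + 1) ^ (N - 1))" using I by (simp add: Q_def card_PiE N_def)
  finally have "n ^ N * T ^ N \<le> n ^ N * (3 * (2 * (C1 * T) + 1) ^ (N - 1))"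
    using I by (simp add: G_def card_PiE N_def P_def power_mult_distrib)
  then have "T ^ N \<le> 3 * (2 * (C1 * T) + 1) ^ (N - 1)" using n by simp
  also have "\<dots> \<le> 3 * ((3 * C1) * T) ^ (N - 1)"
  proof (intro mult_left_mono power_mono)
    have "1 * 1 \<le> C1 * T" using C1(2) T by (intro mult_le_mono)
    then show "2 * (C1 * T) + 1 \<le> 3 * C1 * T" by linarith
  qed simp_all
  also have "\<dots> = 3 * (3 * C1) ^ (N - 1) * T ^ (N - 1)" by (simp add: power_mult_distrib)
  finally have "T * T ^ (N - 1) \<le> 3 * (3 * C1) ^ (N - 1) * T ^ (N - 1)"
    using N by (metis power_eq_if not_gr_zero)
  then have "T \<le> 3 * (3 * C1) ^ (N - 1)" using T by simp
  then show False by (simp add: T_def)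
qed

text \<open>Diagonal dominance: the entry \<open>k\<close> of \<open>v\<close> is the largest, so
  the \<open>card I\<close> errors together cost at most half of it. It is applied to parameter
  differences, for the box, and to cokernel vectors, for the normal of the slab.\<close>

lemma sum_near_unit_vector:
  fixes a v :: "'i \<Rightarrow> real"
  assumes I: "finite I" "k \<in> I"
    and near: "\<And>i. i \<in> I \<Longrightarrow> \<bar>a i - (if i = k then 1 else 0)\<bar> \<le> 1 / (2 * real (card I))"
    and v: "\<And>i. i \<in> I \<Longrightarrow> \<bar>v i\<bar> \<le> \<bar>v k\<bar>"
  shows "\<bar>v k\<bar> / 2 \<le> \<bar>\<Sum>i\<in>I. v i * a i\<bar>"
proof -
  have c: "card I > 0" using I card_gt_0_iff by blast
  have "(\<Sum>i\<in>I. v i * a i) = v k + (\<Sum>i\<in>I. v i * (a i - (if i = k then 1 else 0)))"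
    using I by (simp add: right_diff_distrib sum_subtractf if_distrib[of "\<lambda>z. _ * z"] cong: if_cong)
  moreover have "\<bar>\<Sum>i\<in>I. v i * (a i - (if i = k then 1 else 0))\<bar> \<le> \<bar>v k\<bar> / 2"
  proof -
    have "\<bar>\<Sum>i\<in>I. v i * (a i - (if i = k then 1 else 0))\<bar> \<le> (\<Sum>i\<in>I. \<bar>v i * (a i - (if i = k then 1 else 0))\<bar>)"
      by (rule sum_abs)
    also have "\<dots> \<le> (\<Sum>i\<in>I. \<bar>v k\<bar> * (1 / (2 * real (card I))))"
      unfolding abs_mult by (intro sum_mono mult_mono near v) auto
    also have "\<dots> = \<bar>v k\<bar> / 2" using c by simp
    finally show ?thesis .
  qed
  ultimately show ?thesis by linarith
qed

lemma abs_sum_mult_le: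
  fixes f g :: "'i \<Rightarrow> real"
  assumes "\<And>i. i \<in> I \<Longrightarrow> \<bar>f i\<bar> \<le> a" "\<And>i. i \<in> I \<Longrightarrow> \<bar>g i\<bar> \<le> b" "a \<ge> 0"
  shows "\<bar>\<Sum>i\<in>I. f i * g i\<bar> \<le> real (card I) * (a * b)"
proof -
  have "\<bar>\<Sum>i\<in>I. f i * g i\<bar> \<le> (\<Sum>i\<in>I. \<bar>f i\<bar> * \<bar>g i\<bar>)"
    using sum_abs[of "\<lambda>i. f i * g i" I] by (simp add: abs_mult)
  also have "\<dots> \<le> (\<Sum>i\<in>I. a * b)" using assms by (intro sum_mono mult_mono) auto
  finally show ?thesis by simp
qed

text \<open>A quantitative Sard argument. Here \<open>Y \<mu>\<close> is a degenerate zero of \<open>\<Phi> \<mu>\<close>, with \<open>u \<mu>\<close> a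
  cokernel vector of the derivative \<open>Hs \<mu>\<close>. Since \<open>\<Phi>\<close> moves with \<open>\<mu>\<close> at a rate close to the
  identity matrix, all parameters whose zero lies in a cell of size \<open>d\<close> lie in a box of size
  \<open>O(d)\<close>, and inside it in a slab of width \<open>o(d)\<close> transversal to \<open>u \<mu>\<close>.\<close>

lemma no_cube_of_degenerate_zeros:
  fixes Y u :: "('i \<Rightarrow> real) \<Rightarrow> 'i \<Rightarrow> real" and I :: "'i set" and K :: "('i \<Rightarrow> real) set"
    and \<Phi> :: "('i \<Rightarrow> real) \<Rightarrow> 'i \<Rightarrow> ('i \<Rightarrow> real) \<Rightarrow> real"
    and Hs :: "('i \<Rightarrow> real) \<Rightarrow> 'i \<Rightarrow> 'i \<Rightarrow> ('i \<Rightarrow> real) \<Rightarrow> real"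
    and A :: "'i \<Rightarrow> 'i \<Rightarrow> ('i \<Rightarrow> real) \<Rightarrow> real"
  defines "cube \<equiv> {\<mu>. \<forall>i\<in>I. 0 \<le> \<mu> i \<and> \<mu> i \<le> 1}"
  assumes I: "finite I" "I \<noteq> {}" and s: "s > 0"
    and Y: "\<And>\<mu>. \<mu> \<in> cube \<Longrightarrow> Y \<mu> \<in> K" and K: "\<And>y i. y \<in> K \<Longrightarrow> i \<in> I \<Longrightarrow> \<bar>y i\<bar> \<le> R"
    and crit: "\<And>\<mu> k. \<mu> \<in> cube \<Longrightarrow> k \<in> I \<Longrightarrow> \<Phi> \<mu> k (Y \<mu>) = 0"
    and u: "\<And>\<mu> i. \<mu> \<in> cube \<Longrightarrow> i \<in> I \<Longrightarrow> \<bar>u \<mu> i\<bar> \<le> 1" "\<And>\<mu>. \<mu> \<in> cube \<Longrightarrow> \<exists>i\<in>I. \<bar>u \<mu> i\<bar> = 1"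
    and null: "\<And>\<mu> i. \<mu> \<in> cube \<Longrightarrow> i \<in> I \<Longrightarrow> (\<Sum>k\<in>I. u \<mu> k * Hs \<mu> i k (Y \<mu>)) = 0"
    and lin: "\<And>\<mu> \<mu>' k y. \<mu> \<in> cube \<Longrightarrow> \<mu>' \<in> cube \<Longrightarrow> k \<in> I \<Longrightarrow> y \<in> K \<Longrightarrow>
        \<Phi> \<mu>' k y - \<Phi> \<mu> k y = s * (\<Sum>i\<in>I. (\<mu>' i - \<mu> i) * A i k y)"
    and near: "\<And>i k y. i \<in> I \<Longrightarrow> k \<in> I \<Longrightarrow> y \<in> K \<Longrightarrow>
        \<bar>A i k y - (if i = k then 1 else 0)\<bar> \<le> 1 / (2 * real (card I))"
    and mvt: "\<And>\<mu> y y' k. \<mu> \<in> cube \<Longrightarrow> k \<in> I \<Longrightarrow> y \<in> K \<Longrightarrow> y' \<in> K \<Longrightarrow>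
        \<exists>z\<in>K. (\<forall>i\<in>I. \<bar>z i - y i\<bar> \<le> \<bar>y' i - y i\<bar>) \<and> \<Phi> \<mu> k y' - \<Phi> \<mu> k y = (\<Sum>i\<in>I. (y' i - y i) * Hs \<mu> i k z)"
    and bd: "\<And>\<mu> i k y. \<mu> \<in> cube \<Longrightarrow> i \<in> I \<Longrightarrow> k \<in> I \<Longrightarrow> y \<in> K \<Longrightarrow> \<bar>Hs \<mu> i k y\<bar> \<le> B"
    and uc: "\<And>\<epsilon>. \<epsilon> > 0 \<Longrightarrow> \<exists>\<delta>>0. \<forall>\<mu>\<in>cube. \<forall>y\<in>K. \<forall>y'\<in>K. (\<forall>i\<in>I. \<bar>y' i - y i\<bar> \<le> \<delta>) \<longrightarrow>
        (\<forall>i\<in>I. \<forall>k\<in>I. \<bar>Hs \<mu> i k y' - Hs \<mu> i k y\<bar> \<le> \<epsilon> \<and> \<bar>A i k y' - A i k y\<bar> \<le> \<epsilon>)"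
  shows False
proof -
  define N where "N = real (card I)"
  have N: "N > 0" using I by (simp add: N_def card_gt_0_iff)
  have B: "B \<ge> 0"
  proof -
    obtain i where i: "i \<in> I" using I by blast
    have 0: "(\<lambda>_. 0) \<in> cube" by (simp add: cube_def)
    show ?thesis using bd[OF 0 i i Y[OF 0]] by linarith
  qed
  \<comment> \<open>The Lipschitz constant of parameters against zeros: diagonal dominance loses the
    factor 2, and \<open>N * B\<close> bounds a row of the derivative. The summand 1 only ensures
    positivity.\<close>
  define C where "C = 2 * (N * B) / s + 1"
  have C: "C > 0" using N B s by (simp add: C_def add_nonneg_pos)
  \<comment> \<open>Both \<open>Y \<mu>\<close> and \<open>Y \<mu>'\<close> are zeros for their own
    parameters, so the change of \<open>\<Phi>\<close> caused by the parameter at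
    \<open>Y \<mu>'\<close> is the negative of the change caused by moving the point at the fixed
    parameter \<open>\<mu>\<close>.\<close>
  have key: "\<exists>z\<in>K. (\<forall>i\<in>I. \<bar>z i - Y \<mu> i\<bar> \<le> \<bar>Y \<mu>' i - Y \<mu> i\<bar>) \<and>
      s * (\<Sum>i\<in>I. (\<mu>' i - \<mu> i) * A i k (Y \<mu>')) = - (\<Sum>i\<in>I. (Y \<mu>' i - Y \<mu> i) * Hs \<mu> i k z)"
    if \<mu>: "\<mu> \<in> cube" "\<mu>' \<in> cube" and k: "k \<in> I" for \<mu> \<mu>' k
  proof -
    obtain z where z: "z \<in> K" "\<forall>i\<in>I. \<bar>z i - Y \<mu> i\<bar> \<le> \<bar>Y \<mu>' i - Y \<mu> i\<bar>"
      "\<Phi> \<mu> k (Y \<mu>') - \<Phi> \<mu> k (Y \<mu>) = (\<Sum>i\<in>I. (Y \<mu>' i - Y \<mu> i) * Hs \<mu> i k z)"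
      using mvt[OF \<mu>(1) k Y[OF \<mu>(1)] Y[OF \<mu>(2)]] by blast
    have "s * (\<Sum>i\<in>I. (\<mu>' i - \<mu> i) * A i k (Y \<mu>')) = - (\<Phi> \<mu> k (Y \<mu>') - \<Phi> \<mu> k (Y \<mu>))"
      using lin[OF \<mu> k Y[OF \<mu>(2)]] crit[OF \<mu>(1) k] crit[OF \<mu>(2) k] by simp
    with z show ?thesis by (intro bexI[of _ z]) auto
  qed
  have lip: "\<bar>\<mu>' i - \<mu> i\<bar> \<le> C * d"
    if \<mu>: "\<mu> \<in> cube" "\<mu>' \<in> cube" and d: "0 < d" "\<And>i. i \<in> I \<Longrightarrow> \<bar>Y \<mu>' i - Y \<mu> i\<bar> \<le> d" and i: "i \<in> I" for \<mu> \<mu>' d i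
  proof -
    define m where "m = Max ((\<lambda>i. \<bar>\<mu>' i - \<mu> i\<bar>) ` I)"
    have "m \<in> (\<lambda>i. \<bar>\<mu>' i - \<mu> i\<bar>) ` I" unfolding m_def using I by (intro Max_in) auto
    then obtain k where k: "k \<in> I" "m = \<bar>\<mu>' k - \<mu> k\<bar>" by blast
    have le: "\<bar>\<mu>' j - \<mu> j\<bar> \<le> \<bar>\<mu>' k - \<mu> k\<bar>" if "j \<in> I" for j
      unfolding k(2)[symmetric] m_def using I that by (intro Max_ge) auto
    obtain z where z: "z \<in> K" "s * (\<Sum>i\<in>I. (\<mu>' i - \<mu> i) * A i k (Y \<mu>')) = - (\<Sum>i\<in>I. (Y \<mu>' i - Y \<mu> i) * Hs \<mu> i k z)"
      using key[OF \<mu> k(1)] by blast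
    have "\<bar>\<mu>' k - \<mu> k\<bar> / 2 \<le> \<bar>\<Sum>i\<in>I. (\<mu>' i - \<mu> i) * A i k (Y \<mu>')\<bar>"
      using sum_near_unit_vector[of I k "\<lambda>i. A i k (Y \<mu>')" "\<lambda>i. \<mu>' i - \<mu> i"] I(1) k(1) near[OF _ k(1) Y[OF \<mu>(2)]] le by simp
    then have "s * (\<bar>\<mu>' k - \<mu> k\<bar> / 2) \<le> s * \<bar>\<Sum>i\<in>I. (\<mu>' i - \<mu> i) * A i k (Y \<mu>')\<bar>"
      using s by (intro mult_left_mono) auto
    also have "\<dots> = \<bar>\<Sum>i\<in>I. (Y \<mu>' i - Y \<mu> i) * Hs \<mu> i k z\<bar>"
      using arg_cong[OF z(2), of abs] s by (simp add: abs_mult)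
    also have "\<dots> \<le> N * (d * B)" unfolding N_def
      by (rule abs_sum_mult_le) (use d bd \<mu> k z in auto)
    finally have "s * \<bar>\<mu>' k - \<mu> k\<bar> \<le> 2 * (N * B) * d" by (simp add: mult_ac)
    then have "\<bar>\<mu>' k - \<mu> k\<bar> \<le> 2 * (N * B) / s * d" using s by (simp add: pos_le_divide_eq mult_ac)
    also have "\<dots> \<le> C * d" using d(1) by (simp add: C_def distrib_right)
    finally show ?thesis using le[OF i] by linarith
  qed
  show False
  proof (rule no_degenerate_cube_parametrisation[OF I C, of Y R], fold cube_def)
    show "\<bar>Y \<mu> i\<bar> \<le> R" if "\<mu> \<in> cube" "i \<in> I" for \<mu> i using Y K that by blast
  next
    fix \<epsilon> :: real assume eps: "\<epsilon> > 0"
    \<comment> \<open>The two summands collect the errors from replacing the derivative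
      \<open>Hs\<close> at intermediate points and the matrix \<open>A\<close> at
      \<open>Y \<mu>'\<close> by their values at \<open>Y \<mu>\<close>.\<close>
    define D where "D = 2 * (N * N) / s + 2 * (N * N) * C"
    have D: "D > 0" using N C s by (simp add: D_def add_pos_pos)
    define \<eta> where "\<eta> = \<epsilon> / D"
    have \<eta>: "\<eta> > 0" using eps D by (simp add: \<eta>_def)
    obtain \<delta> where \<delta>: "\<delta> > 0" and uc\<delta>: "\<And>\<mu> y y' i k. \<mu> \<in> cube \<Longrightarrow> y \<in> K \<Longrightarrow> y' \<in> K \<Longrightarrow>
        (\<And>i. i \<in> I \<Longrightarrow> \<bar>y' i - y i\<bar> \<le> \<delta>) \<Longrightarrow> i \<in> I \<Longrightarrow> k \<in> I \<Longrightarrow>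
        \<bar>Hs \<mu> i k y' - Hs \<mu> i k y\<bar> \<le> \<eta> \<and> \<bar>A i k y' - A i k y\<bar> \<le> \<eta>"
      using uc[OF \<eta>] by blast
    have "\<exists>b. (\<exists>i\<in>I. \<bar>b i\<bar> \<ge> 1) \<and>
       (\<forall>\<mu>'\<in>cube. \<forall>d. 0 < d \<and> d \<le> \<delta> \<and> (\<forall>i\<in>I. \<bar>Y \<mu>' i - Y \<mu> i\<bar> \<le> d) \<longrightarrow>
          (\<forall>i\<in>I. \<bar>\<mu>' i - \<mu> i\<bar> \<le> C * d) \<and> \<bar>\<Sum>i\<in>I. b i * (\<mu>' i - \<mu> i)\<bar> \<le> \<epsilon> * d)" if \<mu>: "\<mu> \<in> cube" for \<mu>
    proof (intro exI conjI ballI allI impI)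
      \<comment> \<open>The slab normal is the cokernel vector transported by the parameter
        derivative \<open>A\<close>; the factor 2 compensates the half lost in
        \<open>sum_near_unit_vector\<close>.\<close>
      define b where "b i = 2 * (\<Sum>k\<in>I. u \<mu> k * A i k (Y \<mu>))" for i
      obtain i where i: "i \<in> I" "\<bar>u \<mu> i\<bar> = 1" using u(2)[OF \<mu>] by blast
      have "\<bar>u \<mu> i\<bar> / 2 \<le> \<bar>\<Sum>k\<in>I. u \<mu> k * A i k (Y \<mu>)\<bar>"
        by (rule sum_near_unit_vector) (use I i u \<mu> near[of i _ "Y \<mu>"] Y[OF \<mu>] in \<open>auto simp: eq_commute[of i]\<close>)
      then have "\<bar>b i\<bar> \<ge> 1" using i by (simp add: b_def abs_mult)
      then show "\<exists>i\<in>I. \<bar>b i\<bar> \<ge> 1" using i by blast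
      fix \<mu>' d assume \<mu>': "\<mu>' \<in> cube" and "0 < d \<and> d \<le> \<delta> \<and> (\<forall>i\<in>I. \<bar>Y \<mu>' i - Y \<mu> i\<bar> \<le> d)"
      then have d: "0 < d" "d \<le> \<delta>" "\<And>i. i \<in> I \<Longrightarrow> \<bar>Y \<mu>' i - Y \<mu> i\<bar> \<le> d" by auto
      show C': "\<And>i. i \<in> I \<Longrightarrow> \<bar>\<mu>' i - \<mu> i\<bar> \<le> C * d" by (rule lip[OF \<mu> \<mu>' d(1,3)])
      \<comment> \<open>The mean value theorem is applied to each component of \<open>\<Phi>\<close>
        separately, so the intermediate point depends on \<open>k\<close>.\<close>
      have "\<forall>k\<in>I. \<exists>z. z \<in> K \<and> (\<forall>i\<in>I. \<bar>z i - Y \<mu> i\<bar> \<le> \<bar>Y \<mu>' i - Y \<mu> i\<bar>) \<and>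
          s * (\<Sum>i\<in>I. (\<mu>' i - \<mu> i) * A i k (Y \<mu>')) = - (\<Sum>i\<in>I. (Y \<mu>' i - Y \<mu> i) * Hs \<mu> i k z)"
        using key[OF \<mu> \<mu>'] by blast
      from bchoice[OF this] obtain z where z: "\<And>k. k \<in> I \<Longrightarrow> z k \<in> K"
        "\<And>k i. k \<in> I \<Longrightarrow> i \<in> I \<Longrightarrow> \<bar>z k i - Y \<mu> i\<bar> \<le> \<bar>Y \<mu>' i - Y \<mu> i\<bar>"
        "\<And>k. k \<in> I \<Longrightarrow> s * (\<Sum>i\<in>I. (\<mu>' i - \<mu> i) * A i k (Y \<mu>')) = - (\<Sum>i\<in>I. (Y \<mu>' i - Y \<mu> i) * Hs \<mu> i k (z k))"
        by blast
      \<comment> \<open>\<open>E1\<close> pairs \<open>u\<close> with the full parameter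
        displacement, measured at \<open>Y \<mu>'\<close>; \<open>E2\<close> corrects for evaluating
        \<open>A\<close> there instead of at \<open>Y \<mu>\<close>.\<close>
      define E1 where "E1 = (\<Sum>k\<in>I. u \<mu> k * (s * (\<Sum>i\<in>I. (\<mu>' i - \<mu> i) * A i k (Y \<mu>'))))"
      define E2 where "E2 = (\<Sum>k\<in>I. u \<mu> k * (\<Sum>i\<in>I. (\<mu>' i - \<mu> i) * (A i k (Y \<mu>') - A i k (Y \<mu>))))"
      have "(\<Sum>k\<in>I. \<Sum>i\<in>I. u \<mu> k * ((\<mu>' i - \<mu> i) * A i k (Y \<mu>))) = E1 / s - E2"
        using s by (simp add: E1_def E2_def sum_divide_distrib right_diff_distrib sum_subtractf sum_distrib_left)
      moreover have "(\<Sum>i\<in>I. b i * (\<mu>' i - \<mu> i)) = 2 * (\<Sum>i\<in>I. \<Sum>k\<in>I. u \<mu> k * ((\<mu>' i - \<mu> i) * A i k (Y \<mu>)))"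
        by (simp add: b_def sum_distrib_left sum_distrib_right mult_ac)
      ultimately have bsum: "(\<Sum>i\<in>I. b i * (\<mu>' i - \<mu> i)) = 2 * (E1 / s - E2)"
        by (subst (asm) sum.swap) simp
      have "E1 = - (\<Sum>k\<in>I. \<Sum>i\<in>I. (Y \<mu>' i - Y \<mu> i) * (u \<mu> k * Hs \<mu> i k (z k)))"
        unfolding E1_def sum_negf[symmetric] by (intro sum.cong refl, subst z(3)) (simp_all add: sum_distrib_left sum_negf mult_ac)
      also have "\<dots> = - (\<Sum>i\<in>I. \<Sum>k\<in>I. (Y \<mu>' i - Y \<mu> i) * (u \<mu> k * Hs \<mu> i k (z k)))"
        by (subst sum.swap) simp
      \<comment> \<open>This is where degeneracy enters: \<open>u \<mu>\<close> annihilates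
        \<open>Hs\<close> at \<open>Y \<mu>\<close>, so only the variation of \<open>Hs\<close> over
        a distance \<open>d\<close> survives, and \<open>E1\<close> is o(d) rather than
        O(d).\<close>
      also have "\<dots> = - (\<Sum>i\<in>I. (Y \<mu>' i - Y \<mu> i) * (\<Sum>k\<in>I. u \<mu> k * (Hs \<mu> i k (z k) - Hs \<mu> i k (Y \<mu>))))"
        using null[OF \<mu>] by (simp add: right_diff_distrib sum_subtractf sum_distrib_left[symmetric])
      finally have E1: "E1 = \<dots>" .
      have "\<bar>E1\<bar> \<le> N * (d * (N * (1 * \<eta>)))"
        unfolding E1 abs_minus_cancel N_def
      proof (intro abs_sum_mult_le)
        fix i k assume "i \<in> I" "k \<in> I"
        then show "\<bar>Hs \<mu> i k (z k) - Hs \<mu> i k (Y \<mu>)\<bar> \<le> \<eta>"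
          using uc\<delta>[OF \<mu> Y[OF \<mu>] z(1)] z(2) d by (meson order.trans)
      qed (use d u \<mu> in auto)
      moreover have "\<bar>E2\<bar> \<le> N * (1 * (N * ((C * d) * \<eta>)))"
        unfolding E2_def N_def
      proof (intro abs_sum_mult_le)
        fix i k assume "i \<in> I" "k \<in> I"
        then show "\<bar>A i k (Y \<mu>') - A i k (Y \<mu>)\<bar> \<le> \<eta>"
          using uc\<delta>[OF \<mu> Y[OF \<mu>] Y[OF \<mu>']] d by (meson order.trans)
      qed (use C' C d u \<mu> in auto)
      moreover have "\<bar>\<Sum>i\<in>I. b i * (\<mu>' i - \<mu> i)\<bar> \<le> 2 * (\<bar>E1\<bar> / s + \<bar>E2\<bar>)"
        unfolding bsum using s abs_triangle_ineq4[of "E1 / s" E2] by (simp add: abs_mult abs_divide)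
      moreover have "\<bar>E1\<bar> / s \<le> N * (d * (N * (1 * \<eta>))) / s" using calculation(1) s by (simp add: divide_right_mono)
      moreover have "2 * (a + b) \<le> 2 * (a' + b')" if "a \<le> a'" "b \<le> b'" for a b a' b' :: real using that by simp
      ultimately have "\<bar>\<Sum>i\<in>I. b i * (\<mu>' i - \<mu> i)\<bar> \<le> 2 * (N * (d * (N * (1 * \<eta>))) / s + N * (1 * (N * ((C * d) * \<eta>))))"
        by (meson order.trans)
      also have "\<dots> = D * \<eta> * d" by (simp add: D_def algebra_simps)
      also have "\<dots> = \<epsilon> * d" using D by (simp add: \<eta>_def)
      finally show "\<bar>\<Sum>i\<in>I. b i * (\<mu>' i - \<mu> i)\<bar> \<le> \<epsilon> * d" .
    qed
    then show "\<exists>\<delta>>0. \<forall>\<mu>\<in>cube. \<exists>b. (\<exists>i\<in>I. \<bar>b i\<bar> \<ge> 1) \<and>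
       (\<forall>\<mu>'\<in>cube. \<forall>d. 0 < d \<and> d \<le> \<delta> \<and> (\<forall>i\<in>I. \<bar>Y \<mu>' i - Y \<mu> i\<bar> \<le> d) \<longrightarrow>
          (\<forall>i\<in>I. \<bar>\<mu>' i - \<mu> i\<bar> \<le> C * d) \<and> \<bar>\<Sum>i\<in>I. b i * (\<mu>' i - \<mu> i)\<bar> \<le> \<epsilon> * d)"
      using \<delta> by blast
  qed
qed

section \<open>Differential calculus of configurations\<close>

definition depends_on :: "'k set \<Rightarrow> (('k \<Rightarrow> real) \<Rightarrow> real) \<Rightarrow> bool" where
  "depends_on T f \<longleftrightarrow> (\<forall>x y. (\<forall>k\<in>T. x k = y k) \<longrightarrow> f x = f y)"

lemma depD: "depends_on T f \<Longrightarrow> (\<And>k. k \<in> T \<Longrightarrow> x k = y k) \<Longrightarrow> f x = f y"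
  unfolding depends_on_def by blast

lemma dep_mono: "depends_on T f \<Longrightarrow> T \<subseteq> T' \<Longrightarrow> depends_on T' f"
  unfolding depends_on_def by blast

lemma dep_add: "depends_on T f \<Longrightarrow> depends_on T g \<Longrightarrow> depends_on T (\<lambda>x. f x + g x)"
  unfolding depends_on_def by metis

lemma dep_mult: "depends_on T f \<Longrightarrow> depends_on T g \<Longrightarrow> depends_on T (\<lambda>x. f x * g x)"
  unfolding depends_on_def by metis

lemma dep_const: "depends_on T (\<lambda>x. c)"
  unfolding depends_on_def by simp

lemma dep_sum: "(\<And>a. a \<in> A \<Longrightarrow> depends_on T (f a)) \<Longrightarrow> depends_on T (\<lambda>x. \<Sum>a\<in>A. f a x)"
  unfolding depends_on_def by (intro allI impI sum.cong) auto

lemma dep_pd: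
  fixes f :: "'d::finite config \<Rightarrow> real"
  shows "depends_on T f \<Longrightarrow> depends_on T (pd i f)"
  unfolding depends_on_def pd_def
proof (intro allI impI)
  fix x y :: "'d config" assume f: "\<forall>x y. (\<forall>k\<in>T. x k = y k) \<longrightarrow> f x = f y" and xy: "\<forall>k\<in>T. x k = y k"
  have "f (x(i := x i + t)) = f (y(i := y i + t))" for t
    using xy by (intro f[rule_format]) auto
  then show "deriv (\<lambda>t. f (x(i := x i + t))) 0 = deriv (\<lambda>t. f (y(i := y i + t))) 0" by simp
qed

lemma pd_outside:
  assumes "depends_on T f" "i \<notin> T" shows "pd i f x = 0"
proof -
  have "f (x(i := x i + t)) = f x" for t
    using assms by (intro depD[of T f]) auto
  then show ?thesis by (simp add: pd_def)
qed

lemma tendsto_fun: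
  fixes f :: "'a \<Rightarrow> 'b \<Rightarrow> 'c::topological_space"
  assumes "\<And>i. ((\<lambda>t. f t i) \<longlongrightarrow> l i) F"
  shows "(f \<longlongrightarrow> l) F"
proof -
  have "limitin (product_topology (\<lambda>i. euclidean) UNIV) f l F"
    using assms by (simp add: limitin_componentwise)
  then show ?thesis by (simp add: euclidean_product_topology)
qed

text \<open>Continuity of \<open>f\<close> itself is kept apart: for functions of infinitely many
  coordinates it does not follow from the partial derivatives, and \<open>C2_iff\<close> and
  \<open>C1_mult\<close> state it separately.\<close>

definition C1 :: "('d::finite config \<Rightarrow> real) \<Rightarrow> bool" where
  "C1 f \<longleftrightarrow> (\<forall>i x. (\<lambda>t. f (x(i := x i + t))) differentiable (at 0)) \<and> (\<forall>i. continuous_on UNIV (pd i f))"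

lemma C2_iff: "C2 f \<longleftrightarrow> continuous_on UNIV f \<and> C1 f \<and> (\<forall>k. C1 (pd k f))"
  unfolding C2_def C1_def by blast

lemma C1_has_pd:
  assumes "C1 f"
  shows "((\<lambda>t. f (x(i := x i + t))) has_real_derivative pd i f x) (at 0)"
  unfolding pd_def DERIV_deriv_iff_real_differentiable using assms by (simp add: C1_def)

lemma DERIV_translate:
  fixes g h :: "real \<Rightarrow> real"
  assumes "(g has_real_derivative D) (at 0)" and "\<And>t. h t = g (t - s)"
  shows "(h has_real_derivative D) (at s)"
proof -
  have "((\<lambda>t. t - s) has_real_derivative 1) (at s)" by (auto intro!: derivative_eq_intros)
  moreover have "(g has_real_derivative D) (at (s - s))" using assms(1) by simp
  ultimately have "((\<lambda>t. g (t - s)) has_real_derivative D * 1) (at s)"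
    using DERIV_chain2[of g D "\<lambda>t. t - s" s 1 UNIV] by blast
  moreover have "h = (\<lambda>t. g (t - s))" using assms(2) by blast
  ultimately show ?thesis by (simp only: mult_1_right)
qed

lemma C1_has_pd_at:
  assumes "C1 f"
  shows "((\<lambda>t. f (x(i := x i + t))) has_real_derivative pd i f (x(i := x i + s))) (at s)"
  by (rule DERIV_translate[OF C1_has_pd[OF assms]]) simp

text \<open>Induction over the moving coordinates, the new coordinate \<open>j\<close> moving last.
  The mean value theorem evaluates its increment at a point that tends to \<open>x\<close>
  coordinatewise, so continuity of \<open>pd j f\<close> in the product topology yields the
  limit.\<close>

lemma C1_line_restrict:
  assumes f: "C1 f" and U: "finite U"
  shows "((\<lambda>t. f (\<lambda>k. if k \<in> U then x k + t * v k else x k)) has_real_derivative (\<Sum>i\<in>U. pd i f x * v i)) (at 0)"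
  using U
proof (induction U)
  case empty
  then show ?case by simp
next
  case (insert j U)
  define y where "y t = (\<lambda>k. if k \<in> U then x k + t * v k else x k)" for t
  have yj: "y t j = x j" for t using insert by (simp add: y_def)
  have ins: "(\<lambda>k. if k \<in> insert j U then x k + t * v k else x k) = (y t)(j := y t j + t * v j)" for t
    using insert by (auto simp: y_def fun_eq_iff)
  have "\<exists>z. \<bar>z\<bar> \<le> \<bar>t * v j\<bar> \<and> f ((y t)(j := y t j + t * v j)) - f (y t) = t * v j * pd j f ((y t)(j := y t j + z))" for t
  proof -
    let ?g = "\<lambda>s. f ((y t)(j := y t j + s))" and ?g' = "\<lambda>s. pd j f ((y t)(j := y t j + s))"
    have D: "\<And>s. (?g has_real_derivative ?g' s) (at s)" by (rule C1_has_pd_at[OF f])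
    consider "t * v j = 0" | "0 < t * v j" | "t * v j < 0" by linarith
    then show ?thesis
    proof cases
      case 1 then show ?thesis by (intro exI[of _ 0]) auto
    next
      case 2
      from MVT2[OF this D] obtain z where "0 < z" "z < t * v j" "?g (t * v j) - ?g 0 = (t * v j - 0) * ?g' z" by blast
      then show ?thesis by (intro exI[of _ z]) auto
    next
      case 3
      from MVT2[OF this D] obtain z where "t * v j < z" "z < 0" "?g 0 - ?g (t * v j) = (0 - t * v j) * ?g' z" by blast
      then show ?thesis by (intro exI[of _ z]) auto
    qed
  qed
  then obtain z where z: "\<And>t. \<bar>z t\<bar> \<le> \<bar>t * v j\<bar>"
    "\<And>t. f ((y t)(j := y t j + t * v j)) - f (y t) = t * v j * pd j f ((y t)(j := y t j + z t))" by metis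
  have zlim: "(z \<longlongrightarrow> 0) (at 0)"
  proof (rule Lim_null_comparison)
    show "\<forall>\<^sub>F t in at 0. norm (z t) \<le> \<bar>t * v j\<bar>" using z by simp
    show "((\<lambda>t. \<bar>t * v j\<bar>) \<longlongrightarrow> 0) (at 0)"
      by (intro tendsto_rabs_zero tendsto_mult_left_zero tendsto_ident_at)
  qed
  have lim: "((\<lambda>t. (y t)(j := y t j + z t)) \<longlongrightarrow> x) (at 0)"
  proof (rule tendsto_fun)
    fix k
    have "((\<lambda>t. x k + t * v k) \<longlongrightarrow> x k + 0 * v k) (at 0)" by (intro tendsto_intros)
    moreover have "((\<lambda>t. x j + z t) \<longlongrightarrow> x j + 0) (at 0)" using zlim by (intro tendsto_intros)
    ultimately show "((\<lambda>t. ((y t)(j := y t j + z t)) k) \<longlongrightarrow> x k) (at 0)"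
      using insert.hyps by (cases "k = j"; cases "k \<in> U") (simp_all add: y_def)
  qed
  have "((\<lambda>t. pd j f ((y t)(j := y t j + z t))) \<longlongrightarrow> pd j f x) (at 0)"
    using f lim unfolding C1_def by (intro continuous_on_tendsto_compose[of UNIV "pd j f"]) auto
  then have "((\<lambda>t. v j * pd j f ((y t)(j := y t j + z t))) \<longlongrightarrow> v j * pd j f x) (at 0)"
    by (intro tendsto_intros)
  then have "((\<lambda>t. (f ((y t)(j := y t j + t * v j)) - f (y t)) / t) \<longlongrightarrow> v j * pd j f x) (at 0)"
    by (rule Lim_transform_eventually) (auto simp: z eventually_at_filter)
  then have "((\<lambda>t. f ((y t)(j := y t j + t * v j)) - f (y t)) has_real_derivative v j * pd j f x) (at 0)"
    using yj fun_upd_idem[of "y 0" j "x j"] by (simp add: has_field_derivative_iff)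
  from DERIV_add[OF this insert.IH[folded y_def]]
  show ?case unfolding ins using insert by (simp add: mult.commute add.commute)
qed

lemma C1_line:
  assumes f: "C1 f" and T: "finite T" "depends_on T f"
  shows "((\<lambda>t. f (\<lambda>k. x k + t * v k)) has_real_derivative (\<Sum>i\<in>T. pd i f (\<lambda>k. x k + s * v k) * v i)) (at s)"
proof -
  have *: "((\<lambda>t. f (\<lambda>k. x k + t * v k)) has_real_derivative (\<Sum>i\<in>T. pd i f x * v i)) (at 0)" for x
  proof -
    have "f (\<lambda>k. if k \<in> T then x k + t * v k else x k) = f (\<lambda>k. x k + t * v k)" for t
      by (rule depD[OF T(2)]) simp
    with C1_line_restrict[OF f T(1), of x v] show ?thesis by simp
  qed
  show ?thesis by (rule DERIV_translate[OF *]) (simp add: algebra_simps)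
qed

lemma dderiv_eq:
  assumes "C1 f" "finite T" "depends_on T f"
  shows "dderiv f x v = (\<Sum>i\<in>T. pd i f x * v i)"
  unfolding dderiv_def using C1_line[OF assms, of x v 0] by (intro DERIV_imp_deriv) simp

lemma pd_eqI: "((\<lambda>t. f (x(i := x i + t))) has_real_derivative d) (at 0) \<Longrightarrow> pd i f x = d"
  unfolding pd_def by (rule DERIV_imp_deriv)

lemma C1I:
  assumes "\<And>i x. ((\<lambda>t. f (x(i := x i + t))) has_real_derivative f' i x) (at 0)"
    and "\<And>i. continuous_on UNIV (f' i)"
  shows "C1 f" "pd i f = f' i"
proof -
  have pd: "pd i f = f' i" for i using assms(1) by (auto intro!: pd_eqI ext)
  then show "pd i f = f' i" .
  show "C1 f" unfolding C1_def pd using assms real_differentiable_def by blast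
qed

section \<open>Calculus rules for functions of class C^1 and C^2\<close>

lemma C1_const: "C1 (\<lambda>x. c)" "pd i (\<lambda>x. c) = (\<lambda>x. 0)"
  using C1I[of "\<lambda>x. c" "\<lambda>i x. 0"] by auto

lemma C1_add:
  assumes "C1 f" "C1 g"
  shows "C1 (\<lambda>x. f x + g x)" "pd i (\<lambda>x. f x + g x) = (\<lambda>x. pd i f x + pd i g x)"
  by (rule C1I, rule DERIV_add[OF C1_has_pd[OF assms(1)] C1_has_pd[OF assms(2)]],
      use assms in \<open>auto simp: C1_def intro: continuous_on_add\<close>)+

lemma C1_mult:
  assumes "C1 f" "C1 g" "continuous_on UNIV f" "continuous_on UNIV g"
  shows "C1 (\<lambda>x. f x * g x)" "pd i (\<lambda>x. f x * g x) = (\<lambda>x. pd i f x * g x + pd i g x * f x)"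
proof -
  have "((\<lambda>t. f (x(i := x i + t)) * g (x(i := x i + t))) has_real_derivative pd i f x * g x + pd i g x * f x) (at 0)" for i x
    using DERIV_mult[OF C1_has_pd[OF assms(1), of x i] C1_has_pd[OF assms(2), of x i]] by simp
  moreover have "continuous_on UNIV (\<lambda>x. pd i f x * g x + pd i g x * f x)" for i
    using assms by (auto simp: C1_def intro!: continuous_intros)
  ultimately show "C1 (\<lambda>x. f x * g x)" "pd i (\<lambda>x. f x * g x) = (\<lambda>x. pd i f x * g x + pd i g x * f x)"
    using C1I[of "\<lambda>x. f x * g x" "\<lambda>i x. pd i f x * g x + pd i g x * f x"] by auto
qed

lemma C2_D:
  assumes "C2 f"
  shows C2_C1: "C1 f" and C2_pd: "C1 (pd k f)" and C2_cont: "continuous_on UNIV f"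
    and C2_cont_pd: "continuous_on UNIV (pd k f)" and C2_cont_pd2: "continuous_on UNIV (pd i (pd k f))"
  using assms by (auto simp: C2_iff C1_def)

lemma C2_const: "C2 (\<lambda>x. c)"
  by (simp add: C2_iff C1_const)

lemma C2_add:
  assumes "C2 f" "C2 g"
  shows "C2 (\<lambda>x. f x + g x)" "pd i (\<lambda>x. f x + g x) = (\<lambda>x. pd i f x + pd i g x)"
    "pd k (pd i (\<lambda>x. f x + g x)) = (\<lambda>x. pd k (pd i f) x + pd k (pd i g) x)"
  using assms by (auto simp: C2_iff C1_add intro: continuous_on_add)

lemma C2_mult:
  assumes "C2 f" "C2 g"
  shows "C2 (\<lambda>x. f x * g x)" "pd i (\<lambda>x. f x * g x) = (\<lambda>x. pd i f x * g x + pd i g x * f x)"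
    "pd k (pd i (\<lambda>x. f x * g x)) = (\<lambda>x. pd k (pd i f) x * g x + pd k g x * pd i f x + (pd k (pd i g) x * f x + pd k f x * pd i g x))"
proof -
  have c: "continuous_on UNIV f" "continuous_on UNIV g" "C1 f" "C1 g" "continuous_on UNIV (pd i f)" "continuous_on UNIV (pd i g)"
    "C1 (pd i f)" "C1 (pd i g)" for i
    using assms by (auto simp: C2_D)
  show 1: "pd i (\<lambda>x. f x * g x) = (\<lambda>x. pd i f x * g x + pd i g x * f x)" for i
    using C1_mult c by blast
  have m: "C1 (\<lambda>x. pd i f x * g x)" "C1 (\<lambda>x. pd i g x * f x)" for i using C1_mult c by blast+
  show "C2 (\<lambda>x. f x * g x)" unfolding C2_iff 1
    by (intro conjI allI C1_mult(1) C1_add(1) continuous_on_mult c)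
  show "pd k (pd i (\<lambda>x. f x * g x)) = (\<lambda>x. pd k (pd i f) x * g x + pd k g x * pd i f x + (pd k (pd i g) x * f x + pd k f x * pd i g x))"
    unfolding 1 C1_add(2)[OF m] by (subst C1_mult(2), use c in simp_all)+
qed

lemma C2_cmult:
  assumes "C2 f"
  shows "C2 (\<lambda>x. c * f x)" "pd i (\<lambda>x. c * f x) = (\<lambda>x. c * pd i f x)"
    "pd k (pd i (\<lambda>x. c * f x)) = (\<lambda>x. c * pd k (pd i f) x)"
  using C2_mult[OF C2_const[of c] assms] by (simp_all add: C1_const mult.commute)

lemma C2_sum:
  assumes "\<And>a. a \<in> A \<Longrightarrow> C2 (f a)"
  shows "C2 (\<lambda>x. \<Sum>a\<in>A. f a x)" "pd i (\<lambda>x. \<Sum>a\<in>A. f a x) = (\<lambda>x. \<Sum>a\<in>A. pd i (f a) x)"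
    "pd k (pd i (\<lambda>x. \<Sum>a\<in>A. f a x)) = (\<lambda>x. \<Sum>a\<in>A. pd k (pd i (f a)) x)"
proof -
  have "C2 (\<lambda>x. \<Sum>a\<in>A. f a x) \<and> pd i (\<lambda>x. \<Sum>a\<in>A. f a x) = (\<lambda>x. \<Sum>a\<in>A. pd i (f a) x) \<and>
    pd k (pd i (\<lambda>x. \<Sum>a\<in>A. f a x)) = (\<lambda>x. \<Sum>a\<in>A. pd k (pd i (f a)) x)"
    using assms
  proof (induction A rule: infinite_finite_induct)
    case (insert a A)
    have IH: "C2 (\<lambda>x. \<Sum>a\<in>A. f a x)" "pd i (\<lambda>x. \<Sum>a\<in>A. f a x) = (\<lambda>x. \<Sum>a\<in>A. pd i (f a) x)"
      "pd k (pd i (\<lambda>x. \<Sum>a\<in>A. f a x)) = (\<lambda>x. \<Sum>a\<in>A. pd k (pd i (f a)) x)" and a: "C2 (f a)"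
      using insert.IH insert.prems by auto
    show ?case unfolding sum.insert[OF insert.hyps] C2_add(3)[OF a IH(1)] IH(3)
      unfolding C2_add(2)[OF a IH(1)] IH(2) using C2_add(1)[OF a IH(1)] by blast
  qed (simp_all add: C2_const C1_const)
  then show "C2 (\<lambda>x. \<Sum>a\<in>A. f a x)" "pd i (\<lambda>x. \<Sum>a\<in>A. f a x) = (\<lambda>x. \<Sum>a\<in>A. pd i (f a) x)"
    "pd k (pd i (\<lambda>x. \<Sum>a\<in>A. f a x)) = (\<lambda>x. \<Sum>a\<in>A. pd k (pd i (f a)) x)" by auto
qed

lemma shift_upd: "shift j l (x(i := x i + t)) = (shift j l x)(i - j := shift j l x (i - j) + t)"
  by (auto simp: shift_def fun_eq_iff)

lemma continuous_on_shift: "continuous_on UNIV (shift j l)"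
  unfolding shift_def by (intro continuous_on_coordinatewise_then_product continuous_intros) simp

lemma continuous_on_comp_shift:
  assumes "continuous_on UNIV f" shows "continuous_on UNIV (\<lambda>x. f (shift j l x))"
  using continuous_on_compose2[OF assms continuous_on_shift] by simp

lemma C1_shift:
  assumes "C1 f"
  shows "C1 (\<lambda>x. f (shift j l x))" "pd i (\<lambda>x. f (shift j l x)) = (\<lambda>x. pd (i - j) f (shift j l x))"
proof -
  have "((\<lambda>t. f (shift j l (x(i := x i + t)))) has_real_derivative pd (i - j) f (shift j l x)) (at 0)" for i x
    unfolding shift_upd by (rule C1_has_pd[OF assms])
  moreover have "continuous_on UNIV (\<lambda>x. pd (i - j) f (shift j l x))" for i
    using assms by (intro continuous_on_comp_shift) (simp add: C1_def)
  ultimately show "C1 (\<lambda>x. f (shift j l x))" "pd i (\<lambda>x. f (shift j l x)) = (\<lambda>x. pd (i - j) f (shift j l x))"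
    using C1I[of "\<lambda>x. f (shift j l x)" "\<lambda>i x. pd (i - j) f (shift j l x)"] by auto
qed

lemma C2_shift:
  assumes "C2 f"
  shows "C2 (\<lambda>x. f (shift j l x))" "pd i (\<lambda>x. f (shift j l x)) = (\<lambda>x. pd (i - j) f (shift j l x))"
    "pd k (pd i (\<lambda>x. f (shift j l x))) = (\<lambda>x. pd (k - j) (pd (i - j) f) (shift j l x))"
  using assms by (auto simp: C2_iff C1_shift intro: continuous_on_comp_shift)

lemma dep_shift: "depends_on T f \<Longrightarrow> depends_on ((\<lambda>t. t + j) ` T) (\<lambda>x. f (shift j l x))"
  unfolding depends_on_def by (simp add: shift_def)

lemma dderiv2_eq:
  assumes "C2 f" "finite T" "depends_on T f"
  shows "dderiv (\<lambda>y. dderiv f y w) x v = (\<Sum>k\<in>T. \<Sum>i\<in>T. pd i (pd k f) x * v i * w k)"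
proof -
  have "((\<lambda>t. \<Sum>k\<in>T. pd k f (\<lambda>i. x i + t * v i) * w k) has_real_derivative
      (\<Sum>k\<in>T. (\<Sum>i\<in>T. pd i (pd k f) (\<lambda>i. x i + 0 * v i) * v i) * w k)) (at 0)"
    using assms by (intro DERIV_sum DERIV_cmult_right C1_line dep_pd C2_pd)
  then have "((\<lambda>t. dderiv f (\<lambda>i. x i + t * v i) w) has_real_derivative
      (\<Sum>k\<in>T. \<Sum>i\<in>T. pd i (pd k f) x * v i * w k)) (at 0)"
    by (simp add: dderiv_eq[OF C2_C1[OF assms(1)] assms(2,3)] sum_distrib_right)
  then show ?thesis unfolding dderiv_def[of "\<lambda>y. dderiv f y w"] by (rule DERIV_imp_deriv)
qed

text \<open>Schwarz's argument: the second difference over a square of side \<open>h\<close> equals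
  \<open>h * h\<close> times either mixed derivative, each taken at some point of the square, and
  both points tend to \<open>x\<close>.\<close>

lemma pd_commute:
  assumes f: "C2 f"
  shows "pd i (pd k f) x = pd k (pd i f) x"
proof (cases "i = k")
  case False
  define P where "P s t = x(i := x i + s, k := x k + t)" for s t
  have P1: "P s t = (x(k := x k + t))(i := (x(k := x k + t)) i + s)" 
    and P2: "P s t = (x(i := x i + s))(k := (x(i := x i + s)) k + t)" for s t
    using False by (auto simp: P_def fun_eq_iff)
  have d1: "((\<lambda>s. g (P s t)) has_real_derivative pd i g (P s t)) (at s)"
    and d2: "((\<lambda>t. g (P s t)) has_real_derivative pd k g (P s t)) (at t)" if "C1 g" for g s t
    using C1_has_pd_at[OF that, of "x(k := x k + t)" i s] C1_has_pd_at[OF that, of "x(i := x i + s)" k t]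
    by (simp_all only: P1[symmetric] P2[symmetric])
  have ex1: "\<exists>a b. 0 < a \<and> a < h \<and> 0 < b \<and> b < h \<and> f (P h h) - f (P h 0) - f (P 0 h) + f (P 0 0) = h * h * pd k (pd i f) (P a b)"
    and ex2: "\<exists>a b. 0 < a \<and> a < h \<and> 0 < b \<and> b < h \<and> f (P h h) - f (P h 0) - f (P 0 h) + f (P 0 0) = h * h * pd i (pd k f) (P a b)"
    if h: "h > 0" for h
  proof -
    have D: "((\<lambda>s. f (P s h) - f (P s 0)) has_real_derivative pd i f (P s h) - pd i f (P s 0)) (at s)" for s
      by (intro DERIV_diff d1 C2_C1 f)
    from MVT2[OF h D] obtain a where a: "0 < a" "a < h"
      "(f (P h h) - f (P h 0)) - (f (P 0 h) - f (P 0 0)) = (h - 0) * (pd i f (P a h) - pd i f (P a 0))" by auto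
    from MVT2[OF h d2[OF C2_pd[OF f]]] obtain b where b: "0 < b" "b < h"
      "pd i f (P a h) - pd i f (P a 0) = (h - 0) * pd k (pd i f) (P a b)" by auto
    show "\<exists>a b. 0 < a \<and> a < h \<and> 0 < b \<and> b < h \<and> f (P h h) - f (P h 0) - f (P 0 h) + f (P 0 0) = h * h * pd k (pd i f) (P a b)"
      by (rule exI[of _ a], rule exI[of _ b]) (use a b in simp)
    have D: "((\<lambda>t. f (P h t) - f (P 0 t)) has_real_derivative pd k f (P h t) - pd k f (P 0 t)) (at t)" for t
      by (intro DERIV_diff d2 C2_C1 f)
    from MVT2[OF h D] obtain b where b: "0 < b" "b < h"
      "(f (P h h) - f (P 0 h)) - (f (P h 0) - f (P 0 0)) = (h - 0) * (pd k f (P h b) - pd k f (P 0 b))" by auto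
    from MVT2[OF h d1[OF C2_pd[OF f]]] obtain a where a: "0 < a" "a < h"
      "pd k f (P h b) - pd k f (P 0 b) = (h - 0) * pd i (pd k f) (P a b)" by auto
    show "\<exists>a b. 0 < a \<and> a < h \<and> 0 < b \<and> b < h \<and> f (P h h) - f (P h 0) - f (P 0 h) + f (P 0 0) = h * h * pd i (pd k f) (P a b)"
      by (rule exI[of _ a], rule exI[of _ b]) (use a b in simp)
  qed
  define h where "h n = 1 / real (Suc n)" for n
  have h: "h n > 0" for n by (simp add: h_def)
  have hlim: "h \<longlonglongrightarrow> 0" unfolding h_def using LIMSEQ_inverse_real_of_nat by (simp add: inverse_eq_divide)
  have "\<forall>n. \<exists>a b a' b'. 0 < a \<and> a < h n \<and> 0 < b \<and> b < h n \<and> 0 < a' \<and> a' < h n \<and> 0 < b' \<and> b' < h n \<and>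
      pd k (pd i f) (P a b) = pd i (pd k f) (P a' b')"
  proof
    fix n
    obtain a b where 1: "0 < a" "a < h n" "0 < b" "b < h n"
      "f (P (h n) (h n)) - f (P (h n) 0) - f (P 0 (h n)) + f (P 0 0) = h n * h n * pd k (pd i f) (P a b)"
      using ex1[OF h] by blast
    obtain a' b' where 2: "0 < a'" "a' < h n" "0 < b'" "b' < h n"
      "f (P (h n) (h n)) - f (P (h n) 0) - f (P 0 (h n)) + f (P 0 0) = h n * h n * pd i (pd k f) (P a' b')"
      using ex2[OF h] by blast
    have "pd k (pd i f) (P a b) = pd i (pd k f) (P a' b')" using 1(5) 2(5) h[of n] by simp
    with 1(1-4) 2(1-4) show "\<exists>a b a' b'. 0 < a \<and> a < h n \<and> 0 < b \<and> b < h n \<and> 0 < a' \<and> a' < h n \<and> 0 < b' \<and> b' < h n \<and>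
      pd k (pd i f) (P a b) = pd i (pd k f) (P a' b')" by blast
  qed
  then obtain a b a' b' where ab: "\<And>n. 0 < a n \<and> a n < h n \<and> 0 < b n \<and> b n < h n \<and> 0 < a' n \<and> a' n < h n \<and> 0 < b' n \<and> b' n < h n"
      and eq: "\<And>n. pd k (pd i f) (P (a n) (b n)) = pd i (pd k f) (P (a' n) (b' n))" by metis
  have sq: "u \<longlonglongrightarrow> 0" if "\<And>n. 0 < u n \<and> u n < h n" for u
    by (rule tendsto_sandwich[OF _ _ tendsto_const hlim]) (use that in \<open>auto intro!: always_eventually less_imp_le\<close>)
  have Plim: "(\<lambda>n. P (u n) (w n)) \<longlonglongrightarrow> x" if "u \<longlonglongrightarrow> 0" "w \<longlonglongrightarrow> 0" for u w
  proof (rule tendsto_fun)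
    fix m
    have "(\<lambda>n. x i + u n) \<longlonglongrightarrow> x i" "(\<lambda>n. x k + w n) \<longlonglongrightarrow> x k"
      using that by (auto intro!: tendsto_eq_intros)
    then show "(\<lambda>n. P (u n) (w n) m) \<longlonglongrightarrow> x m" using False by (cases "m = k"; cases "m = i") (auto simp: P_def)
  qed
  have "(\<lambda>n. pd k (pd i f) (P (a n) (b n))) \<longlonglongrightarrow> pd k (pd i f) x"
    by (rule continuous_on_tendsto_compose[OF C2_cont_pd2[OF f] Plim]) (use ab sq in auto)
  moreover have "(\<lambda>n. pd i (pd k f) (P (a' n) (b' n))) \<longlonglongrightarrow> pd i (pd k f) x"
    by (rule continuous_on_tendsto_compose[OF C2_cont_pd2[OF f] Plim]) (use ab sq in auto)
  ultimately show ?thesis using eq LIMSEQ_unique by simp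
qed simp

section \<open>The lattice of periods\<close>

definition lat :: "('d::finite \<Rightarrow> int ^ 'd) \<Rightarrow> ('d \<Rightarrow> int) \<Rightarrow> int ^ 'd" where
  "lat p c = (\<Sum>m\<in>UNIV. c m *s p m)"

lemma lat_nth: "lat p c $ i = (\<Sum>m\<in>UNIV. c m * p m $ i)"
  by (simp add: lat_def)

lemma lat_add: "lat p (\<lambda>m. c m + c' m) = lat p c + lat p c'"
  by (simp add: lat_def vec_eq_iff distrib_right sum.distrib)

lemma lat_diff: "lat p (\<lambda>m. c m - c' m) = lat p c - lat p c'"
  by (simp add: lat_def vec_eq_iff left_diff_distrib sum_subtractf)

lemma lat_0: "lat p (\<lambda>m. 0) = 0"
  by (simp add: lat_def vec_eq_iff)

lemma translate_int_multiple:
  fixes x :: "'d::finite config"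
  assumes "\<And>i. x (i + k) + a = x i"
  shows "x (i + n *s k) + real_of_int n * a = x i"
proof (induction n arbitrary: i rule: int_induct[where k = 0])
  case base
  then show ?case by simp
next
  case (step1 n)
  have "i + (n + 1) *s k = (i + n *s k) + k" by (simp add: vec_eq_iff algebra_simps)
  then show ?case using step1.IH[of i] assms[of "i + n *s k"] by (simp add: algebra_simps)
next
  case (step2 n)
  have "i + n *s k = (i + (n - 1) *s k) + k" by (simp add: vec_eq_iff algebra_simps)
  then show ?case using step2.IH[of i] assms[of "i + (n - 1) *s k"] by (simp add: algebra_simps)
qed

lemma translate_lat:
  fixes x :: "'d::finite config"
  assumes "\<And>i m. x (i + p m) + Q m = x i"
  shows "x (i + lat p c) + (\<Sum>m\<in>UNIV. real_of_int (c m) * Q m) = x i"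
proof -
  have "x (i + (\<Sum>m\<in>A. c m *s p m)) + (\<Sum>m\<in>A. real_of_int (c m) * Q m) = x i" if "finite A" for A :: "'d set"
    using that
  proof (induction A)
    case empty
    then show ?case by simp
  next
    case (insert m A)
    have "x (i + (\<Sum>m\<in>A. c m *s p m) + c m *s p m) + real_of_int (c m) * Q m = x (i + (\<Sum>m\<in>A. c m *s p m))"
      by (rule translate_int_multiple[where x = x and k = "p m" and a = "Q m"]) (rule assms)
    with insert show ?case by (simp add: add_ac)
  qed
  from this[of UNIV] show ?thesis by (simp add: lat_def)
qed

lemma Xpq_iff: "x \<in> Xpq p q \<longleftrightarrow> (\<forall>m i. x (i + p m) + real_of_int (q m) = x i)"
  by (auto simp: Xpq_def shift_def fun_eq_iff)

lemma Xpq_lat: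
  assumes "x \<in> Xpq p q"
  shows "x (i + lat p c) + real_of_int (\<Sum>m\<in>UNIV. c m * q m) = x i"
  using translate_lat[of x p "\<lambda>m. real_of_int (q m)"] assms by (simp add: Xpq_iff)

lemma Vp_lat:
  assumes "v \<in> Vp p" shows "v (i + lat p c) = v i"
  using translate_lat[of v p "\<lambda>m. 0"] assms by (simp add: Vp_def)

lemma inner_int_scale: "inner_int (n *s k) \<omega> = real_of_int n * inner_int k \<omega>"
  by (simp add: inner_int_def sum_distrib_left mult_ac)

lemma inner_int_lat: "inner_int (lat p c) \<omega> = (\<Sum>m\<in>UNIV. real_of_int (c m) * inner_int (p m) \<omega>)"
proof -
  have "inner_int (lat p c) \<omega> = (\<Sum>i\<in>UNIV. \<Sum>m\<in>UNIV. real_of_int (c m) * (real_of_int (p m $ i) * \<omega> $ i))"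
    by (simp add: inner_int_def lat_nth sum_distrib_left sum_distrib_right mult_ac)
  also have "\<dots> = (\<Sum>m\<in>UNIV. real_of_int (c m) * inner_int (p m) \<omega>)"
    by (subst sum.swap) (simp add: inner_int_def sum_distrib_left)
  finally show ?thesis .
qed

lemma common_denominator:
  fixes \<omega> :: "real ^ 'd::finite"
  assumes "\<forall>m. \<omega> $ m \<in> \<rat>"
  shows "\<exists>M::int. M > 0 \<and> (\<forall>m. real_of_int M * \<omega> $ m \<in> \<int>)"
proof -
  have "\<exists>M::int. M > 0 \<and> (\<forall>m\<in>A. real_of_int M * \<omega> $ m \<in> \<int>)" if "finite A" for A :: "'d set"
    using that
  proof (induction A)
    case empty
    then show ?case by (intro exI[of _ 1]) simp
  next
    case (insert a A)
    then obtain M where M: "M > 0" "\<forall>m\<in>A. real_of_int M * \<omega> $ m \<in> \<int>" by blast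
    obtain r s where rs: "s > 0" "\<omega> $ a = of_int r / of_int s"
      using Rats_cases'[OF assms[rule_format, of a]] by metis
    have "real_of_int (M * s) * \<omega> $ m \<in> \<int>" if "m \<in> insert a A" for m
    proof (cases "m = a")
      case True
      then show ?thesis using rs by simp
    next
      case False
      then have "real_of_int M * \<omega> $ m \<in> \<int>" using M(2) that by blast
      then have "real_of_int s * (real_of_int M * \<omega> $ m) \<in> \<int>" by (rule Ints_mult[OF Ints_of_int])
      then show ?thesis by (simp add: mult_ac)
    qed
    then show ?case using M rs by (intro exI[of _ "M * s"]) auto
  qed
  from this[of UNIV] show ?thesis by simp
qed

lemma finite_bounded_vec:
  fixes A :: "(int ^ 'd::finite) set"
  assumes "\<And>k i. k \<in> A \<Longrightarrow> \<bar>k $ i\<bar> \<le> B"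
  shows "finite A"
proof -
  have "vec_nth ` A \<subseteq> PiE UNIV (\<lambda>_. {-B..B})" using assms by (auto simp: abs_le_iff minus_le_iff)
  then have "finite (vec_nth ` A)" by (rule finite_subset) (auto intro: finite_PiE)
  then show ?thesis by (rule finite_imageD) (auto simp: inj_on_def vec_nth_inject)
qed

locale periods =
  fixes \<omega> :: "real ^ 'd::finite" and p :: "'d \<Rightarrow> int ^ 'd" and q :: "'d \<Rightarrow> int"
  assumes rational: "\<forall>m. \<omega> $ m \<in> \<rat>" and principal: "principal_periods \<omega> p q"
begin

lemma inner_p: "inner_int (p m) \<omega> = - real_of_int (q m)"
proof -
  have "(p m, q m) \<in> I_omega \<omega>" using principal by (simp add: principal_periods_def)
  then show ?thesis by (simp add: I_omega_def)
qed

text \<open>Principality enters through this fact: the periods generate every integer vector whose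
  product with \<open>\<omega>\<close> is an integer, not merely a sublattice of finite
  index.\<close>

lemma in_latI:
  assumes "inner_int k \<omega> \<in> \<int>" shows "\<exists>c. k = lat p c"
proof -
  obtain l where l: "inner_int k \<omega> = real_of_int l" using assms Ints_cases by blast
  then have "(k, - l) \<in> I_omega \<omega>" by (simp add: I_omega_def)
  with principal show ?thesis unfolding principal_periods_def lat_def by fast
qed

text \<open>A common denominator of the entries of \<open>\<omega>\<close> works as
  \<open>M\<close>. Rationality thereby makes the period lattice have full rank.\<close>

lemma multiple_in_lat: "\<exists>M>0. \<forall>k. \<exists>c. M *s k = lat p c"
proof -
  obtain M :: int where M: "M > 0" "\<forall>m. real_of_int M * \<omega> $ m \<in> \<int>"
    using common_denominator[OF rational] by blast
  have "inner_int (M *s k) \<omega> \<in> \<int>" for k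
  proof -
    have "inner_int (M *s k) \<omega> = (\<Sum>m\<in>UNIV. real_of_int (k $ m) * (real_of_int M * \<omega> $ m))"
      by (simp add: inner_int_def mult_ac)
    also have "\<dots> \<in> \<int>" by (rule Ints_sum, rule Ints_mult[OF Ints_of_int]) (use M(2) in blast)
    finally show ?thesis .
  qed
  then show ?thesis using M in_latI by blast
qed

text \<open>All periodic configurations have rotation vector \<open>\<omega>\<close>. Repeating the
  self-translation \<open>M\<close> times makes \<open>k\<close> a lattice vector, and comparison
  with periodicity gives \<open>inner_int k \<omega> = l\<close>, an integer.\<close>

lemma Xpq_free:
  assumes x: "x \<in> Xpq p q" and sh: "\<And>i. x (i + k) = x i + real_of_int l"
  shows "\<exists>c. k = lat p c"
proof -
  obtain M c where M: "M > 0" "M *s k = lat p c" using multiple_in_lat by blast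
  have "x (0 + M *s k) + real_of_int M * - real_of_int l = x 0"
    by (rule translate_int_multiple[where x = x and k = k]) (simp add: sh)
  moreover have "x (0 + lat p c) + real_of_int (\<Sum>m\<in>UNIV. c m * q m) = x 0"
    by (rule Xpq_lat[OF x])
  ultimately have "real_of_int (\<Sum>m\<in>UNIV. c m * q m) = - real_of_int M * real_of_int l" using M by simp
  moreover have "real_of_int M * inner_int k \<omega> = - real_of_int (\<Sum>m\<in>UNIV. c m * q m)"
    using inner_int_scale[of M k \<omega>] inner_int_lat[of p c \<omega>] M(2) by (simp add: inner_p sum_negf)
  ultimately have "inner_int k \<omega> = real_of_int l" using M(1) by simp
  then show ?thesis by (intro in_latI) simp
qed

section \<open>The half-open parallelepiped as a fundamental domain\<close>

definition plin :: "real ^ 'd \<Rightarrow> real ^ 'd" where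
  "plin t = (\<chi> i. \<Sum>m\<in>UNIV. t $ m * real_of_int (p m $ i))"

lemma linear_plin: "linear plin"
  by (rule linearI) (simp_all add: plin_def vec_eq_iff distrib_left distrib_right sum.distrib sum_distrib_left mult_ac)

lemma plin_of_int: "plin (\<chi> m. real_of_int (c m)) = (\<chi> i. real_of_int (lat p c $ i))"
  by (simp add: plin_def lat_nth)

text \<open>A multiple of each unit vector lies in the lattice, so the real span of the periods is
  everything; injectivity then follows by dimension.\<close>

lemma surj_plin: "surj plin"
proof -
  obtain M where M: "M > 0" "\<forall>k. \<exists>c. M *s k = lat p c" using multiple_in_lat by blast
  then obtain C where C: "\<And>k. M *s k = lat p (C k)" by metis
  have "axis i 1 \<in> range plin" for i
  proof -
    have "plin (\<chi> m. real_of_int (C (axis i 1) m)) = (\<chi> j. real_of_int ((M *s axis i 1) $ j))"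
      by (simp only: plin_of_int C)
    also have "\<dots> = real_of_int M *\<^sub>R axis i 1" by (simp add: vec_eq_iff axis_def)
    finally have "plin ((1 / real_of_int M) *\<^sub>R (\<chi> m. real_of_int (C (axis i 1) m))) = axis i 1"
      using M(1) by (simp add: linear_cmul[OF linear_plin])
    then show ?thesis by (metis rangeI)
  qed
  then have "Basis \<subseteq> range plin" by (auto simp: Basis_vec_def)
  then have "span Basis \<subseteq> range plin"
    by (rule span_minimal) (simp add: linear_subspace_image[OF linear_plin])
  then show ?thesis by auto
qed

lemma inj_plin: "inj plin"
  by (rule linear_surjective_imp_injective[OF linear_plin surj_plin refl])

lemma Bp_iff: "k \<in> Bp p \<longleftrightarrow> (\<exists>t. (\<forall>m. 0 \<le> t $ m \<and> t $ m < 1) \<and> plin t = (\<chi> i. real_of_int (k $ i)))"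
proof
  assume "k \<in> Bp p"
  then obtain t where "\<forall>m. 0 \<le> t m \<and> t m < 1" "\<forall>i. real_of_int (k $ i) = (\<Sum>m\<in>UNIV. t m * real_of_int (p m $ i))"
    unfolding Bp_def by blast
  then show "\<exists>t. (\<forall>m. 0 \<le> t $ m \<and> t $ m < 1) \<and> plin t = (\<chi> i. real_of_int (k $ i))"
    by (intro exI[of _ "\<chi> m. t m"]) (simp add: plin_def)
next
  assume "\<exists>t. (\<forall>m. 0 \<le> t $ m \<and> t $ m < 1) \<and> plin t = (\<chi> i. real_of_int (k $ i))"
  then obtain t where "\<forall>m. 0 \<le> t $ m \<and> t $ m < 1" "plin t = (\<chi> i. real_of_int (k $ i))" by blast
  then show "k \<in> Bp p" unfolding Bp_def
    by (intro CollectI exI[of _ "\<lambda>m. t $ m"]) (simp add: plin_def vec_eq_iff)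
qed

lemma Bp_rep: "\<exists>b\<in>Bp p. \<exists>c. k = b + lat p c"
proof -
  obtain t where t: "plin t = (\<chi> i. real_of_int (k $ i))" using surj_plin by (metis surjD)
  define c where "c m = \<lfloor>t $ m\<rfloor>" for m
  have "plin (t - (\<chi> m. real_of_int (c m))) = (\<chi> i. real_of_int ((k - lat p c) $ i))"
    unfolding linear_diff[OF linear_plin] t plin_of_int by (simp add: vec_eq_iff)
  moreover have "0 \<le> (t - (\<chi> m. real_of_int (c m))) $ m \<and> (t - (\<chi> m. real_of_int (c m))) $ m < 1" for m
    by (simp add: c_def) linarith
  ultimately have "k - lat p c \<in> Bp p" unfolding Bp_iff by blast
  then show ?thesis by (intro bexI[of _ "k - lat p c"] exI[of _ c]) auto
qed

lemma Bp_unique: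
  assumes "b \<in> Bp p" "b' \<in> Bp p" "b = b' + lat p c" shows "b = b'"
proof -
  obtain t where t: "\<forall>m. 0 \<le> t $ m \<and> t $ m < 1" "plin t = (\<chi> i. real_of_int (b $ i))"
    using assms Bp_iff by blast
  obtain t' where t': "\<forall>m. 0 \<le> t' $ m \<and> t' $ m < 1" "plin t' = (\<chi> i. real_of_int (b' $ i))"
    using assms Bp_iff by blast
  have "plin t = plin (t' + (\<chi> m. real_of_int (c m)))"
    unfolding linear_add[OF linear_plin] t t' plin_of_int assms(3) by (simp add: vec_eq_iff)
  then have "t = t' + (\<chi> m. real_of_int (c m))" using inj_plin by (simp add: inj_eq)
  then have "t $ m - t' $ m = real_of_int (c m)" for m by simp
  moreover have "\<bar>t $ m - t' $ m\<bar> < 1" for m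
    using t(1)[rule_format, of m] t'(1)[rule_format, of m] by linarith
  ultimately have "\<bar>real_of_int (c m)\<bar> < 1" for m by simp
  then have "\<bar>c m\<bar> < 1" for m by (metis of_int_abs of_int_less_1_iff)
  then have "c = (\<lambda>m. 0)" by (auto simp: fun_eq_iff)
  then show ?thesis using assms(3) by (simp add: lat_0)
qed

lemma finite_Bp: "finite (Bp p)"
proof -
  define B where "B = (\<Sum>i\<in>UNIV. \<Sum>m\<in>UNIV. \<bar>p m $ i\<bar>)"
  have "\<bar>k $ i\<bar> \<le> B" if "k \<in> Bp p" for k i
  proof -
    from that obtain t where t': "(\<forall>m. 0 \<le> t m \<and> t m < 1) \<and> (\<forall>i. real_of_int (k $ i) = (\<Sum>m\<in>UNIV. t m * real_of_int (p m $ i)))"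
      unfolding Bp_def mem_Collect_eq ..
    note t = conjunct1[OF t'] conjunct2[OF t']
    have "real_of_int \<bar>k $ i\<bar> \<le> (\<Sum>m\<in>UNIV. \<bar>t m * real_of_int (p m $ i)\<bar>)" unfolding t(2)[rule_format] of_int_abs by (rule sum_abs)
    also have "\<dots> \<le> (\<Sum>m\<in>UNIV. real_of_int \<bar>p m $ i\<bar>)"
    proof (rule sum_mono)
      fix m
      show "\<bar>t m * real_of_int (p m $ i)\<bar> \<le> real_of_int \<bar>p m $ i\<bar>"
        using t(1)[rule_format, of m] by (simp add: abs_mult mult_left_le_one_le)
    qed
    also have "\<dots> = real_of_int (\<Sum>m\<in>UNIV. \<bar>p m $ i\<bar>)" by simp
    also have "\<dots> \<le> real_of_int B" unfolding B_def of_int_le_iff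
      by (intro member_le_sum) (auto intro: sum_nonneg)
    finally show ?thesis by linarith
  qed
  then show ?thesis by (rule finite_bounded_vec)
qed

lemma Bp_nonempty: "Bp p \<noteq> {}"
  using Bp_rep[of 0] by blast

text \<open>The indicator of a coset of the period lattice. For \<open>k \<in> Bp p\<close> these
  functions are the coordinate basis of \<open>Vp p\<close>, so the index set of the
  finite-dimensional arguments can be \<open>Bp p\<close> itself.\<close>

definition ind :: "int ^ 'd \<Rightarrow> 'd config" where
  "ind k i = (if \<exists>c. i = k + lat p c then 1 else 0)"

lemma ind_Vp: "ind k \<in> Vp p"
proof -
  have "(\<exists>c. i + p m = k + lat p c) \<longleftrightarrow> (\<exists>c. i = k + lat p c)" for i m
  proof -
    define u where "u = (\<lambda>n. if n = m then 1 else 0 :: int)"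
    have u: "lat p u = p m" unfolding lat_def vec_eq_iff u_def by (simp add: if_distrib[of "\<lambda>a. a * _"] cong: if_cong)
    show ?thesis
    proof
      assume "\<exists>c. i + p m = k + lat p c"
      then obtain c where "i + p m = k + lat p c" by blast
      then have "i = k + lat p (\<lambda>n. c n - u n)" by (simp add: lat_diff u algebra_simps)
      then show "\<exists>c. i = k + lat p c" by blast
    next
      assume "\<exists>c. i = k + lat p c"
      then obtain c where "i = k + lat p c" by blast
      then have "i + p m = k + lat p (\<lambda>n. c n + u n)" by (simp add: lat_add u)
      then show "\<exists>c. i + p m = k + lat p c" by blast
    qed
  qed
  then show ?thesis by (simp add: Vp_def ind_def)
qed

lemma ind_Bp:
  assumes "k \<in> Bp p" "b \<in> Bp p" shows "ind k b = (if b = k then 1 else 0)"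
proof -
  have "\<exists>c. k = k + lat p c" using lat_0[of p] by (intro exI[of _ "\<lambda>m. 0"]) simp
  then show ?thesis using Bp_unique[OF assms(2,1)] unfolding ind_def by auto
qed

lemma Vp_expand:
  assumes "v \<in> Vp p" shows "v i = (\<Sum>k\<in>Bp p. v k * ind k i)"
proof -
  obtain b c where b: "b \<in> Bp p" "i = b + lat p c" using Bp_rep by blast
  have "ind k i = ind k b" for k using Vp_lat[OF ind_Vp] b by simp
  then have "(\<Sum>k\<in>Bp p. v k * ind k i) = (\<Sum>k\<in>Bp p. v k * (if b = k then 1 else 0))"
    using b by (intro sum.cong) (auto simp: ind_Bp)
  also have "\<dots> = v b" using b finite_Bp by (simp add: if_distrib cong: if_cong)
  also have "\<dots> = v i" using Vp_lat[OF assms] b by simp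
  finally show ?thesis by simp
qed

lemma Xpq_diff:
  assumes "x \<in> Xpq p q" "y \<in> Xpq p q" shows "(\<lambda>i. y i - x i) \<in> Vp p"
proof -
  have "y (i + p m) - x (i + p m) = y i - x i" for i m
  proof -
    have "x (i + p m) + real_of_int (q m) = x i" "y (i + p m) + real_of_int (q m) = y i"
      using assms unfolding Xpq_iff by blast+
    then show ?thesis by linarith
  qed
  then show ?thesis by (simp add: Vp_def)
qed

text \<open>Carries sup estimates from the finitely many coordinates in \<open>Bp p\<close> to all
  sites, where the compact sets are defined.\<close>

lemma Vp_bounded_by_Bp:
  assumes "v \<in> Vp p" "\<And>k. k \<in> Bp p \<Longrightarrow> \<bar>v k\<bar> \<le> r" shows "\<bar>v i\<bar> \<le> r"
  using Bp_rep[of i] Vp_lat[OF assms(1)] assms(2) by metis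

text \<open>If \<open>x s - x t\<close> exceeds \<open>l\<close>, the Birkhoff property orders the
  whole configuration against its translate by \<open>(t - s, l)\<close>. Iterating \<open>M\<close>
  times reaches a period, and periodicity gives \<open>M * l \<le> Q\<close>. This fails for
  \<open>l = \<bar>Q\<bar> + 1\<close>, a bound that does not depend on \<open>x\<close>.\<close>

lemma birkhoff_bounded: "\<exists>B. \<forall>x \<in> birkhoff \<inter> Xpq p q. \<bar>x s - x t\<bar> \<le> B"
proof -
  have "\<exists>B. \<forall>x \<in> birkhoff \<inter> Xpq p q. x s - x t \<le> B" for s t
  proof -
    obtain M c where M: "M > 0" "M *s (t - s) = lat p c" using multiple_in_lat by blast
    define Q where "Q = (\<Sum>m\<in>UNIV. c m * q m)"
    define l where "l = \<bar>Q\<bar> + 1"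
    have "x s - x t \<le> real_of_int l" if x: "x \<in> birkhoff" "x \<in> Xpq p q" for x
    proof (rule ccontr)
      assume "\<not> x s - x t \<le> real_of_int l"
      then have "\<not> (\<forall>i. shift (t - s) l x i \<ge> x i)"
        by (auto simp: shift_def intro!: exI[of _ s])
      then have le: "x (i + (t - s)) + real_of_int l \<le> x i" for i
        using x(1) unfolding birkhoff_def shift_def by blast
      have it: "x (i + (int n) *s (t - s)) + real n * real_of_int l \<le> x i" for n i
      proof (induction n)
        case (Suc n)
        have "i + int (Suc n) *s (t - s) = (i + int n *s (t - s)) + (t - s)"
          by (simp add: vec_eq_iff algebra_simps)
        then show ?case using le[of "i + int n *s (t - s)"] Suc by (simp add: algebra_simps)
      qed simp
      have "x (0 + lat p c) + real_of_int M * real_of_int l \<le> x 0"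
        using it[of 0 "nat M"] M by simp
      moreover have "x (0 + lat p c) + real_of_int Q = x 0"
        unfolding Q_def by (rule Xpq_lat[OF x(2)])
      ultimately have "real_of_int M * real_of_int l \<le> real_of_int Q" by linarith
      then have "M * l \<le> Q" by (metis of_int_le_iff of_int_mult)
      moreover have "1 * l \<le> M * l" using M by (intro mult_right_mono) (auto simp: l_def)
      ultimately show False using l_def by linarith
    qed
    then show ?thesis by blast
  qed
  from this[of s t] this[of t s] obtain B B'
    where BB: "\<forall>x \<in> birkhoff \<inter> Xpq p q. x s - x t \<le> B" "\<forall>x \<in> birkhoff \<inter> Xpq p q. x t - x s \<le> B'" by blast
  have "\<bar>x s - x t\<bar> \<le> max B B'" if "x \<in> birkhoff \<inter> Xpq p q" for x
  proof -
    have "x s - x t \<le> B" "x t - x s \<le> B'" using that BB by blast+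
    then show ?thesis by linarith
  qed
  then show ?thesis by blast
qed

end

section \<open>Generic perturbations are Morse\<close>

text \<open>Periodic directions move infinitely many sites at once; dependence on finitely many of
  them turns directional derivatives into finite sums of partial derivatives.\<close>

definition smooth :: "('d::finite config \<Rightarrow> real) \<Rightarrow> bool" where
  "smooth f \<longleftrightarrow> C2 f \<and> (\<exists>T. finite T \<and> depends_on T f)"

lemma smooth_const: "smooth (\<lambda>x. c)"
  unfolding smooth_def using C2_const dep_const finite.emptyI by blast

lemma smooth_add:
  assumes "smooth f" "smooth g" shows "smooth (\<lambda>x. f x + g x)"
proof -
  obtain T U where "finite T" "depends_on T f" "finite U" "depends_on U g" using assms smooth_def by blast
  then have "finite (T \<union> U)" "depends_on (T \<union> U) (\<lambda>x. f x + g x)"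
    by (auto intro: dep_add dep_mono)
  then show ?thesis using assms C2_add(1) unfolding smooth_def by blast
qed

lemma smooth_cmult: "smooth f \<Longrightarrow> smooth (\<lambda>x. c * f x)"
  unfolding smooth_def using C2_cmult(1) dep_mult[OF dep_const] by blast

lemma smooth_sum: "(\<And>a. a \<in> A \<Longrightarrow> smooth (f a)) \<Longrightarrow> smooth (\<lambda>x. \<Sum>a\<in>A. f a x)"
  by (induction A rule: infinite_finite_induct) (auto intro: smooth_const smooth_add)

lemma smooth_has_dderiv:
  assumes "smooth f"
  shows "((\<lambda>t. f (\<lambda>i. x i + t * v i)) has_real_derivative dderiv f (\<lambda>i. x i + s * v i) v) (at s)"
proof -
  obtain T where T: "C2 f" "finite T" "depends_on T f" using assms smooth_def by blast
  show ?thesis unfolding dderiv_eq[OF C2_C1[OF T(1)] T(2,3)] by (rule C1_line[OF C2_C1[OF T(1)] T(2,3)])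
qed

lemma smooth_has_dderiv2:
  assumes "smooth f"
  shows "((\<lambda>t. dderiv f (\<lambda>i. x i + t * v i) w) has_real_derivative dderiv (\<lambda>y. dderiv f y w) (\<lambda>i. x i + s * v i) v) (at s)"
proof -
  obtain T where T: "C2 f" "finite T" "depends_on T f" using assms smooth_def by blast
  have "((\<lambda>t. \<Sum>k\<in>T. pd k f (\<lambda>i. x i + t * v i) * w k) has_real_derivative
      (\<Sum>k\<in>T. (\<Sum>i\<in>T. pd i (pd k f) (\<lambda>i. x i + s * v i) * v i) * w k)) (at s)"
    using T by (intro DERIV_sum DERIV_cmult_right C1_line dep_pd C2_pd)
  then show ?thesis
    unfolding dderiv2_eq[OF T] unfolding dderiv_eq[OF C2_C1[OF T(1)] T(2,3)] sum_distrib_right .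
qed

lemma dderivI: "((\<lambda>t. f (\<lambda>i. x i + t * v i)) has_real_derivative d) (at 0) \<Longrightarrow> dderiv f x v = d"
  unfolding dderiv_def by (rule DERIV_imp_deriv)

lemma dderiv_add:
  assumes "smooth f" "smooth g"
  shows "dderiv (\<lambda>x. f x + g x) x v = dderiv f x v + dderiv g x v"
  using DERIV_add[OF smooth_has_dderiv[OF assms(1), of x v 0] smooth_has_dderiv[OF assms(2), of x v 0]]
  by (simp add: dderiv_def DERIV_imp_deriv)

lemma dderiv_cmult:
  assumes "smooth f"
  shows "dderiv (\<lambda>x. c * f x) x v = c * dderiv f x v"
  using DERIV_cmult[OF smooth_has_dderiv[OF assms, of x v 0], of c]
  by (simp add: dderiv_def DERIV_imp_deriv)

lemma dderiv_sum:
  assumes "\<And>a. a \<in> A \<Longrightarrow> smooth (f a)"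
  shows "dderiv (\<lambda>x. \<Sum>a\<in>A. f a x) x v = (\<Sum>a\<in>A. dderiv (f a) x v)"
proof -
  have "((\<lambda>t. \<Sum>a\<in>A. f a (\<lambda>i. x i + t * v i)) has_real_derivative (\<Sum>a\<in>A. dderiv (f a) x v)) (at 0)"
    using smooth_has_dderiv[OF assms, of _ x v 0] by (intro DERIV_sum) simp
  then show ?thesis by (simp add: dderiv_def DERIV_imp_deriv)
qed

lemma dderiv_lincomb:
  assumes "smooth W" "\<And>a. a \<in> A \<Longrightarrow> smooth (f a)"
  shows "dderiv (\<lambda>x. W x + (\<Sum>a\<in>A. c a * f a x)) x v = dderiv W x v + (\<Sum>a\<in>A. c a * dderiv (f a) x v)"
  using assms by (simp add: dderiv_add dderiv_sum dderiv_cmult smooth_sum smooth_cmult)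

lemma dderiv2_lincomb:
  assumes "smooth W" "\<And>a. a \<in> A \<Longrightarrow> smooth (f a)"
  shows "dderiv (\<lambda>y. dderiv (\<lambda>x. W x + (\<Sum>a\<in>A. c a * f a x)) y w) x v =
    dderiv (\<lambda>y. dderiv W y w) x v + (\<Sum>a\<in>A. c a * dderiv (\<lambda>y. dderiv (f a) y w) x v)"
proof -
  have 1: "((\<lambda>t. dderiv g (\<lambda>i. x i + t * v i) w) has_real_derivative dderiv (\<lambda>y. dderiv g y w) x v) (at 0)"
    if "smooth g" for g using smooth_has_dderiv2[OF that, of x v w 0] by simp
  have "((\<lambda>t. dderiv W (\<lambda>i. x i + t * v i) w + (\<Sum>a\<in>A. c a * dderiv (f a) (\<lambda>i. x i + t * v i) w)) has_real_derivative
     dderiv (\<lambda>y. dderiv W y w) x v + (\<Sum>a\<in>A. c a * dderiv (\<lambda>y. dderiv (f a) y w) x v)) (at 0)"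
    using assms by (intro DERIV_add DERIV_sum DERIV_cmult 1)
  moreover have "(\<lambda>y. dderiv (\<lambda>x. W x + (\<Sum>a\<in>A. c a * f a x)) y w) =
      (\<lambda>y. dderiv W y w + (\<Sum>a\<in>A. c a * dderiv (f a) y w))"
    by (rule ext, rule dderiv_lincomb) (use assms in auto)
  ultimately show ?thesis by (simp only: dderivI)
qed

section \<open>Sup-norm balls in the product topology\<close>

lemma compact_sup_cball: "compact {y :: 'a \<Rightarrow> real. \<forall>i. \<bar>y i - x i\<bar> \<le> r}"
proof -
  have "{y :: 'a \<Rightarrow> real. \<forall>i. \<bar>y i - x i\<bar> \<le> r} = PiE UNIV (\<lambda>i. cball (x i) r)"
    by (auto simp: dist_real_def abs_minus_commute)
  moreover have "compactin (product_topology (\<lambda>i. euclidean) UNIV) (PiE UNIV (\<lambda>i. cball (x i) r))"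
    unfolding compactin_PiE by simp
  ultimately show ?thesis by (simp add: euclidean_product_topology)
qed

lemma closed_Xpq: "closed (Xpq p q)"
  unfolding Xpq_iff[abs_def] Xpq_def shift_def fun_eq_iff
  by (intro closed_Collect_all closed_Collect_eq continuous_intros) simp_all

lemma closed_Vp: "closed (Vp p)"
  unfolding Vp_def by (intro closed_Collect_all closed_Collect_eq) simp_all

lemma tendsto_fun_sup:
  fixes y z :: "nat \<Rightarrow> 'a \<Rightarrow> real"
  assumes "\<And>n i. \<bar>y n i - z n i\<bar> \<le> \<delta> n" "\<delta> \<longlonglongrightarrow> 0" "z \<longlonglongrightarrow> x"
  shows "y \<longlonglongrightarrow> x"
proof (rule tendsto_fun)
  fix i
  have "(\<lambda>n. y n i - z n i) \<longlonglongrightarrow> 0"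
    by (rule Lim_null_comparison[OF _ assms(2)]) (use assms(1) in auto)
  moreover have "(\<lambda>n. z n i) \<longlonglongrightarrow> x i"
    by (rule continuous_on_tendsto_compose[of UNIV "\<lambda>f. f i", OF _ assms(3)]) auto
  ultimately have "(\<lambda>n. (y n i - z n i) + z n i) \<longlonglongrightarrow> 0 + x i" by (rule tendsto_add)
  then show "(\<lambda>n. y n i) \<longlonglongrightarrow> x i" by simp
qed

text \<open>The sup-distance induces a topology finer than the product topology: a sequence
  converging to \<open>x\<close> uniformly over all sites converges coordinatewise, hence eventually
  enters \<open>U\<close>.\<close>

lemma open_contains_sup_ball:
  fixes U :: "('a \<Rightarrow> real) set"
  assumes "open U" "x \<in> U"
  shows "\<exists>r>0. \<forall>y. (\<forall>i. \<bar>y i - x i\<bar> \<le> r) \<longrightarrow> y \<in> U"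
proof (rule ccontr)
  assume "\<not> ?thesis"
  then have "\<forall>n. \<exists>y. (\<forall>i. \<bar>y i - x i\<bar> \<le> inverse (real (Suc n))) \<and> y \<notin> U"
    by (metis inverse_positive_iff_positive of_nat_0_less_iff zero_less_Suc)
  then obtain y where y: "\<And>n i. \<bar>y n i - x i\<bar> \<le> inverse (real (Suc n))" "\<And>n. y n \<notin> U" by metis
  have "y \<longlonglongrightarrow> x"
    by (rule tendsto_fun_sup[OF _ LIMSEQ_inverse_real_of_nat, of _ "\<lambda>n. x"]) (use y in auto)
  then have "\<forall>\<^sub>F n in sequentially. y n \<in> U" using assms by (rule topological_tendstoD)
  then show False using y(2) by (simp add: eventually_sequentially)
qed

text \<open>Countability of the index set makes the product first countable, so compact sets are
  sequentially compact; two sequences at vanishing sup-distance then share a limit along a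
  subsequence.\<close>

lemma uniformly_continuous_sup:
  fixes h :: "('a::countable \<Rightarrow> real) \<Rightarrow> real"
  assumes K: "compact K" and h: "continuous_on UNIV h" and e: "\<epsilon> > 0"
  shows "\<exists>\<delta>>0. \<forall>y\<in>K. \<forall>y'\<in>K. (\<forall>i. \<bar>y' i - y i\<bar> \<le> \<delta>) \<longrightarrow> \<bar>h y' - h y\<bar> \<le> \<epsilon>"
proof (rule ccontr)
  assume "\<not> ?thesis"
  then have "\<forall>n. \<exists>z. fst z \<in> K \<and> snd z \<in> K \<and> (\<forall>i. \<bar>snd z i - fst z i\<bar> \<le> inverse (real (Suc n))) \<and> \<bar>h (snd z) - h (fst z)\<bar> > \<epsilon>"
    by (simp add: not_le) (metis inverse_positive_iff_positive of_nat_0_less_iff of_nat_Suc zero_less_Suc)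
  then obtain z where z: "\<And>n. fst (z n) \<in> K" "\<And>n. snd (z n) \<in> K"
    "\<And>n i. \<bar>snd (z n) i - fst (z n) i\<bar> \<le> inverse (real (Suc n))" "\<And>n. \<bar>h (snd (z n)) - h (fst (z n))\<bar> > \<epsilon>"
    by metis
  obtain l r where r: "strict_mono (r :: nat \<Rightarrow> nat)" and l: "((\<lambda>n. fst (z n)) \<circ> r) \<longlonglongrightarrow> l"
    using seq_compactE[OF compact_imp_seq_compact[OF K], of "\<lambda>n. fst (z n)"] z(1) by blast
  have "(\<lambda>n. inverse (real (Suc (r n)))) \<longlonglongrightarrow> 0"
    using LIMSEQ_subseq_LIMSEQ[OF LIMSEQ_inverse_real_of_nat r] by (simp add: o_def)
  then have "(\<lambda>n. snd (z (r n))) \<longlonglongrightarrow> l"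
    by (rule tendsto_fun_sup[where z = "\<lambda>n. fst (z (r n))", rotated]) (use l z(3) in \<open>auto simp: o_def\<close>)
  then have "(\<lambda>n. h (snd (z (r n)))) \<longlonglongrightarrow> h l"
    by (rule continuous_on_tendsto_compose[OF h]) auto
  moreover have "(\<lambda>n. h (fst (z (r n)))) \<longlonglongrightarrow> h l"
    by (rule continuous_on_tendsto_compose[OF h]) (use l in \<open>auto simp: o_def\<close>)
  ultimately have "(\<lambda>n. \<bar>h (snd (z (r n))) - h (fst (z (r n)))\<bar>) \<longlonglongrightarrow> \<bar>h l - h l\<bar>"
    by (intro tendsto_intros)
  then have "\<bar>h l - h l\<bar> \<ge> \<epsilon>"
    by (rule LIMSEQ_le_const) (use z(4) in \<open>auto intro: less_imp_le\<close>)
  then show False using e by simp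
qed

lemma bounded_on_compact:
  fixes h :: "'a::topological_space \<Rightarrow> real"
  assumes "compact K" "continuous_on UNIV h"
  shows "\<exists>B. \<forall>x\<in>K. \<bar>h x\<bar> \<le> B"
proof -
  have "compact (h ` K)" using assms by (meson compact_continuous_image continuous_on_subset subset_UNIV)
  then have "bounded (h ` K)" by (rule compact_imp_bounded)
  then show ?thesis by (auto simp: bounded_iff)
qed

section \<open>Gradient, Hessian and degenerate critical points in periodic coordinates\<close>

context periods
begin

definition grd :: "('d config \<Rightarrow> real) \<Rightarrow> int ^ 'd \<Rightarrow> 'd config \<Rightarrow> real" where
  "grd f k x = dderiv f x (ind k)"

definition hss :: "('d config \<Rightarrow> real) \<Rightarrow> int ^ 'd \<Rightarrow> int ^ 'd \<Rightarrow> 'd config \<Rightarrow> real" where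
  "hss f i k x = dderiv (\<lambda>y. dderiv f y (ind k)) x (ind i)"

lemma grd_lincomb:
  assumes "smooth W" "\<And>a. a \<in> A \<Longrightarrow> smooth (f a)"
  shows "grd (\<lambda>x. W x + (\<Sum>a\<in>A. c a * f a x)) k x = grd W k x + (\<Sum>a\<in>A. c a * grd (f a) k x)"
  unfolding grd_def using assms by (rule dderiv_lincomb)

lemma hss_lincomb:
  assumes "smooth W" "\<And>a. a \<in> A \<Longrightarrow> smooth (f a)"
  shows "hss (\<lambda>x. W x + (\<Sum>a\<in>A. c a * f a x)) i k x = hss W i k x + (\<Sum>a\<in>A. c a * hss (f a) i k x)"
  unfolding hss_def using assms by (rule dderiv2_lincomb)

lemma dderiv2_expand:
  assumes f: "smooth f" and v: "v \<in> Vp p"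
  shows "dderiv (\<lambda>y. dderiv f y w) x v = (\<Sum>i\<in>Bp p. v i * dderiv (\<lambda>y. dderiv f y w) x (ind i))"
proof -
  obtain T where T: "C2 f" "finite T" "depends_on T f" using assms smooth_def by blast
  note d = dderiv2_eq[OF T]
  have "dderiv (\<lambda>y. dderiv f y w) x v = (\<Sum>k\<in>T. \<Sum>j\<in>T. \<Sum>i\<in>Bp p. pd j (pd k f) x * (v i * ind i j) * w k)"
    unfolding d by (subst Vp_expand[OF v]) (simp add: sum_distrib_left sum_distrib_right)
  also have "\<dots> = (\<Sum>k\<in>T. \<Sum>i\<in>Bp p. \<Sum>j\<in>T. pd j (pd k f) x * (v i * ind i j) * w k)"
    by (intro sum.cong refl sum.swap)
  also have "\<dots> = (\<Sum>i\<in>Bp p. \<Sum>k\<in>T. \<Sum>j\<in>T. pd j (pd k f) x * (v i * ind i j) * w k)"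
    by (rule sum.swap)
  also have "\<dots> = (\<Sum>i\<in>Bp p. v i * dderiv (\<lambda>y. dderiv f y w) x (ind i))"
    by (simp add: d sum_distrib_left mult_ac)
  finally show ?thesis .
qed

text \<open>Turns the kernel vector appearing in \<open>degenerate\<close> into the cokernel vector
  required by \<open>no_cube_of_degenerate_zeros\<close>.\<close>

lemma hss_sym:
  assumes "smooth f" shows "hss f i k x = hss f k i x"
proof -
  obtain T where T: "C2 f" "finite T" "depends_on T f" using assms smooth_def by blast
  have "(\<Sum>a\<in>T. \<Sum>b\<in>T. pd b (pd a f) x * ind i b * ind k a) = (\<Sum>b\<in>T. \<Sum>a\<in>T. pd b (pd a f) x * ind i b * ind k a)"
    by (rule sum.swap)
  also have "\<dots> = (\<Sum>b\<in>T. \<Sum>a\<in>T. pd a (pd b f) x * ind k a * ind i b)"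
    by (intro sum.cong refl) (simp add: pd_commute[OF T(1)] mult_ac)
  finally show ?thesis by (simp add: hss_def dderiv2_eq[OF T])
qed

lemma continuous_grd:
  assumes "smooth f" shows "continuous_on UNIV (grd f k)"
proof -
  obtain T where T: "C2 f" "finite T" "depends_on T f" using assms smooth_def by blast
  show ?thesis unfolding grd_def[abs_def] dderiv_eq[OF C2_C1[OF T(1)] T(2,3)]
    using T by (intro continuous_on_sum continuous_on_mult continuous_on_const C2_cont_pd)
qed

lemma continuous_hss:
  assumes "smooth f" shows "continuous_on UNIV (hss f i k)"
proof -
  obtain T where T: "C2 f" "finite T" "depends_on T f" using assms smooth_def by blast
  show ?thesis unfolding hss_def[abs_def] dderiv2_eq[OF T]
    using T by (intro continuous_on_sum continuous_on_mult continuous_on_const C2_cont_pd2)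
qed

lemma grd_MVT:
  assumes f: "smooth f" and v: "(\<lambda>i. y i - x i) \<in> Vp p"
  shows "\<exists>s. 0 < s \<and> s < 1 \<and> grd f k y - grd f k x = (\<Sum>i\<in>Bp p. (y i - x i) * hss f i k (\<lambda>i. x i + s * (y i - x i)))"
proof -
  from MVT2[OF zero_less_one smooth_has_dderiv2[OF f, of x "\<lambda>i. y i - x i" "ind k"]]
  obtain s where "0 < s" "s < 1" "grd f k y - grd f k x = dderiv (\<lambda>y. dderiv f y (ind k)) (\<lambda>i. x i + s * (y i - x i)) (\<lambda>i. y i - x i)"
    by (auto simp: grd_def)
  then show ?thesis unfolding dderiv2_expand[OF f v] hss_def by blast
qed

definition degenerate :: "('d config \<Rightarrow> real) \<Rightarrow> 'd config \<Rightarrow> 'd config \<Rightarrow> bool" where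
  "degenerate f x v \<longleftrightarrow> (\<forall>k\<in>Bp p. grd f k x = 0) \<and> (\<forall>k\<in>Bp p. (\<Sum>i\<in>Bp p. v i * hss f i k x) = 0)"

text \<open>Kernel vectors are normalised to this compact sup-norm sphere so that their limits stay
  nonzero. The value 1 has to be attained on the finite set \<open>Bp p\<close>, which keeps the
  condition closed.\<close>

definition unit_sphere :: "'d config set" where
  "unit_sphere = {v \<in> Vp p. (\<forall>i. \<bar>v i\<bar> \<le> 1) \<and> (\<exists>i\<in>Bp p. \<bar>v i\<bar> = 1)}"

lemma compact_unit_sphere: "compact unit_sphere"
proof -
  have "unit_sphere = {v. \<forall>i. \<bar>v i - 0\<bar> \<le> 1} \<inter> (Vp p \<inter> (\<Union>i\<in>Bp p. {v. \<bar>v i\<bar> = 1}))"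
    by (auto simp: unit_sphere_def)
  moreover have "closed (\<Union>i\<in>Bp p. {v :: 'd config. \<bar>v i\<bar> = 1})"
    by (intro closed_UN finite_Bp ballI closed_Collect_eq continuous_intros) simp_all
  ultimately show ?thesis
    using compact_Int_closed[OF compact_sup_cball[of "\<lambda>i. 0" 1] closed_Int[OF closed_Vp]] by simp
qed

lemma not_morse_degenerate:
  assumes f: "smooth f" and nm: "\<not> morse_on_X p q f"
  shows "\<exists>x\<in>Xpq p q. \<exists>v\<in>unit_sphere. degenerate f x v"
proof -
  obtain x v where x: "x \<in> Xpq p q" and crit: "\<And>v. v \<in> Vp p \<Longrightarrow> dderiv f x v = 0" and v: "v \<in> Vp p"
    and null: "\<And>w. w \<in> Vp p \<Longrightarrow> dderiv (\<lambda>y. dderiv f y w) x v = 0" and nz: "v \<noteq> (\<lambda>i. 0)"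
    using nm unfolding morse_on_X_def by blast
  define m where "m = Max ((\<lambda>i. \<bar>v i\<bar>) ` Bp p)"
  have "m \<in> (\<lambda>i. \<bar>v i\<bar>) ` Bp p" unfolding m_def using finite_Bp Bp_nonempty by (intro Max_in) auto
  then obtain b where b: "b \<in> Bp p" "m = \<bar>v b\<bar>" by blast
  have le: "\<bar>v i\<bar> \<le> m" for i
    by (rule Vp_bounded_by_Bp[OF v]) (auto simp: m_def intro!: Max_ge finite_Bp)
  have m: "m > 0"
  proof -
    obtain i where "v i \<noteq> 0" using nz by blast
    then show ?thesis using le[of i] by linarith
  qed
  define u where "u i = v i / m" for i
  have "u \<in> unit_sphere"
    using v le m b by (auto simp: unit_sphere_def u_def Vp_def abs_divide divide_le_eq intro!: bexI[of _ b])
  moreover have "degenerate f x u"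
    unfolding degenerate_def
  proof (intro conjI ballI)
    fix k assume "k \<in> Bp p"
    show "grd f k x = 0" unfolding grd_def by (rule crit[OF ind_Vp])
    have "(\<Sum>i\<in>Bp p. u i * hss f i k x) = (\<Sum>i\<in>Bp p. v i * hss f i k x) / m"
      by (simp add: u_def sum_divide_distrib)
    also have "\<dots> = 0" using null[OF ind_Vp] unfolding hss_def dderiv2_expand[OF f v] by simp
    finally show "(\<Sum>i\<in>Bp p. u i * hss f i k x) = 0" .
  qed
  ultimately show ?thesis using x by blast
qed

end

lemma uniformly_continuous_sup_family:
  fixes h :: "'b \<Rightarrow> ('a::countable \<Rightarrow> real) \<Rightarrow> real"
  assumes "finite J" "compact K" "\<And>j. j \<in> J \<Longrightarrow> continuous_on UNIV (h j)" "\<epsilon> > 0"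
  shows "\<exists>\<delta>>0. \<forall>y\<in>K. \<forall>y'\<in>K. (\<forall>i. \<bar>y' i - y i\<bar> \<le> \<delta>) \<longrightarrow> (\<forall>j\<in>J. \<bar>h j y' - h j y\<bar> \<le> \<epsilon>)"
  using assms(1,3)
proof (induction J)
  case empty
  then show ?case by (intro exI[of _ 1]) simp
next
  case (insert j J)
  obtain d1 where d1: "d1 > 0" "\<forall>y\<in>K. \<forall>y'\<in>K. (\<forall>i. \<bar>y' i - y i\<bar> \<le> d1) \<longrightarrow> (\<forall>j\<in>J. \<bar>h j y' - h j y\<bar> \<le> \<epsilon>)"
    using insert by auto
  obtain d2 where d2: "d2 > 0" "\<forall>y\<in>K. \<forall>y'\<in>K. (\<forall>i. \<bar>y' i - y i\<bar> \<le> d2) \<longrightarrow> \<bar>h j y' - h j y\<bar> \<le> \<epsilon>"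
    using uniformly_continuous_sup[OF assms(2) insert.prems assms(4)] by blast
  show ?case using d1 d2 by (intro exI[of _ "min d1 d2"]) auto
qed

section \<open>Sets of degenerate parameters are closed with empty interior\<close>

context periods
begin

definition pert :: "('d config \<Rightarrow> real) \<Rightarrow> ('l \<Rightarrow> 'd config \<Rightarrow> real) \<Rightarrow> 'l set \<Rightarrow> ('l \<Rightarrow> real) \<Rightarrow> 'd config \<Rightarrow> real" where
  "pert W F A c x = W x + (\<Sum>a\<in>A. c a * F a x)"

definition degenerate_params :: "('d config \<Rightarrow> real) \<Rightarrow> ('l \<Rightarrow> 'd config \<Rightarrow> real) \<Rightarrow> 'l set \<Rightarrow> 'd config set \<Rightarrow> ('l \<Rightarrow> real) set" where
  "degenerate_params W F A K = {c. \<exists>x\<in>K. \<exists>v\<in>unit_sphere. degenerate (pert W F A c) x v}"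

lemma smooth_pert:
  assumes "smooth W" "\<forall>a\<in>A. smooth (F a)"
  shows "smooth (pert W F A c)"
  unfolding pert_def[abs_def] by (intro smooth_add smooth_sum smooth_cmult) (use assms in auto)

lemma grd_pert:
  assumes "smooth W" "\<forall>a\<in>A. smooth (F a)"
  shows "grd (pert W F A c) k x = grd W k x + (\<Sum>a\<in>A. c a * grd (F a) k x)"
  unfolding pert_def[abs_def] by (rule grd_lincomb) (use assms in auto)

lemma hss_pert:
  assumes "smooth W" "\<forall>a\<in>A. smooth (F a)"
  shows "hss (pert W F A c) i k x = hss W i k x + (\<Sum>a\<in>A. c a * hss (F a) i k x)"
  unfolding pert_def[abs_def] by (rule hss_lincomb) (use assms in auto)

text \<open>Given a convergent sequence of parameters, compactness of
  \<open>K \<times> unit_sphere\<close> yields a convergent subsequence of degenerate points with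
  kernel vectors. Gradient and Hessian are affine in the parameter and continuous in the point, so
  degeneracy passes to the limit.\<close>

lemma closed_degenerate_params:
  fixes F :: "'l::countable \<Rightarrow> 'd config \<Rightarrow> real"
  assumes sm: "smooth W" "\<forall>a\<in>A. smooth (F a)" and K: "compact K"
  shows "closed (degenerate_params W F A K)"
  unfolding closed_sequential_limits
proof (intro allI impI, elim conjE)
  fix c :: "nat \<Rightarrow> 'l \<Rightarrow> real" and l assume c: "\<forall>n. c n \<in> degenerate_params W F A K" and lim: "c \<longlonglongrightarrow> l"
  have "\<forall>n. \<exists>z. z \<in> K \<times> unit_sphere \<and> degenerate (pert W F A (c n)) (fst z) (snd z)"
    using c unfolding degenerate_params_def by fastforce
  from choice[OF this] obtain z where z: "\<forall>n. z n \<in> K \<times> unit_sphere"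
    "\<And>n. degenerate (pert W F A (c n)) (fst (z n)) (snd (z n))" by blast
  have "seq_compact (K \<times> unit_sphere)"
    by (intro compact_imp_seq_compact compact_Times K compact_unit_sphere)
  then obtain w r where w: "w \<in> K \<times> unit_sphere" and r: "strict_mono (r :: nat \<Rightarrow> nat)" and zr: "(z \<circ> r) \<longlonglongrightarrow> w"
    using seq_compactE z(1) by blast
  have x: "(\<lambda>n. fst (z (r n))) \<longlonglongrightarrow> fst w" and v: "(\<lambda>n. snd (z (r n))) \<longlonglongrightarrow> snd w"
    using tendsto_fst[OF zr] tendsto_snd[OF zr] by (simp_all add: o_def)
  have lr: "(\<lambda>n. c (r n)) \<longlonglongrightarrow> l"
    using LIMSEQ_subseq_LIMSEQ[OF lim r] by (simp add: o_def)
  have cr: "(\<lambda>n. c (r n) a) \<longlonglongrightarrow> l a" for a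
    by (rule continuous_on_tendsto_compose[of UNIV "\<lambda>f. f a", OF _ lr]) auto
  have vr: "(\<lambda>n. snd (z (r n)) i) \<longlonglongrightarrow> snd w i" for i
    by (rule continuous_on_tendsto_compose[of UNIV "\<lambda>f. f i", OF _ v]) auto
  have g: "(\<lambda>n. grd f k (fst (z (r n)))) \<longlonglongrightarrow> grd f k (fst w)" if "smooth f" for f k
    by (rule continuous_on_tendsto_compose[OF continuous_grd[OF that] x]) auto
  have h: "(\<lambda>n. hss f i k (fst (z (r n)))) \<longlonglongrightarrow> hss f i k (fst w)" if "smooth f" for f i k
    by (rule continuous_on_tendsto_compose[OF continuous_hss[OF that] x]) auto
  have "degenerate (pert W F A l) (fst w) (snd w)"
    unfolding degenerate_def
  proof (intro conjI ballI)
    fix k assume k: "k \<in> Bp p"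
    have "(\<lambda>n. grd W k (fst (z (r n))) + (\<Sum>a\<in>A. c (r n) a * grd (F a) k (fst (z (r n))))) \<longlonglongrightarrow>
        grd W k (fst w) + (\<Sum>a\<in>A. l a * grd (F a) k (fst w))"
      by (intro tendsto_add tendsto_sum tendsto_mult g cr sm(1) sm(2)[rule_format])
    moreover have "grd W k (fst (z (r n))) + (\<Sum>a\<in>A. c (r n) a * grd (F a) k (fst (z (r n)))) = 0" for n
      using z(2)[of "r n"] k unfolding degenerate_def grd_pert[OF sm] by blast
    ultimately show "grd (pert W F A l) k (fst w) = 0"
      unfolding grd_pert[OF sm] by (simp add: LIMSEQ_const_iff)
    have "(\<lambda>n. \<Sum>i\<in>Bp p. snd (z (r n)) i * (hss W i k (fst (z (r n))) + (\<Sum>a\<in>A. c (r n) a * hss (F a) i k (fst (z (r n)))))) \<longlonglongrightarrow>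
        (\<Sum>i\<in>Bp p. snd w i * (hss W i k (fst w) + (\<Sum>a\<in>A. l a * hss (F a) i k (fst w))))"
      by (intro tendsto_add tendsto_sum tendsto_mult h cr vr sm(1) sm(2)[rule_format])
    moreover have "(\<Sum>i\<in>Bp p. snd (z (r n)) i * (hss W i k (fst (z (r n))) + (\<Sum>a\<in>A. c (r n) a * hss (F a) i k (fst (z (r n)))))) = 0" for n
      using z(2)[of "r n"] k unfolding degenerate_def hss_pert[OF sm] by blast
    ultimately show "(\<Sum>i\<in>Bp p. snd w i * hss (pert W F A l) i k (fst w)) = 0"
      unfolding hss_pert[OF sm] by (simp add: LIMSEQ_const_iff)
  qed
  with w show "l \<in> degenerate_params W F A K" unfolding degenerate_params_def by (auto simp: mem_Times_iff)
qed

lemma Xpq_segment: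
  assumes "x \<in> Xpq p q" "y \<in> Xpq p q"
  shows "(\<lambda>i. x i + s * (y i - x i)) \<in> Xpq p q"
proof -
  have "x (i + p m) + s * (y (i + p m) - x (i + p m)) + real_of_int (q m) = x i + s * (y i - x i)" for i m
  proof -
    have "x (i + p m) = x i - real_of_int (q m)" "y (i + p m) = y i - real_of_int (q m)"
      using assms unfolding Xpq_iff by (simp_all add: eq_diff_eq)
    then show ?thesis by (simp only:) (simp add: algebra_simps)
  qed
  then show ?thesis by (simp add: Xpq_iff)
qed

text \<open>The family \<open>c i\<close> moves the gradient nearly along the coordinate
  \<open>i\<close>, everywhere on \<open>K\<close>. An interior point \<open>l\<close> would leave
  room for a small cube of parameters spanned by these families, each with a degenerate zero in
  \<open>K\<close>, and \<open>no_cube_of_degenerate_zeros\<close> forbids that.\<close>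

lemma interior_degenerate_params:
  fixes F :: "'l::countable \<Rightarrow> 'd config \<Rightarrow> real" and c :: "int ^ 'd \<Rightarrow> 'l \<Rightarrow> real" and A :: "'l set"
  defines "M \<equiv> \<lambda>i k y. \<Sum>a\<in>A. c i a * grd (F a) k y"
  assumes sm: "smooth W" "\<forall>a\<in>A. smooth (F a)" and A: "finite A"
    and K: "K = Xpq p q \<inter> {y. \<forall>i. \<bar>y i - x0 i\<bar> \<le> r}"
    and near: "\<And>i k y. i \<in> Bp p \<Longrightarrow> k \<in> Bp p \<Longrightarrow> y \<in> K \<Longrightarrow>
        \<bar>M i k y - (if i = k then 1 else 0)\<bar> \<le> 1 / (2 * real (card (Bp p)))"
  shows "interior (degenerate_params W F A K) = {}"
proof (rule ccontr)
  assume "interior (degenerate_params W F A K) \<noteq> {}"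
  then obtain l where "l \<in> interior (degenerate_params W F A K)" by blast
  then obtain \<rho> where \<rho>: "\<rho> > 0" "\<And>c. (\<And>a. \<bar>c a - l a\<bar> \<le> \<rho>) \<Longrightarrow> c \<in> degenerate_params W F A K"
    using open_contains_sup_ball[OF open_interior] interior_subset by blast
  define B where "B = (\<Sum>i\<in>Bp p. \<Sum>a\<in>A. \<bar>c i a\<bar>)"
  have B: "B \<ge> 0" by (auto simp: B_def intro!: sum_nonneg)
  \<comment> \<open>\<open>B\<close> bounds the displacement of any coefficient over the unit cube,
    so scaling by \<open>s\<close> stays within \<open>\<rho>\<close>; the 1 guards against
    \<open>B = 0\<close>.\<close>
  define s where "s = \<rho> / (B + 1)"
  have s: "s > 0" "s * B \<le> \<rho>" using \<rho> B by (auto simp: s_def field_simps)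
  define par where "par \<mu> a = l a + (if a \<in> A then s * (\<Sum>i\<in>Bp p. \<mu> i * c i a) else 0)" for \<mu> a
  define cube where "cube = {\<mu> :: 'd config. \<forall>i\<in>Bp p. 0 \<le> \<mu> i \<and> \<mu> i \<le> 1}"
  have par: "\<bar>par \<mu> a - l a\<bar> \<le> \<rho>" if "\<mu> \<in> cube" for \<mu> a
  proof (cases "a \<in> A")
    case True
    have "\<bar>\<Sum>i\<in>Bp p. \<mu> i * c i a\<bar> \<le> (\<Sum>i\<in>Bp p. \<bar>c i a\<bar>)"
    proof (rule order.trans[OF sum_abs], rule sum_mono)
      fix i assume "i \<in> Bp p"
      then show "\<bar>\<mu> i * c i a\<bar> \<le> \<bar>c i a\<bar>" using that by (simp add: cube_def abs_mult mult_left_le_one_le)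
    qed
    also have "\<dots> \<le> B" unfolding B_def
      by (intro sum_mono member_le_sum True A) auto
    finally have "s * \<bar>\<Sum>i\<in>Bp p. \<mu> i * c i a\<bar> \<le> s * B" using s by (intro mult_left_mono) auto
    then have "s * \<bar>\<Sum>i\<in>Bp p. \<mu> i * c i a\<bar> \<le> \<rho>" using s(2) by (rule order.trans)
    then show ?thesis using s True by (simp add: par_def abs_mult)
  qed (use \<rho> in \<open>simp add: par_def\<close>)
  \<comment> \<open>One degenerate zero with its kernel vector is picked for each parameter, without
    any regularity in \<open>\<mu>\<close>.\<close>
  have "\<forall>\<mu>\<in>cube. \<exists>z. fst z \<in> K \<and> snd z \<in> unit_sphere \<and> degenerate (pert W F A (par \<mu>)) (fst z) (snd z)"
    using \<rho>(2)[OF par] unfolding degenerate_params_def by fastforce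
  from bchoice[OF this] obtain z where z: "\<And>\<mu>. \<mu> \<in> cube \<Longrightarrow> fst (z \<mu>) \<in> K" "\<And>\<mu>. \<mu> \<in> cube \<Longrightarrow> snd (z \<mu>) \<in> unit_sphere"
    "\<And>\<mu>. \<mu> \<in> cube \<Longrightarrow> degenerate (pert W F A (par \<mu>)) (fst (z \<mu>)) (snd (z \<mu>))" by blast
  have smp: "smooth (pert W F A (par \<mu>))" for \<mu> using smooth_pert[OF sm] .
  have Kc: "compact K" unfolding K Int_commute[of "Xpq p q"]
    by (intro compact_Int_closed compact_sup_cball closed_Xpq)
  have Kd: "(\<lambda>i. y' i - y i) \<in> Vp p" if "y \<in> K" "y' \<in> K" for y y' using Xpq_diff that K by blast
  define m where "m a = \<bar>l a\<bar> + \<rho>" for a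
  have m: "\<bar>par \<mu> a\<bar> \<le> m a" if "\<mu> \<in> cube" for \<mu> a using par[OF that, of a] by (simp add: m_def)
  have m0: "m a \<ge> 0" for a using \<rho> by (simp add: m_def)
  define h where "h i k y = \<bar>hss W i k y\<bar> + (\<Sum>a\<in>A. m a * \<bar>hss (F a) i k y\<bar>)" for i k y
  have h0: "h i k y \<ge> 0" for i k y using m0 by (auto simp: h_def intro!: add_nonneg_nonneg sum_nonneg)
  have "continuous_on UNIV (\<lambda>y. \<Sum>i\<in>Bp p. \<Sum>k\<in>Bp p. h i k y)"
    unfolding h_def using sm by (intro continuous_intros continuous_hss) auto
  then obtain B' where B': "\<And>y. y \<in> K \<Longrightarrow> \<bar>\<Sum>i\<in>Bp p. \<Sum>k\<in>Bp p. h i k y\<bar> \<le> B'"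
    using bounded_on_compact[OF Kc] by blast
  have bound: "\<bar>hss (pert W F A (par \<mu>)) i k y\<bar> \<le> B'" if "\<mu> \<in> cube" "i \<in> Bp p" "k \<in> Bp p" "y \<in> K" for \<mu> i k y
  proof -
    have "\<bar>hss (pert W F A (par \<mu>)) i k y\<bar> \<le> \<bar>hss W i k y\<bar> + (\<Sum>a\<in>A. \<bar>par \<mu> a * hss (F a) i k y\<bar>)"
      unfolding hss_pert[OF sm] by (intro order.trans[OF abs_triangle_ineq] add_left_mono sum_abs)
    also have "\<dots> \<le> h i k y"
      unfolding h_def abs_mult by (intro add_left_mono sum_mono mult_right_mono m that) simp
    also have "\<dots> \<le> (\<Sum>k\<in>Bp p. h i k y)" using that finite_Bp h0 by (intro member_le_sum) auto
    also have "\<dots> \<le> (\<Sum>i\<in>Bp p. \<Sum>k\<in>Bp p. h i k y)" using that finite_Bp h0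
      by (intro member_le_sum[where f = "\<lambda>i. \<Sum>k\<in>Bp p. h i k y"]) (auto intro: sum_nonneg)
    also have "\<dots> \<le> B'" using B'[OF that(4)] by linarith
    finally show ?thesis .
  qed
  have contM: "continuous_on UNIV (M i k)" for i k
    unfolding M_def using sm by (intro continuous_intros continuous_grd) auto
  have unif: "\<exists>\<delta>>0. \<forall>\<mu>\<in>cube. \<forall>y\<in>K. \<forall>y'\<in>K. (\<forall>i\<in>Bp p. \<bar>y' i - y i\<bar> \<le> \<delta>) \<longrightarrow>
        (\<forall>i\<in>Bp p. \<forall>k\<in>Bp p. \<bar>hss (pert W F A (par \<mu>)) i k y' - hss (pert W F A (par \<mu>)) i k y\<bar> \<le> \<epsilon> \<and> \<bar>M i k y' - M i k y\<bar> \<le> \<epsilon>)"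
    if e: "\<epsilon> > 0" for \<epsilon>
  proof -
    \<comment> \<open>\<open>W\<close> enters the Hessian with coefficient 1 and \<open>F a\<close>
      with a coefficient of modulus at most \<open>m a\<close>. Since these bounds hold on the whole
      cube, the modulus of continuity is uniform in \<open>\<mu>\<close>.\<close>
    define D where "D = 1 + (\<Sum>a\<in>A. m a)"
    have D: "D \<ge> 1" using m0 by (simp add: D_def sum_nonneg)
    define e' where "e' = \<epsilon> / D"
    have e': "e' > 0" "e' * D = \<epsilon>" "e' \<le> \<epsilon>" using e D by (auto simp: e'_def field_simps)
    let ?J = "Bp p \<times> Bp p"
    have J: "finite ?J" using finite_Bp by simp
    obtain d1 where d1: "d1 > 0" "\<forall>y\<in>K. \<forall>y'\<in>K. (\<forall>i. \<bar>y' i - y i\<bar> \<le> d1) \<longrightarrow> (\<forall>j\<in>?J. \<bar>hss W (fst j) (snd j) y' - hss W (fst j) (snd j) y\<bar> \<le> e')"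
      using uniformly_continuous_sup_family[OF J Kc continuous_hss[OF sm(1)] e'(1), of "\<lambda>j. fst j" "\<lambda>j. snd j"] by blast
    have "\<exists>\<delta>>0. \<forall>y\<in>K. \<forall>y'\<in>K. (\<forall>i. \<bar>y' i - y i\<bar> \<le> \<delta>) \<longrightarrow>
        (\<forall>j\<in>A \<times> ?J. \<bar>hss (F (fst j)) (fst (snd j)) (snd (snd j)) y' - hss (F (fst j)) (fst (snd j)) (snd (snd j)) y\<bar> \<le> e')"
      by (rule uniformly_continuous_sup_family[OF _ Kc _ e'(1)]) (use A J sm continuous_hss in auto)
    then obtain d2 where d2: "d2 > 0" "\<forall>y\<in>K. \<forall>y'\<in>K. (\<forall>i. \<bar>y' i - y i\<bar> \<le> d2) \<longrightarrow>
        (\<forall>j\<in>A \<times> ?J. \<bar>hss (F (fst j)) (fst (snd j)) (snd (snd j)) y' - hss (F (fst j)) (fst (snd j)) (snd (snd j)) y\<bar> \<le> e')" by blast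
    obtain d3 where d3: "d3 > 0" "\<forall>y\<in>K. \<forall>y'\<in>K. (\<forall>i. \<bar>y' i - y i\<bar> \<le> d3) \<longrightarrow> (\<forall>j\<in>?J. \<bar>M (fst j) (snd j) y' - M (fst j) (snd j) y\<bar> \<le> e')"
      using uniformly_continuous_sup_family[OF J Kc contM e'(1), of "\<lambda>j. fst j" "\<lambda>j. snd j"] by blast
    have "\<bar>hss (pert W F A (par \<mu>)) i k y' - hss (pert W F A (par \<mu>)) i k y\<bar> \<le> \<epsilon> \<and> \<bar>M i k y' - M i k y\<bar> \<le> \<epsilon>"
      if \<mu>: "\<mu> \<in> cube" and y: "y \<in> K" "y' \<in> K" and le: "\<forall>i\<in>Bp p. \<bar>y' i - y i\<bar> \<le> min d1 (min d2 d3)"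
        and ik: "i \<in> Bp p" "k \<in> Bp p" for \<mu> y y' i k
    proof -
      \<comment> \<open>Closeness on \<open>Bp p\<close> implies closeness at all sites because the
        difference is periodic.\<close>
      have le': "\<bar>y' i - y i\<bar> \<le> min d1 (min d2 d3)" for i
        by (rule Vp_bounded_by_Bp[OF Kd[OF y]]) (use le in blast)
      have 1: "\<bar>hss W i k y' - hss W i k y\<bar> \<le> e'"
        using d1(2)[rule_format, OF y, of "(i, k)"] le' ik by auto
      have 2: "\<bar>hss (F a) i k y' - hss (F a) i k y\<bar> \<le> e'" if "a \<in> A" for a
        using d2(2)[rule_format, OF y, of "(a, i, k)"] le' ik that by auto
      have 3: "\<bar>M i k y' - M i k y\<bar> \<le> e'"
        using d3(2)[rule_format, OF y, of "(i, k)"] le' ik by auto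
      have eq: "hss (pert W F A (par \<mu>)) i k y' - hss (pert W F A (par \<mu>)) i k y =
          (hss W i k y' - hss W i k y) + (\<Sum>a\<in>A. par \<mu> a * (hss (F a) i k y' - hss (F a) i k y))"
        unfolding hss_pert[OF sm] by (simp add: right_diff_distrib sum_subtractf)
      have "\<bar>hss (pert W F A (par \<mu>)) i k y' - hss (pert W F A (par \<mu>)) i k y\<bar>
          \<le> \<bar>hss W i k y' - hss W i k y\<bar> + (\<Sum>a\<in>A. \<bar>par \<mu> a * (hss (F a) i k y' - hss (F a) i k y)\<bar>)"
        unfolding eq by (intro order.trans[OF abs_triangle_ineq] add_left_mono sum_abs)
      also have "\<dots> \<le> e' + (\<Sum>a\<in>A. m a * e')"
        unfolding abs_mult by (intro add_mono sum_mono mult_mono 1 2 m \<mu> m0) auto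
      also have "\<dots> = e' * D" by (simp add: D_def algebra_simps sum_distrib_left)
      finally show ?thesis using e' 3 by linarith
    qed
    then show ?thesis using d1(1) d2(1) d3(1) by (intro exI[of _ "min d1 (min d2 d3)"]) auto
  qed
  show False
  proof (rule no_cube_of_degenerate_zeros[OF finite_Bp Bp_nonempty s(1), of "\<lambda>\<mu>. fst (z \<mu>)" K "(\<Sum>i\<in>Bp p. \<bar>x0 i\<bar>) + r"
      "\<lambda>\<mu> k y. grd (pert W F A (par \<mu>)) k y" "\<lambda>\<mu>. snd (z \<mu>)" "\<lambda>\<mu> i k y. hss (pert W F A (par \<mu>)) i k y" M B', folded cube_def])
    fix y i assume y: "y \<in> K" and i: "i \<in> Bp p"
    have "\<bar>x0 i\<bar> \<le> (\<Sum>i\<in>Bp p. \<bar>x0 i\<bar>)" using i finite_Bp by (intro member_le_sum) auto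
    moreover have "\<bar>y i - x0 i\<bar> \<le> r" using y K by blast
    ultimately show "\<bar>y i\<bar> \<le> (\<Sum>i\<in>Bp p. \<bar>x0 i\<bar>) + r" by linarith
  next
    fix \<mu> k assume "\<mu> \<in> cube" "k \<in> Bp p"
    then show "grd (pert W F A (par \<mu>)) k (fst (z \<mu>)) = 0" using z(3) unfolding degenerate_def by blast
  next
    fix \<mu> i assume "\<mu> \<in> cube" "i \<in> Bp p"
    then show "(\<Sum>k\<in>Bp p. snd (z \<mu>) k * hss (pert W F A (par \<mu>)) i k (fst (z \<mu>))) = 0"
      using z(3) unfolding degenerate_def hss_sym[OF smp, where i = i] by blast
  next
    fix \<mu> i assume "\<mu> \<in> cube" "i \<in> Bp p"
    then show "\<bar>snd (z \<mu>) i\<bar> \<le> 1" using z(2) unfolding unit_sphere_def by blast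
  next
    fix \<mu> assume "\<mu> \<in> cube"
    then show "\<exists>i\<in>Bp p. \<bar>snd (z \<mu>) i\<bar> = 1" using z(2) unfolding unit_sphere_def by blast
  next
    fix \<mu> \<mu>' k y
    have "(\<Sum>a\<in>A. par \<mu>' a * grd (F a) k y) - (\<Sum>a\<in>A. par \<mu> a * grd (F a) k y) =
        (\<Sum>a\<in>A. \<Sum>i\<in>Bp p. s * ((\<mu>' i - \<mu> i) * (c i a * grd (F a) k y)))"
      unfolding sum_subtractf[symmetric]
      by (intro sum.cong refl) (simp add: par_def algebra_simps sum_subtractf sum_distrib_left)
    also have "\<dots> = (\<Sum>i\<in>Bp p. \<Sum>a\<in>A. s * ((\<mu>' i - \<mu> i) * (c i a * grd (F a) k y)))" by (rule sum.swap)
    also have "\<dots> = s * (\<Sum>i\<in>Bp p. (\<mu>' i - \<mu> i) * M i k y)" by (simp add: M_def sum_distrib_left)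
    finally show "grd (pert W F A (par \<mu>')) k y - grd (pert W F A (par \<mu>)) k y = s * (\<Sum>i\<in>Bp p. (\<mu>' i - \<mu> i) * M i k y)"
      unfolding grd_pert[OF sm] by simp
  next
    fix \<mu> y y' k assume y: "y \<in> K" "y' \<in> K"
    obtain t where t: "0 < t" "t < 1" "grd (pert W F A (par \<mu>)) k y' - grd (pert W F A (par \<mu>)) k y =
        (\<Sum>i\<in>Bp p. (y' i - y i) * hss (pert W F A (par \<mu>)) i k (\<lambda>i. y i + t * (y' i - y i)))"
      using grd_MVT[OF smp Kd[OF y]] by blast
    have zi: "\<bar>t * (y' i - y i)\<bar> \<le> \<bar>y' i - y i\<bar>" for i
      using t(1,2) by (simp add: abs_mult mult_left_le_one_le)
    have "\<bar>(y i + t * (y' i - y i)) - x0 i\<bar> \<le> r" for i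
    proof -
      have "(y i + t * (y' i - y i)) - x0 i = (1 - t) * (y i - x0 i) + t * (y' i - x0 i)" by (simp add: algebra_simps)
      also have "\<bar>\<dots>\<bar> \<le> (1 - t) * \<bar>y i - x0 i\<bar> + t * \<bar>y' i - x0 i\<bar>"
        using t(1,2) by (intro order.trans[OF abs_triangle_ineq]) (simp add: abs_mult)
      also have "\<dots> \<le> (1 - t) * r + t * r"
        using t(1,2) y K by (intro add_mono mult_left_mono) auto
      finally show ?thesis by (simp add: algebra_simps)
    qed
    then have "(\<lambda>i. y i + t * (y' i - y i)) \<in> K" using Xpq_segment y K by blast
    then show "\<exists>z\<in>K. (\<forall>i\<in>Bp p. \<bar>z i - y i\<bar> \<le> \<bar>y' i - y i\<bar>) \<and> grd (pert W F A (par \<mu>)) k y' - grd (pert W F A (par \<mu>)) k y =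
        (\<Sum>i\<in>Bp p. (y' i - y i) * hss (pert W F A (par \<mu>)) i k z)"
      using t(3) zi by (intro bexI[of _ "\<lambda>i. y i + t * (y' i - y i)"]) auto
  next
    fix \<mu> i k y assume "\<mu> \<in> cube" "i \<in> Bp p" "k \<in> Bp p" "y \<in> K"
    then show "\<bar>hss (pert W F A (par \<mu>)) i k y\<bar> \<le> B'" by (rule bound)
  next
    fix \<epsilon> :: real assume "\<epsilon> > 0"
    then show "\<exists>\<delta>>0. \<forall>\<mu>\<in>cube. \<forall>y\<in>K. \<forall>y'\<in>K. (\<forall>i\<in>Bp p. \<bar>y' i - y i\<bar> \<le> \<delta>) \<longrightarrow>
        (\<forall>i\<in>Bp p. \<forall>k\<in>Bp p. \<bar>hss (pert W F A (par \<mu>)) i k y' - hss (pert W F A (par \<mu>)) i k y\<bar> \<le> \<epsilon> \<and> \<bar>M i k y' - M i k y\<bar> \<le> \<epsilon>)"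
      by (rule unif)
  qed (use z near in auto)
qed

text \<open>Countably many compact pieces cover \<open>Xpq p q\<close>, and each contributes a
  closed set of degenerate parameters with empty interior. By Baire their union has empty interior
  in the complete space of all coefficient families, so it cannot contain the nonempty open set of
  families that are small on \<open>A\<close>.\<close>

theorem morse_perturbation:
  fixes F :: "'l::countable \<Rightarrow> 'd config \<Rightarrow> real"
  assumes sm: "smooth W" "\<forall>a\<in>A. smooth (F a)" and A: "finite A"
    and span: "\<And>x i. x \<in> Xpq p q \<Longrightarrow> i \<in> Bp p \<Longrightarrow>
        \<exists>c. \<forall>k\<in>Bp p. (\<Sum>a\<in>A. c a * grd (F a) k x) = (if i = k then 1 else 0)"
    and \<eta>: "\<eta> > 0"
  shows "\<exists>c. (\<forall>a\<in>A. \<bar>c a\<bar> < \<eta>) \<and> morse_on_X p q (\<lambda>x. W x + (\<Sum>a\<in>A. c a * F a x))"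
proof -
  define N where "N = real (card (Bp p))"
  have N: "N > 0" using finite_Bp Bp_nonempty by (simp add: N_def card_gt_0_iff)
  \<comment> \<open>Two neighbourhoods of \<open>x\<close> are used. \<open>V\<close> restricts only
    the sites of \<open>Bp p\<close> and is open in the product topology, as the Lindelof property
    requires; \<open>K\<close> restricts all sites and is compact. Within \<open>Xpq p q\<close> the
    first is contained in the second.\<close>
  define K where "K x r = Xpq p q \<inter> {y. \<forall>i. \<bar>y i - x i\<bar> \<le> r}" for x r
  define V where "V x r = {y :: 'd config. \<forall>i\<in>Bp p. \<bar>y i - x i\<bar> < r}" for x r
  have VK: "y \<in> K x r" if "x \<in> Xpq p q" "y \<in> Xpq p q" "y \<in> V x r" for x y r
  proof -
    have "\<bar>y i - x i\<bar> \<le> r" for i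
      by (rule Vp_bounded_by_Bp[OF Xpq_diff[OF that(1,2)]]) (use that(3) in \<open>auto simp: V_def\<close>)
    then show ?thesis using that by (simp add: K_def)
  qed
  have openV: "open (V x r)" for x r
  proof -
    have "V x r = (\<Inter>i\<in>Bp p. {y. \<bar>y i - x i\<bar> < r})" by (auto simp: V_def)
    also have "open \<dots>"
      by (intro open_INT finite_Bp ballI open_Collect_less continuous_intros) simp_all
    finally show ?thesis .
  qed
  have "\<exists>r>0. interior (degenerate_params W F A (K x r)) = {}" if x: "x \<in> Xpq p q" for x
  proof -
    have "\<forall>i\<in>Bp p. \<exists>c. \<forall>k\<in>Bp p. (\<Sum>a\<in>A. c a * grd (F a) k x) = (if i = k then 1 else 0)"
      using span[OF x] by blast
    from bchoice[OF this] obtain c where c: "\<And>i k. i \<in> Bp p \<Longrightarrow> k \<in> Bp p \<Longrightarrow>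
        (\<Sum>a\<in>A. c i a * grd (F a) k x) = (if i = k then 1 else 0)" by blast
    \<comment> \<open>The deviation from the identity matrix. It vanishes at \<open>x\<close>, so by
      continuity it stays below the tolerance of \<open>sum_near_unit_vector\<close> on a small
      sup-ball.\<close>
    define g where "g i k y = \<bar>(\<Sum>a\<in>A. c i a * grd (F a) k y) - (if i = k then 1 else 0)\<bar>" for i k y
    have "continuous_on UNIV (\<lambda>y. \<Sum>i\<in>Bp p. \<Sum>k\<in>Bp p. g i k y)"
      unfolding g_def using sm by (intro continuous_intros continuous_grd) auto
    then have opn: "open {y. (\<Sum>i\<in>Bp p. \<Sum>k\<in>Bp p. g i k y) < 1 / (2 * N)}"
      by (intro open_Collect_less continuous_on_const)
    have "(\<Sum>i\<in>Bp p. \<Sum>k\<in>Bp p. g i k x) = 0" by (simp add: g_def c)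
    then have mem: "x \<in> {y. (\<Sum>i\<in>Bp p. \<Sum>k\<in>Bp p. g i k y) < 1 / (2 * N)}" using N by simp
    obtain r where r: "r > 0" "\<And>y. (\<And>i. \<bar>y i - x i\<bar> \<le> r) \<Longrightarrow> (\<Sum>i\<in>Bp p. \<Sum>k\<in>Bp p. g i k y) < 1 / (2 * N)"
      using open_contains_sup_ball[OF opn mem] by blast
    have "g i k y \<le> 1 / (2 * N)" if "i \<in> Bp p" "k \<in> Bp p" "y \<in> K x r" for i k y
    proof -
      have "g i k y \<le> (\<Sum>k\<in>Bp p. g i k y)" using that finite_Bp by (intro member_le_sum) (auto simp: g_def)
      also have "\<dots> \<le> (\<Sum>i\<in>Bp p. \<Sum>k\<in>Bp p. g i k y)" using that finite_Bp
        by (intro member_le_sum[where f = "\<lambda>i. \<Sum>k\<in>Bp p. g i k y"]) (auto intro: sum_nonneg simp: g_def)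
      also have "\<dots> \<le> 1 / (2 * N)" by (rule less_imp_le[OF r(2)]) (use that in \<open>auto simp: K_def\<close>)
      finally show ?thesis .
    qed
    then have "interior (degenerate_params W F A (K x r)) = {}"
      by (intro interior_degenerate_params[OF sm A K_def, where c = c]) (auto simp: g_def N_def)
    then show ?thesis using r(1) by blast
  qed
  then have "\<forall>x\<in>Xpq p q. \<exists>r>0. interior (degenerate_params W F A (K x r)) = {}" by blast
  from bchoice[OF this] obtain r where r: "\<And>x. x \<in> Xpq p q \<Longrightarrow> r x > 0"
    "\<And>x. x \<in> Xpq p q \<Longrightarrow> interior (degenerate_params W F A (K x (r x))) = {}" by blast
  obtain \<F> where \<F>: "\<F> \<subseteq> (\<lambda>x. V x (r x)) ` Xpq p q" "countable \<F>" "\<Union>\<F> = (\<Union>x\<in>Xpq p q. V x (r x))"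
    using Lindelof[of "(\<lambda>x. V x (r x)) ` Xpq p q"] openV by blast
  obtain D where D: "D \<subseteq> Xpq p q" "countable D" "\<F> = (\<lambda>x. V x (r x)) ` D"
    using countable_subset_image[of \<F> "\<lambda>x. V x (r x)" "Xpq p q"] \<F> by blast
  have "Met_TC.mtopology interior_of \<Union>((\<lambda>x. degenerate_params W F A (K x (r x))) ` D) = {}"
  proof (rule Met_TC.metric_Baire_category_alt)
    show "Met_TC.mcomplete TYPE('l \<Rightarrow> real)" by (simp add: complete_UNIV)
    show "countable ((\<lambda>x. degenerate_params W F A (K x (r x))) ` D)" using D by simp
    fix T assume "T \<in> (\<lambda>x. degenerate_params W F A (K x (r x))) ` D"
    then obtain x where x: "x \<in> D" "T = degenerate_params W F A (K x (r x))" by blast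
    have "compact (K x (r x))" unfolding K_def Int_commute[of "Xpq p q"]
      by (intro compact_Int_closed compact_sup_cball closed_Xpq)
    then have "closed T" unfolding x(2) by (rule closed_degenerate_params[OF sm])
    moreover have "interior T = {}" using r(2) x D by blast
    ultimately show "closedin Met_TC.mtopology T \<and> Met_TC.mtopology interior_of T = {}"
      by simp
  qed
  then have int: "interior (\<Union>x\<in>D. degenerate_params W F A (K x (r x))) = {}" by simp
  define U0 where "U0 = {c :: 'l \<Rightarrow> real. \<forall>a\<in>A. \<bar>c a\<bar> < \<eta>}"
  have "U0 = (\<Inter>a\<in>A. {c. \<bar>c a\<bar> < \<eta>})" by (auto simp: U0_def)
  also have "open \<dots>"
    by (intro open_INT A ballI open_Collect_less continuous_intros) simp_all
  finally have "open U0" .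
  moreover have "(\<lambda>a. 0) \<in> U0" using \<eta> by (simp add: U0_def)
  ultimately have "\<not> U0 \<subseteq> (\<Union>x\<in>D. degenerate_params W F A (K x (r x)))"
    using int interior_maximal by blast
  then obtain c where c: "c \<in> U0" "\<And>x. x \<in> D \<Longrightarrow> c \<notin> degenerate_params W F A (K x (r x))" by blast
  have "morse_on_X p q (pert W F A c)"
  proof (rule ccontr)
    assume "\<not> morse_on_X p q (pert W F A c)"
    then obtain y v where y: "y \<in> Xpq p q" "v \<in> unit_sphere" "degenerate (pert W F A c) y v"
      using not_morse_degenerate smooth_pert[OF sm] by blast
    have "y \<in> V y (r y)" using r(1)[OF y(1)] by (simp add: V_def)
    then have "y \<in> \<Union>\<F>" using \<F>(3) y(1) by blast
    then obtain x where x: "x \<in> D" "y \<in> V x (r x)" using D(3) by blast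
    then have "y \<in> K x (r x)" using VK D(1) y(1) by blast
    then show False using c(2)[OF x(1)] y unfolding degenerate_params_def by blast
  qed
  then show ?thesis using c(1) unfolding U0_def pert_def[abs_def] by blast
qed

end

section \<open>Perturbing functions with decaying mixed derivatives\<close>

definition wt :: "real \<Rightarrow> real" where "wt u = 1 / (1 + u^2)"

lemma wt_pos: "wt u > 0"
  unfolding wt_def by (simp add: add_pos_nonneg)

lemma wt_le_1: "wt u \<le> 1"
  unfolding wt_def by (simp add: divide_le_eq_1 add_pos_nonneg)

lemma wt_0 [simp]: "wt 0 = 1"
  by (simp add: wt_def)

lemma wt_minus: "wt (a - b) = wt (b - a)"
  by (simp add: wt_def power2_commute)

text \<open>A Peetre inequality: \<open>1 + (a - b)\<^sup>2\<close> is at most twice the product of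
  \<open>1 + a\<^sup>2\<close> and \<open>1 + b\<^sup>2\<close>.\<close>

lemma wt_mult: "wt a * wt b \<le> 2 * wt (a - b)"
proof -
  have "(a - b)\<^sup>2 \<le> 2 * a\<^sup>2 + 2 * b\<^sup>2" using sum_squares_bound[of a "-b"] by (simp add: power2_diff)
  moreover have "(1 + a\<^sup>2) * (1 + b\<^sup>2) = 1 + a\<^sup>2 + b\<^sup>2 + a\<^sup>2 * b\<^sup>2" by (simp add: algebra_simps)
  moreover have "a\<^sup>2 * b\<^sup>2 \<ge> 0" by (intro mult_nonneg_nonneg) simp_all
  ultimately have "1 + (a - b)\<^sup>2 \<le> 2 * ((1 + a\<^sup>2) * (1 + b\<^sup>2))" by linarith
  moreover have "1 + (a - b)\<^sup>2 > 0" "(1 + a\<^sup>2) * (1 + b\<^sup>2) > 0" by (auto simp: add_pos_nonneg)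
  ultimately show ?thesis unfolding wt_def by (simp add: field_simps)
qed

text \<open>Because of \<open>wt_mult\<close>, the decay demanded of the first derivatives relative to the site
  \<open>0\<close> is what makes the decay of the second derivatives stable under products.\<close>
definition tame :: "(int ^ 'd::finite) set \<Rightarrow> ('d config \<Rightarrow> real) \<Rightarrow> bool" where
  "tame T f \<longleftrightarrow> C2 f \<and> depends_on T f \<and> (\<forall>l x. f (shift 0 l x) = f x) \<and>
    (\<exists>C. \<forall>x. \<bar>f x\<bar> \<le> C \<and> (\<forall>i. \<bar>pd i f x\<bar> \<le> C * wt (x i - x 0)) \<and>
        (\<forall>i k. \<bar>pd i (pd k f) x\<bar> \<le> C * wt (x i - x k)))"

lemma tame_const: "tame T (\<lambda>x. c)"
  unfolding tame_def by (auto simp: C2_const dep_const C1_const intro!: exI[of _ "\<bar>c\<bar>"] mult_nonneg_nonneg less_imp_le[OF wt_pos])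

lemma tame_mult:
  assumes "tame T f" "tame T g"
  shows "tame T (\<lambda>x. f x * g x)"
proof -
  have C2: "C2 f" "C2 g" using assms by (auto simp: tame_def)
  obtain C where C: "\<And>x. \<bar>f x\<bar> \<le> C" "\<And>x i. \<bar>pd i f x\<bar> \<le> C * wt (x i - x 0)" "\<And>x i k. \<bar>pd i (pd k f) x\<bar> \<le> C * wt (x i - x k)"
    using assms(1) unfolding tame_def by blast
  obtain D where D: "\<And>x. \<bar>g x\<bar> \<le> D" "\<And>x i. \<bar>pd i g x\<bar> \<le> D * wt (x i - x 0)" "\<And>x i k. \<bar>pd i (pd k g) x\<bar> \<le> D * wt (x i - x k)"
    using assms(2) unfolding tame_def by blast
  have C0: "C \<ge> 0" and D0: "D \<ge> 0" using C(1)[of "\<lambda>i. 0"] D(1)[of "\<lambda>i. 0"] by linarith+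
  have w0: "wt u \<ge> 0" for u using wt_pos by (rule less_imp_le)
  have 1: "\<bar>f x * g x\<bar> \<le> C * D" for x unfolding abs_mult by (intro mult_mono C D C0) simp
  have 2: "\<bar>pd i f x * g x + pd i g x * f x\<bar> \<le> 2 * (C * D) * wt (x i - x 0)" for i x
  proof -
    have "\<bar>pd i f x * g x\<bar> \<le> (C * wt (x i - x 0)) * D" "\<bar>pd i g x * f x\<bar> \<le> (D * wt (x i - x 0)) * C"
      unfolding abs_mult by (intro mult_mono C D mult_nonneg_nonneg C0 D0 w0; simp)+
    then show ?thesis by (intro order.trans[OF abs_triangle_ineq]) (simp add: algebra_simps)
  qed
  have mixed: "\<bar>pd k f x * pd i g x\<bar> \<le> 2 * (C * D) * wt (x k - x i)" for i k x
  proof -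
    have "\<bar>pd k f x * pd i g x\<bar> \<le> (C * wt (x k - x 0)) * (D * wt (x i - x 0))"
      unfolding abs_mult by (intro mult_mono C D mult_nonneg_nonneg C0 D0 w0) simp
    also have "\<dots> = (C * D) * (wt (x k - x 0) * wt (x i - x 0))" by simp
    also have "\<dots> \<le> (C * D) * (2 * wt ((x k - x 0) - (x i - x 0)))"
      by (intro mult_left_mono wt_mult mult_nonneg_nonneg C0 D0)
    finally show ?thesis by simp
  qed
  \<comment> \<open>The constant is 1 + 2 + 1 + 2, in the order of the summands: 1 for a second
    derivative times a bounded factor, 2 for a product of first derivatives via
    \<open>wt_mult\<close>.\<close>
  have 3: "\<bar>pd k (pd i f) x * g x + pd k g x * pd i f x + (pd k (pd i g) x * f x + pd k f x * pd i g x)\<bar>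
      \<le> 6 * (C * D) * wt (x k - x i)" for i k x
  proof -
    define E where "E = C * D * wt (x k - x i)"
    have "\<bar>pd k (pd i f) x * g x\<bar> \<le> (C * wt (x k - x i)) * D" "\<bar>pd k (pd i g) x * f x\<bar> \<le> (D * wt (x k - x i)) * C"
      unfolding abs_mult by (intro mult_mono C D mult_nonneg_nonneg C0 D0 w0; simp)+
    then have "\<bar>pd k (pd i f) x * g x\<bar> \<le> E" "\<bar>pd k (pd i g) x * f x\<bar> \<le> E" by (simp_all add: E_def mult_ac)
    moreover have "\<bar>pd k g x * pd i f x\<bar> \<le> 2 * E"
      using mixed[of i x k] by (simp add: E_def wt_minus[of "x k"] mult_ac)
    moreover have "\<bar>pd k f x * pd i g x\<bar> \<le> 2 * E"
      using mixed[of k x i] by (simp add: E_def mult_ac)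
    ultimately have "\<bar>pd k (pd i f) x * g x + pd k g x * pd i f x + (pd k (pd i g) x * f x + pd k f x * pd i g x)\<bar> \<le> 6 * E"
      by linarith
    then show ?thesis by (simp add: E_def mult_ac)
  qed
  have le: "C * D * u \<le> 6 * (C * D) * u" "2 * (C * D) * u \<le> 6 * (C * D) * u" "C * D \<le> 6 * (C * D)" if "u \<ge> 0" for u
    using C0 D0 that by (auto intro!: mult_right_mono)
  show ?thesis unfolding tame_def C2_mult(3)[OF C2] unfolding C2_mult(2)[OF C2]
  proof (intro conjI exI[of _ "6 * (C * D)"] allI)
    fix x i k
    show "\<bar>f x * g x\<bar> \<le> 6 * (C * D)" using 1[of x] le(3)[OF order.refl] by linarith
    show "\<bar>pd i f x * g x + pd i g x * f x\<bar> \<le> 6 * (C * D) * wt (x i - x 0)"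
      using 2[of i x] le(2)[OF w0, of "x i - x 0"] by linarith
  qed (use assms C2_mult(1)[OF C2] 3 in \<open>auto simp: tame_def intro: dep_mult\<close>)
qed

text \<open>With \<open>c = 0\<close> this covers functions of a single site, with
  \<open>c = 1\<close> functions of the difference of two sites.\<close>

lemma C1_ridge:
  assumes "\<And>u. (\<phi> has_real_derivative \<phi>' u) (at u)" "continuous_on UNIV \<phi>'"
  shows "C1 (\<lambda>x. \<phi> (x s - c * x t))"
    and "pd i (\<lambda>x. \<phi> (x s - c * x t)) = (\<lambda>x. \<phi>' (x s - c * x t) * (of_bool (i = s) - c * of_bool (i = t)))"
proof -
  define d where "d i = (of_bool (i = s) - c * of_bool (i = t) :: real)" for i
  have "((\<lambda>\<tau>. \<phi> ((x(i := x i + \<tau>)) s - c * (x(i := x i + \<tau>)) t)) has_real_derivative \<phi>' (x s - c * x t) * d i) (at 0)" for i x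
  proof -
    have e: "(x(i := x i + \<tau>)) s - c * (x(i := x i + \<tau>)) t = (x s - c * x t) + \<tau> * d i" for \<tau>
      by (auto simp: d_def algebra_simps)
    have "((\<lambda>\<tau>. (x s - c * x t) + \<tau> * d i) has_real_derivative d i) (at 0)"
      by (auto intro!: derivative_eq_intros)
    then show ?thesis unfolding e
      using DERIV_chain2[of \<phi> "\<phi>' (x s - c * x t)" "\<lambda>\<tau>. (x s - c * x t) + \<tau> * d i" 0 "d i" UNIV] assms(1) by simp
  qed
  moreover have "continuous_on UNIV (\<lambda>x. \<phi>' (x s - c * x t) * d i)" for i
  proof -
    have "continuous_on UNIV (\<lambda>x :: 'a config. x s - c * x t)" by (intro continuous_intros) simp_all
    then have "continuous_on UNIV (\<lambda>x :: 'a config. \<phi>' (x s - c * x t))"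
      using continuous_on_compose2[OF assms(2)] by blast
    then show ?thesis by (intro continuous_intros)
  qed
  ultimately show "C1 (\<lambda>x. \<phi> (x s - c * x t))"
    "pd i (\<lambda>x. \<phi> (x s - c * x t)) = (\<lambda>x. \<phi>' (x s - c * x t) * (of_bool (i = s) - c * of_bool (i = t)))"
    using C1I[of "\<lambda>x. \<phi> (x s - c * x t)" "\<lambda>i x. \<phi>' (x s - c * x t) * d i"] by (auto simp: d_def)
qed

lemma C2_ridge:
  fixes s t :: "int ^ 'd::finite"
  assumes 1: "\<And>u. (\<phi> has_real_derivative \<phi>' u) (at u)" and 2: "\<And>u. (\<phi>' has_real_derivative \<psi> u) (at u)"
    and 3: "continuous_on UNIV \<psi>"
  shows "C2 (\<lambda>x. \<phi> (x s - c * x t))"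
    and "pd i (\<lambda>x. \<phi> (x s - c * x t)) = (\<lambda>x. \<phi>' (x s - c * x t) * (of_bool (i = s) - c * of_bool (i = t)))"
    and "pd k (pd i (\<lambda>x. \<phi> (x s - c * x t))) = (\<lambda>x. \<psi> (x s - c * x t) *
           (of_bool (k = s) - c * of_bool (k = t)) * (of_bool (i = s) - c * of_bool (i = t)))"
proof -
  have c: "continuous_on UNIV \<phi>" "continuous_on UNIV \<phi>'"
    using 1 2 by (auto intro!: continuous_at_imp_continuous_on DERIV_isCont)
  show pd: "pd i (\<lambda>x. \<phi> (x s - c * x t)) = (\<lambda>x. \<phi>' (x s - c * x t) * (of_bool (i = s) - c * of_bool (i = t)))" for i
    by (rule C1_ridge(2)[OF 1 c(2)])
  have D2: "((\<lambda>u. \<phi>' u * d) has_real_derivative \<psi> u * d) (at u)" "continuous_on UNIV (\<lambda>u. \<psi> u * d)" for u d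
    by (auto intro!: derivative_eq_intros 2 continuous_intros 3)
  show "pd k (pd i (\<lambda>x. \<phi> (x s - c * x t))) = (\<lambda>x. \<psi> (x s - c * x t) *
           (of_bool (k = s) - c * of_bool (k = t)) * (of_bool (i = s) - c * of_bool (i = t)))"
    unfolding pd by (subst C1_ridge(2)[OF D2]) (simp add: mult_ac)
  have "continuous_on UNIV (\<lambda>x :: 'd config. x s - c * x t)" by (intro continuous_intros) simp_all
  then have "continuous_on UNIV (\<lambda>x :: 'd config. \<phi> (x s - c * x t))"
    using continuous_on_compose2[OF c(1)] by blast
  then show "C2 (\<lambda>x. \<phi> (x s - c * x t))"
    unfolding C2_iff pd using C1_ridge(1)[OF 1 c(2)] C1_ridge(1)[OF D2] by blast
qed

lemma DERIV_arctan': "(arctan has_real_derivative wt u) (at u)"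
  using DERIV_arctan[of u] by (simp add: wt_def inverse_eq_divide)

lemma DERIV_wt: "(wt has_real_derivative - 2 * u * (wt u)\<^sup>2) (at u)"
proof -
  have "1 + u\<^sup>2 \<noteq> 0" using add_pos_nonneg[of 1 "u\<^sup>2"] by simp
  then show ?thesis unfolding wt_def[abs_def]
    by (auto intro!: derivative_eq_intros simp: power2_eq_square)
qed

lemma continuous_wt: "continuous_on S wt"
  using DERIV_wt by (auto intro!: continuous_at_imp_continuous_on DERIV_isCont)

text \<open>By \<open>DERIV_wt\<close> the left side is the modulus of the second derivative of
  arctan, so arctan of a difference has mixed derivatives with exactly the decay that
  \<open>tame\<close> demands. The proof rests on
  \<open>2 * \<bar>u\<bar> \<le> 1 + u\<^sup>2\<close>.\<close>

lemma wt_deriv_le: "\<bar>- 2 * u * (wt u)\<^sup>2\<bar> \<le> wt u"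
proof -
  have "2 * \<bar>u\<bar> \<le> 1 + u\<^sup>2" using sum_squares_bound[of 1 "\<bar>u\<bar>"] by simp
  then have "2 * \<bar>u\<bar> * wt u \<le> 1" unfolding wt_def by (simp add: divide_le_eq_1 add_pos_nonneg)
  then have "2 * \<bar>u\<bar> * wt u * wt u \<le> 1 * wt u" by (intro mult_right_mono less_imp_le[OF wt_pos])
  then show ?thesis by (simp add: abs_mult power2_eq_square mult_ac)
qed

text \<open>Only derivatives at site 0 survive, and there the weight is \<open>wt 0 = 1\<close>, so
  plain boundedness suffices. The frequency \<open>2 * pi\<close> gives invariance under integer
  shifts, and its square dominates the bounds of all three orders.\<close>

lemma tame_trig:
  assumes T: "0 \<in> T" and f: "f = cos \<or> f = sin"
  shows "tame T (\<lambda>x :: 'd::finite config. f (2 * pi * x 0))"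
proof -
  obtain g where g: "\<And>u. (f has_real_derivative g u) (at u)" "\<And>u. (g has_real_derivative - f u) (at u)" "\<And>u. \<bar>g u\<bar> \<le> 1"
  proof -
    consider "f = cos" | "f = sin" using f by blast
    then show thesis
    proof cases
      case 1
      show thesis by (rule that[of "\<lambda>u. - sin u"]) (auto simp: 1 intro!: derivative_eq_intros)
    next
      case 2
      show thesis by (rule that[of cos]) (auto simp: 2 intro!: derivative_eq_intros)
    qed
  qed
  have fle: "\<bar>f u\<bar> \<le> 1" for u using f by auto
  define \<phi> where "\<phi> u = f (2 * pi * u)" for u
  have i: "((\<lambda>u. 2 * pi * u) has_real_derivative 2 * pi) (at u)" for u
    by (auto intro!: derivative_eq_intros)
  have d1: "(\<phi> has_real_derivative 2 * pi * g (2 * pi * u)) (at u)" for u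
  proof -
    have "((\<lambda>u. f (2 * pi * u)) has_real_derivative g (2 * pi * u) * (2 * pi)) (at u)"
      by (rule DERIV_chain2[OF g(1) i])
    then show ?thesis by (simp only: \<phi>_def[abs_def] mult.commute[of "2 * pi" "g _"])
  qed
  have d2: "((\<lambda>u. 2 * pi * g (2 * pi * u)) has_real_derivative - (2 * pi)\<^sup>2 * \<phi> u) (at u)" for u
  proof -
    have "((\<lambda>u. 2 * pi * g (2 * pi * u)) has_real_derivative 2 * pi * (- f (2 * pi * u) * (2 * pi))) (at u)"
      by (rule DERIV_cmult[OF DERIV_chain2[OF g(2) i]])
    moreover have "2 * pi * (- f (2 * pi * u) * (2 * pi)) = - (2 * pi)\<^sup>2 * \<phi> u"
      by (simp add: \<phi>_def power2_eq_square)
    ultimately show ?thesis by (simp only:)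
  qed
  have "continuous_on UNIV \<phi>" using d1 by (auto intro!: continuous_at_imp_continuous_on DERIV_isCont)
  then have c: "continuous_on UNIV (\<lambda>u. - (2 * pi)\<^sup>2 * \<phi> u)" by (intro continuous_intros)
  note R' = C2_ridge[OF d1 d2 c]
  have R1: "C2 (\<lambda>x :: 'd config. \<phi> (x 0))" using R'(1)[of 0 0 0] by simp
  have R2: "pd i (\<lambda>x :: 'd config. \<phi> (x 0)) = (\<lambda>x. 2 * pi * g (2 * pi * x 0) * of_bool (i = 0))" for i :: "int ^ 'd"
    using R'(2)[of i 0 0 0] by (simp only: mult_zero_left diff_zero)
  have R3: "pd i (\<lambda>x :: 'd config. 2 * pi * g (2 * pi * x 0) * of_bool (k = 0)) =
      (\<lambda>x. - (2 * pi)\<^sup>2 * \<phi> (x 0) * of_bool (i = 0) * of_bool (k = 0))" for i k :: "int ^ 'd"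
    using R'(3)[of i k 0 0 0] unfolding R'(2) by (simp only: mult_zero_left diff_zero)
  have pi: "(2 * pi)\<^sup>2 \<ge> 2 * pi" "2 * pi \<ge> 1" using pi_gt3 by (auto simp: power2_eq_square)
  have per: "f (2 * pi * (a + real_of_int l)) = f (2 * pi * a)" for a l
  proof -
    have "2 * pi * (a + real_of_int l) = 2 * pi * a + 2 * pi * real_of_int l" by (simp add: algebra_simps)
    then show ?thesis using f sin_integer_2pi cos_integer_2pi by (auto simp: sin_add cos_add)
  qed
  have "tame T (\<lambda>x :: 'd config. \<phi> (x 0))"
    unfolding tame_def R2 R3
  proof (intro conjI exI[of _ "(2 * pi)\<^sup>2"] allI)
    fix x :: "'d config" and i k :: "int ^ 'd"
    show "\<bar>\<phi> (x 0)\<bar> \<le> (2 * pi)\<^sup>2" using fle[of "2 * pi * x 0"] pi unfolding \<phi>_def by linarith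
    show "\<bar>2 * pi * g (2 * pi * x 0) * of_bool (i = 0)\<bar> \<le> (2 * pi)\<^sup>2 * wt (x i - x 0)"
    proof (cases "i = 0")
      case True
      have "2 * pi * \<bar>g (2 * pi * x 0)\<bar> \<le> 2 * pi * 1" using g(3) by (intro mult_left_mono) auto
      then have "2 * pi * \<bar>g (2 * pi * x 0)\<bar> \<le> (2 * pi)\<^sup>2" using pi(1) by linarith
      then show ?thesis using True by (simp add: abs_mult)
    qed (simp add: less_imp_le[OF wt_pos])
    show "\<bar>- (2 * pi)\<^sup>2 * \<phi> (x 0) * of_bool (i = 0) * of_bool (k = 0)\<bar> \<le> (2 * pi)\<^sup>2 * wt (x i - x k)"
    proof (cases "i = 0 \<and> k = 0")
      case True
      have "(2 * pi)\<^sup>2 * \<bar>\<phi> (x 0)\<bar> \<le> (2 * pi)\<^sup>2 * 1" using fle unfolding \<phi>_def by (intro mult_left_mono) auto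
      then show ?thesis using True by (simp add: abs_mult)
    qed (auto simp: less_imp_le[OF wt_pos])
  qed (use T R1 per in \<open>auto simp: depends_on_def \<phi>_def shift_def\<close>)
  then show ?thesis by (simp add: \<phi>_def)
qed

lemma tame_arctan:
  assumes T: "0 \<in> T" "t \<in> T"
  shows "tame T (\<lambda>x :: 'd::finite config. arctan (x t - x 0))"
proof -
  have c: "continuous_on UNIV (\<lambda>u. - 2 * u * (wt u)\<^sup>2)" by (intro continuous_intros continuous_wt)
  note R = C2_ridge[OF DERIV_arctan' DERIV_wt c]
  have R1: "C2 (\<lambda>x :: 'd config. arctan (x t - x 0))" using R(1)[of t 1 0] by simp
  have R2: "pd i (\<lambda>x :: 'd config. arctan (x t - x 0)) = (\<lambda>x. wt (x t - x 0) * (of_bool (i = t) - of_bool (i = 0)))" for i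
    using R(2)[of i t 1 0] by simp
  have R3: "pd i (\<lambda>x :: 'd config. wt (x t - x 0) * (of_bool (k = t) - of_bool (k = 0))) = (\<lambda>x. - 2 * (x t - x 0) * (wt (x t - x 0))\<^sup>2 *
      (of_bool (i = t) - of_bool (i = 0)) * (of_bool (k = t) - of_bool (k = 0)))" for i k
    using R(3)[of i k t 1 0] unfolding R(2) by (simp only: mult_1_left)
  have w0: "wt u \<ge> 0" for u using wt_pos by (rule less_imp_le)
  \<comment> \<open>\<open>pi / 2\<close> bounds arctan; being at least 1, it also serves for the
    two derivative estimates, which hold with constant 1.\<close>
  have pi: "pi / 2 \<ge> 1" using pi_gt3 by simp
  show ?thesis unfolding tame_def R2 R3
  proof (intro conjI exI[of _ "pi / 2"] allI)
    fix x :: "'d config" and i k :: "int ^ 'd"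
    show "\<bar>arctan (x t - x 0)\<bar> \<le> pi / 2" using arctan_bounded[of "x t - x 0"] by linarith
    have le: "a \<le> pi / 2 * b" if "a \<le> b" "b \<ge> 0" for a b
      using mult_right_mono[OF pi that(2)] that by linarith
    have "\<bar>wt (x t - x 0) * (of_bool (i = t) - of_bool (i = 0))\<bar> \<le> wt (x i - x 0)"
      using w0 wt_le_1 by auto
    then show "\<bar>wt (x t - x 0) * (of_bool (i = t) - of_bool (i = 0))\<bar> \<le> pi / 2 * wt (x i - x 0)"
      using w0 by (intro le) auto
    define Z where "Z = - 2 * (x t - x 0) * (wt (x t - x 0))\<^sup>2"
    have "\<bar>Z\<bar> \<le> wt (x t - x 0)" unfolding Z_def by (rule wt_deriv_le)
    then have "\<bar>Z * (of_bool (i = t) - of_bool (i = 0)) * (of_bool (k = t) - of_bool (k = 0))\<bar> \<le> wt (x i - x k)"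
      using w0 wt_le_1[of "x t - x 0"] by (auto simp: wt_minus[of "x 0" "x t"] intro: order.trans)
    then show "\<bar>- 2 * (x t - x 0) * (wt (x t - x 0))\<^sup>2 * (of_bool (i = t) - of_bool (i = 0)) * (of_bool (k = t) - of_bool (k = 0))\<bar> \<le> pi / 2 * wt (x i - x k)"
      unfolding Z_def using w0 by (rule le)
  qed (use T R1 in \<open>auto simp: depends_on_def shift_def\<close>)
qed

text \<open>The site \<^term>\<open>0\<close> is recorded modulo \<^term>\<open>1\<close> by a point of the circle; all other sites
  are recorded by their difference to it.\<close>
fun gen :: "(int ^ 'd::finite) option \<Rightarrow> 'd config \<Rightarrow> real" where
  "gen None x = cos (2 * pi * x 0)"
| "gen (Some t) x = (if t = 0 then sin (2 * pi * x 0) else arctan (x t - x 0))"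

definition mon :: "(int ^ 'd::finite) option list \<Rightarrow> 'd config \<Rightarrow> real" where
  "mon L x = (\<Prod>c\<leftarrow>L. gen c x)"

lemma mon_simps [simp]: "mon [] x = 1" "mon (c # L) x = gen c x * mon L x"
  by (simp_all add: mon_def)

definition gens :: "(int ^ 'd::finite) set \<Rightarrow> (int ^ 'd) option set" where
  "gens T = insert None (Some ` T)"

text \<open>Several words may denote the same monomial, which is harmless since only spans matter.
  Lists keep the index type countable, as \<open>morse_perturbation\<close> demands, and make degree
  a length.\<close>

definition words :: "(int ^ 'd::finite) set \<Rightarrow> nat \<Rightarrow> (int ^ 'd) option list set" where
  "words T n = {L. set L \<subseteq> gens T \<and> length L \<le> n}"

lemma finite_words: "finite T \<Longrightarrow> finite (words T n)"
  unfolding words_def by (rule finite_lists_length_le) (simp add: gens_def)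

lemma tame_gen:
  assumes "0 \<in> T" "c \<in> gens T" shows "tame T (gen c)"
proof (cases c)
  case None
  then show ?thesis using tame_trig[OF assms(1), of cos] by (simp add: gen.simps(1)[abs_def])
next
  case (Some t)
  then show ?thesis using tame_trig[OF assms(1), of sin] tame_arctan[OF assms(1), of t] assms(2)
    by (cases "t = 0") (auto simp: gen.simps(2)[abs_def] gens_def)
qed

lemma tame_mon:
  assumes "0 \<in> T" "set L \<subseteq> gens T" shows "tame T (mon L)"
  using assms(2)
proof (induction L)
  case Nil
  then show ?case using tame_const[of T 1] by (simp add: mon_def[abs_def])
next
  case (Cons c L)
  then show ?case using tame_mult[OF tame_gen[OF assms(1), of c], of "mon L"] by (simp add: mon_def[abs_def])
qed

section \<open>Polynomials of bounded degree in the generators\<close>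

definition in_span :: "(int ^ 'd::finite) set \<Rightarrow> nat \<Rightarrow> ('d config \<Rightarrow> real) \<Rightarrow> bool" where
  "in_span T n f \<longleftrightarrow> (\<exists>c. f = (\<lambda>x. \<Sum>L\<in>words T n. c L * mon L x))"

lemma in_spanI: "(\<And>x. f x = (\<Sum>L\<in>words T n. c L * mon L x)) \<Longrightarrow> in_span T n f"
  unfolding in_span_def by blast

lemma in_span_mono:
  assumes "in_span T m f" "m \<le> n" "finite T" shows "in_span T n f"
proof -
  obtain c where c: "f = (\<lambda>x. \<Sum>L\<in>words T m. c L * mon L x)" using assms in_span_def by blast
  have "f x = (\<Sum>L\<in>words T n. (if L \<in> words T m then c L else 0) * mon L x)" for x
    unfolding c using assms(2)
    by (intro sum.mono_neutral_cong_left finite_words assms(3)) (auto simp: words_def)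
  then show ?thesis by (rule in_spanI)
qed

lemma in_span_const: "finite T \<Longrightarrow> in_span T n (\<lambda>x. a)"
proof -
  assume T: "finite T"
  have "a = (\<Sum>L\<in>words T n. (if L = [] then a else 0) * mon L x)" for x
  proof -
    have "(\<Sum>L\<in>words T n. (if L = [] then a else 0) * mon L x) = (\<Sum>L\<in>words T n. if L = [] then a else 0)"
      by (rule sum.cong) auto
    also have "\<dots> = a" using finite_words[OF T] by (simp add: words_def)
    finally show ?thesis by simp
  qed
  then show ?thesis by (rule in_spanI)
qed

lemma in_span_add:
  assumes "in_span T n f" "in_span T n g" shows "in_span T n (\<lambda>x. f x + g x)"
proof -
  obtain c d where "f = (\<lambda>x. \<Sum>L\<in>words T n. c L * mon L x)" "g = (\<lambda>x. \<Sum>L\<in>words T n. d L * mon L x)"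
    using assms unfolding in_span_def by blast
  then show ?thesis by (intro in_spanI[where c = "\<lambda>L. c L + d L"]) (simp add: distrib_right sum.distrib)
qed

lemma in_span_cmult:
  assumes "in_span T n f" shows "in_span T n (\<lambda>x. a * f x)"
proof -
  obtain c where "f = (\<lambda>x. \<Sum>L\<in>words T n. c L * mon L x)"
    using assms unfolding in_span_def by blast
  then show ?thesis by (intro in_spanI[where c = "\<lambda>L. a * c L"]) (simp add: sum_distrib_left mult_ac)
qed

lemma in_span_sum:
  assumes "finite T" "\<And>a. a \<in> A \<Longrightarrow> in_span T n (f a)"
  shows "in_span T n (\<lambda>x. \<Sum>a\<in>A. f a x)"
  using assms(2) by (induction A rule: infinite_finite_induct) (auto intro: in_span_const in_span_add assms(1))

lemma in_span_gen_mult: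
  assumes T: "finite T" and f: "in_span T n f" and c: "c \<in> gens T"
  shows "in_span T (Suc n) (\<lambda>x. gen c x * f x)"
proof -
  obtain d where d: "f = (\<lambda>x. \<Sum>L\<in>words T n. d L * mon L x)" using f in_span_def by blast
  have "in_span T (Suc n) (\<lambda>x. mon (c # L) x)" if "L \<in> words T n" for L
  proof -
    have cL: "c # L \<in> words T (Suc n)" using that c by (auto simp: words_def)
    have "mon (c # L) x = (\<Sum>L'\<in>words T (Suc n). (if L' = c # L then 1 else 0) * mon L' x)" for x
    proof -
      have "(\<Sum>L'\<in>words T (Suc n). (if L' = c # L then 1 else 0) * mon L' x) =
          (\<Sum>L'\<in>words T (Suc n). if L' = c # L then mon (c # L) x else 0)"
        by (rule sum.cong) auto
      also have "\<dots> = mon (c # L) x" using finite_words[OF T] cL by (subst sum.delta) auto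
      finally show ?thesis by simp
    qed
    then show ?thesis by (rule in_spanI)
  qed
  then have "in_span T (Suc n) (\<lambda>x. \<Sum>L\<in>words T n. d L * mon (c # L) x)"
    by (intro in_span_sum in_span_cmult T)
  moreover have "(\<lambda>x. \<Sum>L\<in>words T n. d L * mon (c # L) x) = (\<lambda>x. gen c x * f x)"
    by (simp add: d sum_distrib_left mult_ac)
  ultimately show ?thesis by simp
qed

lemma in_span_mult:
  assumes T: "finite T" and f: "in_span T m f" and g: "in_span T n g"
  shows "in_span T (m + n) (\<lambda>x. f x * g x)"
proof -
  obtain d where d: "f = (\<lambda>x. \<Sum>L\<in>words T m. d L * mon L x)" using f in_span_def by blast
  have "in_span T (length L + n) (\<lambda>x. mon L x * g x)" if "set L \<subseteq> gens T" for L
    using that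
  proof (induction L)
    case Nil
    then show ?case using g by simp
  next
    case (Cons c L)
    then show ?case using in_span_gen_mult[OF T, of "length L + n" "\<lambda>x. mon L x * g x" c] by (simp add: mult.assoc)
  qed
  then have "in_span T (m + n) (\<lambda>x. mon L x * g x)" if "L \<in> words T m" for L
    by (rule in_span_mono[where m = "length L + n"]) (use that T in \<open>auto simp: words_def\<close>)
  then have "in_span T (m + n) (\<lambda>x. \<Sum>L\<in>words T m. d L * (mon L x * g x))"
    by (intro in_span_sum in_span_cmult T)
  then show ?thesis by (simp add: d sum_distrib_right mult.assoc)
qed

lemma in_span_gen: "finite T \<Longrightarrow> c \<in> gens T \<Longrightarrow> in_span T 1 (gen c)"
  using in_span_gen_mult[of T 0 "\<lambda>x. 1" c] in_span_const[of T 0 1] by simp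

lemma in_span_prod:
  assumes T: "finite T" and "\<And>a. a \<in> A \<Longrightarrow> in_span T n (f a)" and A: "finite A"
  shows "in_span T (card A * n) (\<lambda>x. \<Prod>a\<in>A. f a x)"
  using A assms(2)
proof (induction A)
  case empty
  then show ?case using in_span_const[OF T] by simp
next
  case (insert a A)
  then show ?case using in_span_mult[OF T, of n "f a" "card A * n" "\<lambda>x. \<Prod>a\<in>A. f a x"] by simp
qed

lemma smoothI: "C2 f \<Longrightarrow> finite T \<Longrightarrow> depends_on T f \<Longrightarrow> smooth f"
  unfolding smooth_def by (intro conjI exI)

lemma smooth_tame: "finite T \<Longrightarrow> tame T f \<Longrightarrow> smooth f"
  unfolding tame_def by (elim conjE) (rule smoothI)

lemma smooth_shift:
  assumes "smooth f" shows "smooth (\<lambda>x. f (shift j l x))"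
proof -
  obtain T where "C2 f" "finite T" "depends_on T f" using assms smooth_def by blast
  then show ?thesis by (intro smoothI[OF C2_shift(1) _ dep_shift] finite_imageI)
qed

lemma smooth_mult:
  assumes "smooth f" "smooth g" shows "smooth (\<lambda>x. f x * g x)"
proof -
  obtain T U where "finite T" "depends_on T f" "finite U" "depends_on U g" using assms smooth_def by blast
  then have "finite (T \<union> U)" "depends_on (T \<union> U) (\<lambda>x. f x * g x)"
    by (auto intro: dep_mult dep_mono)
  then show ?thesis using assms C2_mult(1) unfolding smooth_def by blast
qed

lemma smooth_prod: "(\<And>a. a \<in> A \<Longrightarrow> smooth (f a)) \<Longrightarrow> smooth (\<lambda>x. \<Prod>a\<in>A. f a x)"
  by (induction A rule: infinite_finite_induct) (auto intro: smooth_const smooth_mult)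

lemma dderiv_mult:
  assumes "smooth f" "smooth g"
  shows "dderiv (\<lambda>x. f x * g x) x v = dderiv f x v * g x + dderiv g x v * f x"
  using DERIV_mult[OF smooth_has_dderiv[OF assms(1), of x v 0] smooth_has_dderiv[OF assms(2), of x v 0]]
  by (intro dderivI) simp

lemma dderiv_shift: "dderiv (\<lambda>x. f (shift j l x)) x v = dderiv f (shift j l x) (\<lambda>i. v (i + j))"
proof -
  have "shift j l (\<lambda>i. x i + t * v i) = (\<lambda>i. shift j l x i + t * v (i + j))" for t
    by (simp add: shift_def fun_eq_iff)
  then show ?thesis by (simp add: dderiv_def)
qed

context periods
begin

text \<open>Equal generators give equal differences \<open>x (t + i) - x i = x (t + j) - x j\<close>
  on \<open>T\<close>; since \<open>T\<close> contains a fundamental domain, periodicity extends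
  this to all \<open>t\<close>. As \<open>x i - x j\<close> is an integer, \<open>x\<close> is its
  own translate by \<open>i - j\<close> up to that integer, and \<open>Xpq_free\<close> makes
  \<open>i - j\<close> a period.\<close>

lemma gen_separates:
  assumes T: "Bp p \<subseteq> T" "0 \<in> T" and x: "x \<in> Xpq p q" and ij: "i \<in> Bp p" "j \<in> Bp p"
    and eq: "\<And>c. c \<in> gens T \<Longrightarrow> gen c (shift i 0 x) = gen c (shift j 0 x)"
  shows "i = j"
proof -
  have "cos (2 * pi * x i) = cos (2 * pi * x j)" using eq[of None] by (simp add: gens_def shift_def)
  moreover have "sin (2 * pi * x i) = sin (2 * pi * x j)" using eq[of "Some 0"] T by (simp add: gens_def shift_def)
  ultimately obtain n :: int where "2 * pi * x i = 2 * pi * x j + 2 * pi * real_of_int n"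
    using sin_cos_eq_iff[of "2 * pi * x i" "2 * pi * x j"] by (auto elim!: Ints_cases)
  then have n: "x i - x j = real_of_int n" by (simp add: distrib_left[symmetric])
  have T': "x (t + i) - x i = x (t + j) - x j" if "t \<in> T" for t
  proof (cases "t = 0")
    case False
    then show ?thesis using eq[of "Some t"] that by (simp add: gens_def shift_def arctan_eq_iff)
  qed simp
  have all: "x (t + i) - x i = x (t + j) - x j" for t
  proof -
    obtain b c where b: "b \<in> Bp p" "t = b + lat p c" using Bp_rep by blast
    have "x (t + k) = x (b + k) - real_of_int (\<Sum>m\<in>UNIV. c m * q m)" for k
      using Xpq_lat[OF x, of "b + k" c] b by (simp add: add_ac eq_diff_eq)
    then show ?thesis using T'[of b] b T by auto
  qed
  have "x (m + (i - j)) = x m + real_of_int n" for m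
    using all[of "m - j"] n by (simp add: algebra_simps)
  then obtain c where "i - j = lat p c" using Xpq_free[OF x] by blast
  then have "i = j + lat p c" by (simp add: algebra_simps)
  then show ?thesis using Bp_unique ij by blast
qed

text \<open>The witness is \<open>g * E\<close>: the factor \<open>E\<close> vanishes to second order at all points
  \<^term>\<open>shift j 0 x\<close> with \<open>j \<noteq> i\<close>, while \<open>g\<close>, which is \<open>sin (2 * pi * (y 0 - x i))\<close>, has a simple
  zero at \<^term>\<open>shift i 0 x\<close>.\<close>
lemma gradients_span:
  assumes T: "finite T" "Bp p \<subseteq> T" "0 \<in> T" and x: "x \<in> Xpq p q" and i: "i \<in> Bp p"
  shows "\<exists>c. \<forall>k\<in>Bp p. (\<Sum>L\<in>words T (1 + 2 * card (Bp p)). c L * grd (\<lambda>x. \<Sum>j\<in>Bp p. mon L (shift j 0 x)) k x) = (if i = k then 1 else 0)"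
proof -
  \<comment> \<open>Degree 1 for \<open>g\<close>, plus degree 2 for each factor of
    \<open>E\<close>, of which there are fewer than \<open>card (Bp p)\<close>.\<close>
  let ?N = "1 + 2 * card (Bp p)"
  \<comment> \<open>A sum of squares of differences of generators: value and derivative vanish at
    \<open>shift j 0 x\<close>, while \<open>gen_separates\<close> makes it positive at
    \<open>shift i 0 x\<close> for \<open>i \<noteq> j\<close>.\<close>
  define Q where "Q j y = (\<Sum>c\<in>gens T. (gen c y - gen c (shift j 0 x)) * (gen c y - gen c (shift j 0 x)))" for j y
  define E where "E y = (\<Prod>j\<in>Bp p - {i}. Q j y)" for y
  define g where "g y = cos (2 * pi * x i) * gen (Some 0) y + - sin (2 * pi * x i) * gen None y" for y :: "'d config"
  have fg: "finite (gens T)" using T by (simp add: gens_def)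
  have spQ: "in_span T 2 (Q j)" for j
  proof -
    have "in_span T 1 (\<lambda>y. gen c y - a)" if "c \<in> gens T" for c a
      using in_span_add[OF in_span_gen[OF T(1) that] in_span_const[OF T(1), of 1 "- a"]] by simp
    then have "in_span T (1 + 1) (\<lambda>y. (gen c y - a) * (gen c y - a))" if "c \<in> gens T" for c a
      using in_span_mult[OF T(1)] that by blast
    then show ?thesis unfolding Q_def by (intro in_span_sum T(1)) (simp add: numeral_2_eq_2)
  qed
  have "in_span T (1 + card (Bp p - {i}) * 2) (\<lambda>y. g y * E y)"
    unfolding E_def g_def
    by (intro in_span_mult in_span_prod in_span_add in_span_cmult in_span_gen spQ T(1)) (use T finite_Bp in \<open>auto simp: gens_def\<close>)
  then have "in_span T ?N (\<lambda>y. g y * E y)"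
    by (rule in_span_mono) (use i finite_Bp T in auto)
  then obtain d where d: "(\<lambda>y. g y * E y) = (\<lambda>y. \<Sum>L\<in>words T ?N. d L * mon L y)" unfolding in_span_def by blast
  have smg: "smooth (gen c)" if "c \<in> gens T" for c using smooth_tame tame_gen T that by blast
  have smd: "smooth (\<lambda>y. gen c y - a)" if "c \<in> gens T" for c a
    using smooth_add[OF smg[OF that] smooth_const[of "- a"]] by simp
  have smQ: "smooth (Q j)" for j unfolding Q_def by (intro smooth_sum smooth_mult smd)
  have smG: "smooth g" unfolding g_def by (intro smooth_add smooth_cmult smg) (use T in \<open>auto simp: gens_def\<close>)
  have smP: "smooth (\<lambda>y. \<Prod>j\<in>J. Q j y)" for J by (intro smooth_prod smQ)
  have smm: "smooth (mon L)" if "L \<in> words T ?N" for L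
    by (rule smooth_tame[OF T(1) tame_mon[OF T(3)]]) (use that in \<open>simp add: words_def\<close>)
  have Q0: "Q j (shift j 0 x) = 0" for j by (simp add: Q_def)
  have dQ: "dderiv (Q j) (shift j 0 x) v = 0" for j v
  proof -
    have "dderiv (Q j) (shift j 0 x) v = (\<Sum>c\<in>gens T. dderiv (\<lambda>y. (gen c y - gen c (shift j 0 x)) * (gen c y - gen c (shift j 0 x))) (shift j 0 x) v)"
      unfolding Q_def by (intro dderiv_sum smooth_mult smd)
    also have "\<dots> = 0" by (intro sum.neutral ballI) (simp add: dderiv_mult smd)
    finally show ?thesis .
  qed
  have off: "dderiv (\<lambda>y. g y * E y) (shift j 0 x) v = 0" if j: "j \<in> Bp p" "j \<noteq> i" for j v
  proof -
    have "(\<lambda>y. g y * E y) = (\<lambda>y. Q j y * (g y * (\<Prod>j\<in>Bp p - {i} - {j}. Q j y)))"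
      unfolding E_def using j finite_Bp by (subst prod.remove[of _ j]) (auto simp: mult_ac)
    then show ?thesis using Q0 dQ by (simp add: dderiv_mult smQ smooth_mult smG smP)
  qed
  have g0: "g (shift i 0 x) = 0" by (simp add: g_def shift_def)
  have dg: "dderiv g (shift i 0 x) v = 2 * pi * v 0" for v
  proof (rule dderivI)
    let ?a = "2 * pi * x i"
    have "((\<lambda>t. cos ?a * sin (2 * pi * (x i + t * v 0)) - sin ?a * cos (2 * pi * (x i + t * v 0))) has_real_derivative
        cos ?a * (cos ?a * (2 * pi * v 0)) - sin ?a * (- sin ?a * (2 * pi * v 0))) (at 0)"
      by (auto intro!: derivative_eq_intros)
    moreover have "cos ?a * (cos ?a * (2 * pi * v 0)) - sin ?a * (- sin ?a * (2 * pi * v 0)) = ((sin ?a)\<^sup>2 + (cos ?a)\<^sup>2) * (2 * pi * v 0)"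
    proof -
      have "c * (c * w) - s * (- s * w) = (s\<^sup>2 + c\<^sup>2) * w" for c s w :: real
        by (simp add: power2_eq_square algebra_simps)
      then show ?thesis .
    qed
    ultimately show "((\<lambda>t. g (\<lambda>n. shift i 0 x n + t * v n)) has_real_derivative 2 * pi * v 0) (at 0)"
      by (simp add: g_def shift_def)
  qed
  define e where "e = E (shift i 0 x)"
  have e: "e > 0"
    unfolding e_def E_def
  proof (rule prod_pos)
    fix j assume j: "j \<in> Bp p - {i}"
    obtain c where c: "c \<in> gens T" "gen c (shift i 0 x) \<noteq> gen c (shift j 0 x)"
      using gen_separates[OF T(2,3) x i, of j] j by blast
    then show "Q j (shift i 0 x) > 0" unfolding Q_def
      by (intro sum_pos2[OF fg c(1)]) (auto simp: zero_less_mult_iff)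
  qed
  have on: "dderiv (\<lambda>y. g y * E y) (shift i 0 x) v = 2 * pi * e * v 0" for v
    using smP by (simp add: dderiv_mult smG E_def[abs_def] dg g0) (simp add: e_def E_def)
  \<comment> \<open>The coefficients \<open>d\<close> of the witness produce
    \<open>2 * pi * e\<close> times the unit covector \<open>i\<close>; the division normalises
    this.\<close>
  define c where "c L = d L / (2 * pi * e)" for L
  have "(\<Sum>L\<in>words T ?N. c L * grd (\<lambda>x. \<Sum>j\<in>Bp p. mon L (shift j 0 x)) k x) = (if i = k then 1 else 0)" if k: "k \<in> Bp p" for k
  proof -
    have "grd (\<lambda>x. \<Sum>j\<in>Bp p. mon L (shift j 0 x)) k x = (\<Sum>j\<in>Bp p. dderiv (mon L) (shift j 0 x) (\<lambda>n. ind k (n + j)))"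
      if "L \<in> words T ?N" for L
      unfolding grd_def using smm[OF that] by (subst dderiv_sum) (auto simp: smooth_shift dderiv_shift)
    then have "(\<Sum>L\<in>words T ?N. d L * grd (\<lambda>x. \<Sum>j\<in>Bp p. mon L (shift j 0 x)) k x) =
        (\<Sum>L\<in>words T ?N. \<Sum>j\<in>Bp p. d L * dderiv (mon L) (shift j 0 x) (\<lambda>n. ind k (n + j)))"
      by (simp add: sum_distrib_left)
    also have "\<dots> = (\<Sum>j\<in>Bp p. \<Sum>L\<in>words T ?N. d L * dderiv (mon L) (shift j 0 x) (\<lambda>n. ind k (n + j)))" by (rule sum.swap)
    also have "\<dots> = (\<Sum>j\<in>Bp p. dderiv (\<lambda>y. g y * E y) (shift j 0 x) (\<lambda>n. ind k (n + j)))"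
      unfolding d by (intro sum.cong refl, subst dderiv_sum) (auto simp: smm smooth_cmult dderiv_cmult)
    \<comment> \<open>Only the translate \<open>j = i\<close> contributes. There the direction has
      the value \<open>ind k (0 + i)\<close> at site 0, the Kronecker delta of \<open>i\<close> and
      \<open>k\<close>.\<close>
    also have "\<dots> = (\<Sum>j\<in>Bp p. if j = i then 2 * pi * e * ind k i else 0)"
      by (intro sum.cong refl) (auto simp: on off)
    also have "\<dots> = 2 * pi * e * ind k i" using i finite_Bp by simp
    also have "\<dots> = 2 * pi * e * (if i = k then 1 else 0)" by (simp add: ind_Bp[OF k i])
    finally show ?thesis using e unfolding c_def by (simp add: sum_divide_distrib[symmetric] divide_simps)
  qed
  then show ?thesis by blast
qed

end

section \<open>The twisting pair potential\<close>

text \<open>A convex function whose second derivative is \<^term>\<open>wt\<close>.\<close>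
definition arctan_int :: "real \<Rightarrow> real" where
  "arctan_int u = u * arctan u - ln (1 + u\<^sup>2) / 2"

lemma DERIV_arctan_int: "(arctan_int has_real_derivative arctan u) (at u)"
proof -
  have p: "1 + u\<^sup>2 > 0" by (simp add: add_pos_nonneg)
  have "((\<lambda>u. ln (1 + u\<^sup>2) / 2) has_real_derivative u / (1 + u\<^sup>2)) (at u)"
    using p by (auto intro!: derivative_eq_intros simp: divide_simps)
  from DERIV_diff[OF DERIV_mult[OF DERIV_ident DERIV_arctan'] this]
  have "((\<lambda>u. u * arctan u - ln (1 + u\<^sup>2) / 2) has_real_derivative 1 * arctan u + wt u * u - u / (1 + u\<^sup>2)) (at u)" .
  moreover have "1 * arctan u + wt u * u - u / (1 + u\<^sup>2) = arctan u" by (simp add: wt_def)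
  ultimately show ?thesis by (simp add: arctan_int_def[abs_def])
qed

text \<open>The mean value theorem writes \<open>arctan_int u\<close> as \<open>u * arctan z\<close>
  with \<open>z\<close> on the same side of 0 as \<open>u\<close>. The linear upper bound is what
  lets bounded oscillation control the pair potentials on periodic Birkhoff configurations.\<close>

lemma arctan_int_bounds: "0 \<le> arctan_int u" "arctan_int u \<le> 2 * \<bar>u\<bar>"
proof -
  have z: "arctan_int 0 = 0" by (simp add: arctan_int_def)
  have "\<exists>z. arctan_int u = u * arctan z \<and> 0 \<le> z * u"
  proof -
    consider "u = 0" | "0 < u" | "u < 0" by linarith
    then show ?thesis
    proof cases
      case 1 then show ?thesis by (simp add: z)
    next
      case 2
      from MVT2[OF this DERIV_arctan_int] obtain y where "0 < y" "y < u" "arctan_int u - arctan_int 0 = (u - 0) * arctan y" by blast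
      then show ?thesis using z by (intro exI[of _ y]) auto
    next
      case 3
      from MVT2[OF this DERIV_arctan_int] obtain y where "u < y" "y < 0" "arctan_int 0 - arctan_int u = (0 - u) * arctan y" by blast
      then show ?thesis using z by (intro exI[of _ y]) (auto simp: mult_nonpos_nonpos)
    qed
  qed
  then obtain y where y: "arctan_int u = u * arctan y" "0 \<le> y * u" by blast
  show "0 \<le> arctan_int u" unfolding y(1) using y(2)
    by (auto simp: zero_le_mult_iff)
  have "\<bar>arctan y\<bar> \<le> 2" using arctan_bounded[of y] pi_less_4 by linarith
  then have "\<bar>u\<bar> * \<bar>arctan y\<bar> \<le> \<bar>u\<bar> * 2" by (intro mult_left_mono) auto
  then show "arctan_int u \<le> 2 * \<bar>u\<bar>" unfolding y(1) by (simp add: abs_mult[symmetric] mult.commute) 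
qed

text \<open>Ordered pairs avoid choosing an order on the sites: \<open>arctan_int\<close> is even,
  so each pair counts twice, and the diagonal terms vanish.\<close>

definition twist :: "(int ^ 'd::finite) set \<Rightarrow> 'd config \<Rightarrow> real" where
  "twist T x = (\<Sum>s\<in>T. \<Sum>t\<in>T. arctan_int (x s - x t))"

lemma twist_C2:
  fixes T :: "(int ^ 'd::finite) set"
  shows C2_twist: "C2 (twist T)"
    and pd_twist: "pd i (twist T) = (\<lambda>x. \<Sum>s\<in>T. \<Sum>t\<in>T. arctan (x s - x t) * (of_bool (i = s) - of_bool (i = t)))"
    and pd2_twist: "pd k (pd i (twist T)) = (\<lambda>x. \<Sum>s\<in>T. \<Sum>t\<in>T. wt (x s - x t) *
        (of_bool (k = s) - of_bool (k = t)) * (of_bool (i = s) - of_bool (i = t)))"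
proof -
  note R = C2_ridge[OF DERIV_arctan_int DERIV_arctan' continuous_wt]
  have R1: "C2 (\<lambda>x :: 'd config. arctan_int (x s - x t))" for s t using R(1)[of s 1 t] by simp
  have R2: "pd i (\<lambda>x :: 'd config. arctan_int (x s - x t)) = (\<lambda>x. arctan (x s - x t) * (of_bool (i = s) - of_bool (i = t)))" for i s t
    using R(2)[of i s 1 t] by (simp only: mult_1_left)
  have R3: "pd k (pd i (\<lambda>x :: 'd config. arctan_int (x s - x t))) = (\<lambda>x. wt (x s - x t) *
        (of_bool (k = s) - of_bool (k = t)) * (of_bool (i = s) - of_bool (i = t)))" for i k s t
    using R(3)[of k i s 1 t] by (simp only: mult_1_left)
  note inner = C2_sum[where f = "\<lambda>t x. arctan_int (x s - x t)" for s, OF R1]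
  note outer = C2_sum[where f = "\<lambda>s x. \<Sum>t\<in>T. arctan_int (x s - x t)", OF inner(1)]
  show "C2 (twist T)" unfolding twist_def[abs_def] by (rule outer(1))
  show "pd i (twist T) = (\<lambda>x. \<Sum>s\<in>T. \<Sum>t\<in>T. arctan (x s - x t) * (of_bool (i = s) - of_bool (i = t)))"
    unfolding twist_def[abs_def] outer(2) inner(2) R2 ..
  show "pd k (pd i (twist T)) = (\<lambda>x. \<Sum>s\<in>T. \<Sum>t\<in>T. wt (x s - x t) *
        (of_bool (k = s) - of_bool (k = t)) * (of_bool (i = s) - of_bool (i = t)))"
    unfolding twist_def[abs_def] outer(3) inner(3) R3 ..
qed

lemma abs_double_sum_le:
  fixes g :: "'a \<Rightarrow> 'a \<Rightarrow> real"
  assumes "\<And>s t. \<bar>g s t\<bar> \<le> a"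
  shows "\<bar>\<Sum>s\<in>T. \<Sum>t\<in>T. g s t\<bar> \<le> (real (card T))\<^sup>2 * a"
proof -
  have "\<bar>\<Sum>s\<in>T. \<Sum>t\<in>T. g s t\<bar> \<le> (\<Sum>s\<in>T. \<Sum>t\<in>T. a)"
    by (intro order.trans[OF sum_abs] sum_mono assms)
  then show ?thesis by (simp add: power2_eq_square mult.assoc)
qed

lemma twist_bounds:
  shows twist_nonneg: "0 \<le> twist T x"
    and pd_twist_le: "\<bar>pd i (twist T) x\<bar> \<le> 2 * (real (card T))\<^sup>2"
    and pd2_twist_le: "\<bar>pd k (pd i (twist T)) x\<bar> \<le> 2 * (real (card T))\<^sup>2"
proof -
  show "0 \<le> twist T x" unfolding twist_def by (intro sum_nonneg arctan_int_bounds)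
  have a2: "\<bar>arctan u\<bar> \<le> 2" for u using arctan_bounded[of u] pi_less_4 by linarith
  have "\<bar>arctan (x s - x t) * (of_bool (i = s) - of_bool (i = t))\<bar> \<le> 2" for s t
    using a2[of "x s - x t"] by auto
  from abs_double_sum_le[where g = "\<lambda>s t. arctan (x s - x t) * (of_bool (i = s) - of_bool (i = t))", OF this, of T]
  show "\<bar>pd i (twist T) x\<bar> \<le> 2 * (real (card T))\<^sup>2" unfolding pd_twist by simp
  have "\<bar>wt (x s - x t) * (of_bool (k = s) - of_bool (k = t)) * (of_bool (i = s) - of_bool (i = t))\<bar> \<le> 2" for s t
    using wt_le_1[of "x s - x t"] less_imp_le[OF wt_pos[of "x s - x t"]] by auto
  from abs_double_sum_le[where g = "\<lambda>s t. wt (x s - x t) * (of_bool (k = s) - of_bool (k = t)) * (of_bool (i = s) - of_bool (i = t))", OF this, of T]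
  show "\<bar>pd k (pd i (twist T)) x\<bar> \<le> 2 * (real (card T))\<^sup>2" unfolding pd2_twist by simp
qed

text \<open>By convexity every pair contributes nonpositively to a mixed derivative; keeping just
  the ordered pair \<open>(i, k)\<close> already gives the bound.\<close>

lemma twist_mixed:
  assumes T: "finite T" and ik: "i \<in> T" "k \<in> T" "i \<noteq> k"
  shows "pd i (pd k (twist T)) x \<le> - wt (x i - x k)"
proof -
  define g where "g s t = wt (x s - x t) * (of_bool (i = s) - of_bool (i = t)) * (of_bool (k = s) - of_bool (k = t))" for s t
  have g: "g s t \<le> 0" for s t
    using ik less_imp_le[OF wt_pos[of "x s - x t"]] by (auto simp: g_def)
  have "pd i (pd k (twist T)) x = (\<Sum>s\<in>T. \<Sum>t\<in>T. g s t)" by (simp add: pd2_twist g_def)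
  also have "\<dots> = (\<Sum>t\<in>T. g i t) + (\<Sum>s\<in>T-{i}. \<Sum>t\<in>T. g s t)"
    by (rule sum.remove[OF T ik(1)])
  also have "(\<Sum>t\<in>T. g i t) = g i k + (\<Sum>t\<in>T-{k}. g i t)" by (rule sum.remove[OF T ik(2)])
  also have "g i k + (\<Sum>t\<in>T-{k}. g i t) + (\<Sum>s\<in>T-{i}. \<Sum>t\<in>T. g s t) \<le> g i k + 0 + 0"
    by (intro add_mono order.refl sum_nonpos g)
  also have "\<dots> = - wt (x i - x k)" using ik by (simp add: g_def)
  finally show ?thesis .
qed

lemma twist_dep: "depends_on T (twist T)"
  unfolding depends_on_def twist_def by auto

lemma twist_shift0: "twist T (shift 0 l x) = twist T x"
  by (simp add: twist_def shift_def)

section \<open>Perturbations that preserve (A) to (E)\<close>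

definition admissible :: "(int ^ 'd::finite) set \<Rightarrow> real \<Rightarrow> ('d config \<Rightarrow> real) \<Rightarrow> bool" where
  "admissible T C P \<longleftrightarrow> C2 P \<and> depends_on T P \<and> (\<forall>l x. P (shift 0 l x) = P x) \<and> (\<forall>x. - C \<le> P x) \<and>
    (\<forall>i x. \<bar>pd i P x\<bar> \<le> C) \<and> (\<forall>i k x. \<bar>pd i (pd k P) x\<bar> \<le> C) \<and> (\<forall>i k x. i \<noteq> k \<longrightarrow> pd i (pd k P) x \<le> 0)"

text \<open>The choice of \<open>\<delta>\<close> makes the sum of
  \<open>\<bar>c a\<bar> * C a\<close> at most 1. The mixed derivative of the combination is then at
  most \<open>wt (x i - x k)\<close> in modulus, precisely what \<open>twist_mixed\<close> offers
  for sites in \<open>T\<close>; if one of the sites lies outside \<open>T\<close>, the mixed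
  derivative is 0. Neither \<open>\<delta>\<close> nor the constant depends on \<open>c\<close>,
  which later gives estimates uniform in \<open>n\<close>.\<close>

lemma admissible_twist_plus_small:
  fixes T :: "(int ^ 'd::finite) set"
  assumes T: "finite T" and A: "finite A" and F: "\<And>a. a \<in> A \<Longrightarrow> tame T (F a)"
  shows "\<exists>\<delta>>0. \<exists>C. \<forall>c. (\<forall>a\<in>A. \<bar>c a\<bar> < \<delta>) \<longrightarrow>
      admissible T C (\<lambda>x. twist T x + (\<Sum>a\<in>A. c a * F a x)) \<and> (\<forall>x. \<bar>\<Sum>a\<in>A. c a * F a x\<bar> \<le> 1)"
proof -
  have "\<forall>a\<in>A. \<exists>C. \<forall>x. \<bar>F a x\<bar> \<le> C \<and> (\<forall>i. \<bar>pd i (F a) x\<bar> \<le> C * wt (x i - x 0)) \<and>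
        (\<forall>i k. \<bar>pd i (pd k (F a)) x\<bar> \<le> C * wt (x i - x k))"
    using F unfolding tame_def by blast
  from bchoice[OF this] obtain C where C: "\<And>a x. a \<in> A \<Longrightarrow> \<bar>F a x\<bar> \<le> C a"
    "\<And>a i x. a \<in> A \<Longrightarrow> \<bar>pd i (F a) x\<bar> \<le> C a * wt (x i - x 0)"
    "\<And>a i k x. a \<in> A \<Longrightarrow> \<bar>pd i (pd k (F a)) x\<bar> \<le> C a * wt (x i - x k)" by blast
  have C0: "C a \<ge> 0" if "a \<in> A" for a using C(1)[OF that, of "\<lambda>i. 0"] by linarith
  define \<delta> where "\<delta> = 1 / (1 + (\<Sum>a\<in>A. C a))"
  have s0: "(\<Sum>a\<in>A. C a) \<ge> 0" using C0 by (rule sum_nonneg)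
  have \<delta>: "\<delta> > 0" "\<delta> * (\<Sum>a\<in>A. C a) \<le> 1" using s0 by (auto simp: \<delta>_def divide_le_eq)
  have small: "\<bar>\<Sum>a\<in>A. c a * g a\<bar> \<le> w" if c: "\<forall>a\<in>A. \<bar>c a\<bar> < \<delta>" and g: "\<And>a. a \<in> A \<Longrightarrow> \<bar>g a\<bar> \<le> C a * w" and w: "w \<ge> 0" for c g w
  proof -
    have "\<bar>\<Sum>a\<in>A. c a * g a\<bar> \<le> (\<Sum>a\<in>A. \<bar>c a\<bar> * \<bar>g a\<bar>)" using sum_abs[of "\<lambda>a. c a * g a" A] by (simp add: abs_mult)
    also have "\<dots> \<le> (\<Sum>a\<in>A. \<delta> * (C a * w))"
      using c \<delta>(1) by (intro sum_mono mult_mono g) (auto intro: less_imp_le)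
    also have "\<dots> = \<delta> * (\<Sum>a\<in>A. C a) * w" by (simp add: sum_distrib_left sum_distrib_right mult.assoc)
    also have "\<dots> \<le> 1 * w" by (intro mult_right_mono \<delta> w)
    finally show ?thesis by simp
  qed
  have w0: "wt u \<ge> 0" for u using wt_pos by (rule less_imp_le)
  define K where "K = 2 * (real (card T))\<^sup>2 + 1"
  have "admissible T K (\<lambda>x. twist T x + (\<Sum>a\<in>A. c a * F a x)) \<and> (\<forall>x. \<bar>\<Sum>a\<in>A. c a * F a x\<bar> \<le> 1)"
    if c: "\<forall>a\<in>A. \<bar>c a\<bar> < \<delta>" for c
  proof -
    have C2F: "C2 (F a)" if "a \<in> A" for a using F[OF that] by (simp add: tame_def)
    have S: "C2 (\<lambda>x. \<Sum>a\<in>A. c a * F a x)"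
      "\<And>i. pd i (\<lambda>x. \<Sum>a\<in>A. c a * F a x) = (\<lambda>x. \<Sum>a\<in>A. c a * pd i (F a) x)"
      "\<And>i k. pd k (pd i (\<lambda>x. \<Sum>a\<in>A. c a * F a x)) = (\<lambda>x. \<Sum>a\<in>A. c a * pd k (pd i (F a)) x)"
    proof -
      have c2: "C2 (\<lambda>x. c a * F a x)" if "a \<in> A" for a by (rule C2_cmult(1)[OF C2F[OF that]])
      show "C2 (\<lambda>x. \<Sum>a\<in>A. c a * F a x)" by (rule C2_sum(1)[OF c2])
      show "pd i (\<lambda>x. \<Sum>a\<in>A. c a * F a x) = (\<lambda>x. \<Sum>a\<in>A. c a * pd i (F a) x)" for i
        by (rule trans[OF C2_sum(2)[OF c2]]) (auto intro!: sum.cong simp: C2_cmult(2)[OF C2F])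
      show "pd k (pd i (\<lambda>x. \<Sum>a\<in>A. c a * F a x)) = (\<lambda>x. \<Sum>a\<in>A. c a * pd k (pd i (F a)) x)" for i k
        by (rule trans[OF C2_sum(3)[OF c2]]) (auto intro!: sum.cong simp: fun_cong[OF C2_cmult(3)[OF C2F]])
    qed
    note P = C2_add[OF C2_twist[of T] S(1)]
    have b0: "\<bar>\<Sum>a\<in>A. c a * F a x\<bar> \<le> 1" for x by (rule small[OF c]) (simp_all add: C(1))
    have b1: "\<bar>\<Sum>a\<in>A. c a * pd i (F a) x\<bar> \<le> 1" for i x
    proof -
      have "\<bar>\<Sum>a\<in>A. c a * pd i (F a) x\<bar> \<le> wt (x i - x 0)" by (rule small[OF c C(2) w0])
      then show ?thesis using wt_le_1[of "x i - x 0"] by linarith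
    qed
    have b2: "\<bar>\<Sum>a\<in>A. c a * pd i (pd k (F a)) x\<bar> \<le> wt (x i - x k)" for i k x
      by (rule small[OF c C(3) w0])
    have "depends_on T (\<lambda>x. twist T x + (\<Sum>a\<in>A. c a * F a x))"
      by (intro dep_add twist_dep dep_sum dep_mult dep_const) (use F in \<open>simp add: tame_def\<close>)
    then have "admissible T K (\<lambda>x. twist T x + (\<Sum>a\<in>A. c a * F a x))"
      unfolding admissible_def
    proof (intro conjI allI impI P(1))
      fix x i k
      show "- K \<le> twist T x + (\<Sum>a\<in>A. c a * F a x)"
        using twist_nonneg[of T x] b0[of x] zero_le_power2[of "real (card T)"] unfolding K_def by linarith
      show "\<bar>pd i (\<lambda>x. twist T x + (\<Sum>a\<in>A. c a * F a x)) x\<bar> \<le> K"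
        unfolding P(2) S(2) K_def using pd_twist_le[of i T x] b1[of i x] by linarith
      show "\<bar>pd i (pd k (\<lambda>x. twist T x + (\<Sum>a\<in>A. c a * F a x))) x\<bar> \<le> K"
        unfolding P(3) S(3) K_def using pd2_twist_le[of i k T x] b2[of i k x] wt_le_1[of "x i - x k"] by linarith
      fix l show "twist T (shift 0 l x) + (\<Sum>a\<in>A. c a * F a (shift 0 l x)) = twist T x + (\<Sum>a\<in>A. c a * F a x)"
        using F unfolding twist_shift0 by (auto simp: tame_def intro!: sum.cong)
    next
      fix i k x assume ik: "i \<noteq> (k :: int ^ 'd)"
      show "pd i (pd k (\<lambda>x. twist T x + (\<Sum>a\<in>A. c a * F a x))) x \<le> 0"
      proof (cases "i \<in> T \<and> k \<in> T")
        case True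
        then show ?thesis unfolding P(3) S(3) using twist_mixed[OF T _ _ ik, of x] b2[of i k x] by auto
      next
        case False
        have "pd i (pd k (\<lambda>x. twist T x + (\<Sum>a\<in>A. c a * F a x))) x = 0"
        proof (cases "i \<in> T")
          case True
          then have "k \<notin> T" using False by blast
          then have "pd k (\<lambda>x. twist T x + (\<Sum>a\<in>A. c a * F a x)) = (\<lambda>x. 0)"
            using pd_outside[OF \<open>depends_on T _\<close>] by (simp add: fun_eq_iff)
          then show ?thesis by (simp add: C1_const)
        next
          case False
          then show ?thesis using pd_outside[OF dep_pd[OF \<open>depends_on T _\<close>]] by blast
        qed
        then show ?thesis by simp
      qed
    qed
    with b0 show ?thesis by blast
  qed
  then show ?thesis using \<delta>(1) by blast
qed

text \<open>Translates of a single \<open>P\<close> satisfy (B) because \<open>P\<close> ignores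
  integer constants added to the configuration. Its lower bound preserves the coercivity in (C), and
  its signs preserve (D), whose strict part is inherited from \<open>S\<close>.\<close>

lemma local_potentials_add:
  fixes S :: "'d::finite potentials"
  assumes S: "local_potentials S r" and P: "admissible T C P" and T: "T \<subseteq> ball1 0 r'" and e: "\<epsilon> \<ge> 0"
  shows "local_potentials (\<lambda>j x. S j x + \<epsilon> * P (shift j 0 x)) (max r r')"
proof -
  have L: "0 < r" "\<forall>j x y. (\<forall>k\<in>ball1 j r. x k = y k) \<longrightarrow> S j x = S j y" "\<forall>j. C2 (S j)"
    "\<forall>j k l x. S j (shift k l x) = S (j + k) x" "\<forall>j. bdd_below (range (S j))"
    "\<forall>j k. l1norm (k - j) = 1 \<longrightarrow> (\<forall>M. \<exists>R. \<forall>x. \<bar>x k - x j\<bar> > R \<longrightarrow> S j x > M)"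
    "\<forall>i k j x. i \<noteq> k \<longrightarrow> pd i (pd k (S j)) x \<le> 0" "\<forall>i k x. l1norm (i - k) = 1 \<longrightarrow> pd i (pd k (S i)) x < 0"
    and E: "\<exists>C. \<forall>i k j x. \<bar>pd i (pd k (S j)) x\<bar> \<le> C"
    using S unfolding local_potentials_def by - (elim conjE, assumption)+
  note A = L(1) L(2)[rule_format] L(3)[rule_format] and B = L(4)[rule_format] and Cb = L(5)[rule_format]
    and Cc = L(6)[rule_format] and D = L(7,8)[rule_format]
  have P1: "C2 P" "depends_on T P" "\<And>l x. P (shift 0 l x) = P x" "\<And>x. - C \<le> P x"
    "\<And>i k x. \<bar>pd i (pd k P) x\<bar> \<le> C" "\<And>i k x. i \<noteq> k \<Longrightarrow> pd i (pd k P) x \<le> 0"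
    using P unfolding admissible_def by blast+
  have Q: "C2 (\<lambda>x. \<epsilon> * P (shift j 0 x))"
    "pd i (pd k (\<lambda>x. \<epsilon> * P (shift j 0 x))) = (\<lambda>x. \<epsilon> * pd (i - j) (pd (k - j) P) (shift j 0 x))" for i j k
    using C2_cmult[OF C2_shift(1)[OF P1(1)]] C2_shift(3)[OF P1(1)] by simp_all
  have pd: "pd i (pd k (\<lambda>x. S j x + \<epsilon> * P (shift j 0 x))) x =
      pd i (pd k (S j)) x + \<epsilon> * pd (i - j) (pd (k - j) P) (shift j 0 x)" for i j k x
    by (simp only: C2_add(3)[OF A(3) Q(1)] Q(2))
  have le: "\<epsilon> * pd (i - j) (pd (k - j) P) (shift j 0 x) \<le> 0" if "i \<noteq> k" for i j k x
    using P1(6)[of "i - j" "k - j"] that e by (intro mult_nonneg_nonpos) auto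
  show ?thesis
    unfolding local_potentials_def pd
  proof (intro conjI allI impI)
    show "0 < max r r'" using A(1) by simp
  next
    fix j and x y :: "'d config" assume xy: "\<forall>k\<in>ball1 j (max r r'). x k = y k"
    have "S j x = S j y" by (rule A(2)) (use xy in \<open>auto simp: ball1_def\<close>)
    moreover have "P (shift j 0 x) = P (shift j 0 y)"
    proof (rule depD[OF P1(2)])
      fix t assume "t \<in> T"
      then have "t + j \<in> ball1 j (max r r')" using T by (auto simp: ball1_def)
      then show "shift j 0 x t = shift j 0 y t" using xy by (simp add: shift_def)
    qed
    ultimately show "S j x + \<epsilon> * P (shift j 0 x) = S j y + \<epsilon> * P (shift j 0 y)" by simp
  next
    fix j show "C2 (\<lambda>x. S j x + \<epsilon> * P (shift j 0 x))" by (rule C2_add(1)[OF A(3) Q(1)])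
  next
    fix j k l and x :: "'d config"
    have "shift j 0 (shift k l x) = shift 0 l (shift (j + k) 0 x)" by (simp add: shift_def fun_eq_iff add_ac)
    then show "S j (shift k l x) + \<epsilon> * P (shift j 0 (shift k l x)) = S (j + k) x + \<epsilon> * P (shift (j + k) 0 x)"
      using B P1(3) by simp
  next
    fix j
    obtain m where m: "\<And>x. m \<le> S j x" using Cb[of j] by (auto simp: bdd_below_def)
    have "m + \<epsilon> * (- C) \<le> S j x + \<epsilon> * P (shift j 0 x)" for x
      by (intro add_mono m mult_left_mono P1(4) e)
    then show "bdd_below (range (\<lambda>x. S j x + \<epsilon> * P (shift j 0 x)))" by (intro bdd_belowI2)
  next
    fix j k :: "int ^ 'd" and M :: real assume jk: "l1norm (k - j) = 1"
    obtain R where R: "\<And>x. \<bar>x k - x j\<bar> > R \<Longrightarrow> S j x > M + \<epsilon> * C" using Cc[OF jk] by blast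
    have "S j x + \<epsilon> * P (shift j 0 x) > M" if "\<bar>x k - x j\<bar> > R" for x
      using R[OF that] mult_left_mono[OF P1(4)[of "shift j 0 x"] e] by simp
    then show "\<exists>R. \<forall>x. R < \<bar>x k - x j\<bar> \<longrightarrow> M < S j x + \<epsilon> * P (shift j 0 x)" by blast
  next
    fix i k j :: "int ^ 'd" and x :: "'d config" assume ik: "i \<noteq> k"
    show "pd i (pd k (S j)) x + \<epsilon> * pd (i - j) (pd (k - j) P) (shift j 0 x) \<le> 0"
      using D(1)[OF ik] le[OF ik] by (rule add_nonpos_nonpos)
  next
    fix i k :: "int ^ 'd" and x :: "'d config" assume ik: "l1norm (i - k) = 1"
    then have "i \<noteq> k" by (auto simp: l1norm_def)
    then show "pd i (pd k (S i)) x + \<epsilon> * pd (i - i) (pd (k - i) P) (shift i 0 x) < 0"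
      using D(2)[OF ik] le by (intro add_neg_nonpos)
  next
    obtain C' where C': "\<And>i k j x. \<bar>pd i (pd k (S j)) x\<bar> \<le> C'" using E by blast
    have "\<bar>pd i (pd k (S j)) x + \<epsilon> * pd (i - j) (pd (k - j) P) (shift j 0 x)\<bar> \<le> C' + \<epsilon> * C" for i k j x
    proof (rule order.trans[OF abs_triangle_ineq], rule add_mono[OF C'])
      show "\<bar>\<epsilon> * pd (i - j) (pd (k - j) P) (shift j 0 x)\<bar> \<le> \<epsilon> * C"
        using e P1(5) by (simp add: abs_mult mult_left_mono)
    qed
    then show "\<exists>C. \<forall>i k j x. \<bar>pd i (pd k (S j)) x + \<epsilon> * pd (i - j) (pd (k - j) P) (shift j 0 x)\<bar> \<le> C" by blast
  qed
qed

text \<open>\<open>P\<close> depends on the sites in \<open>T\<close> alone, so at most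
  \<open>card T\<close> first and \<open>(card T)\<^sup>2\<close> second derivatives are nonzero,
  each of them bounded by \<open>\<epsilon> * C\<close>.\<close>

lemma C1_grad_norm_admissible:
  fixes T :: "(int ^ 'd::finite) set"
  assumes P: "admissible T C P" and T: "finite T" and e: "\<epsilon> \<ge> 0"
  shows "C1_grad_norm (\<lambda>x. \<epsilon> * P x) \<le> ennreal (\<epsilon> * (C * (real (card T) + (real (card T))\<^sup>2)))"
proof -
  have P1: "C2 P" "depends_on T P" "\<And>i x. \<bar>pd i P x\<bar> \<le> C" "\<And>i k x. \<bar>pd i (pd k P) x\<bar> \<le> C"
    using P unfolding admissible_def by blast+
  have C0: "C \<ge> 0" using P1(3)[of 0 "\<lambda>i. 0"] by linarith
  define M where "M = ennreal (\<epsilon> * C)"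
  have sup1: "(SUP x. ennreal \<bar>pd j (\<lambda>x. \<epsilon> * P x) x\<bar>) \<le> (if j \<in> T then M else 0)" for j
  proof (rule SUP_least)
    fix x
    show "ennreal \<bar>pd j (\<lambda>x. \<epsilon> * P x) x\<bar> \<le> (if j \<in> T then M else 0)"
      using e P1(3)[of j x] pd_outside[OF P1(2), of j x]
      by (auto simp: C2_cmult[OF P1(1)] M_def abs_mult intro!: ennreal_leI mult_left_mono)
  qed
  have sup2: "(SUP x. ennreal \<bar>pd j (pd k (\<lambda>x. \<epsilon> * P x)) x\<bar>) \<le> (if j \<in> T \<and> k \<in> T then M else 0)" for j k
  proof (rule SUP_least)
    fix x
    have "pd j (pd k P) x = 0" if "j \<notin> T \<or> k \<notin> T"
    proof (cases "k \<in> T")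
      case False
      then have "pd k P = (\<lambda>x. 0)" using pd_outside[OF P1(2)] by blast
      then show ?thesis by (simp add: C1_const)
    next
      case True
      then show ?thesis using that pd_outside[OF dep_pd[OF P1(2)]] by blast
    qed
    then show "ennreal \<bar>pd j (pd k (\<lambda>x. \<epsilon> * P x)) x\<bar> \<le> (if j \<in> T \<and> k \<in> T then M else 0)"
      using e P1(4)[of j k x]
      by (auto simp: C2_cmult(3)[OF P1(1)] M_def abs_mult intro!: ennreal_leI mult_left_mono)
  qed
  have "(\<Sum>j\<in>F. SUP x. ennreal \<bar>pd j (\<lambda>x. \<epsilon> * P x) x\<bar>) + (\<Sum>(j1, j2)\<in>F \<times> F. SUP x. ennreal \<bar>pd j1 (pd j2 (\<lambda>x. \<epsilon> * P x)) x\<bar>)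
      \<le> ennreal (\<epsilon> * (C * (real (card T) + (real (card T))\<^sup>2)))" if F: "finite F" for F
  proof -
    have c: "card (F \<inter> T) \<le> card T" using T by (intro card_mono) auto
    have "(\<Sum>j\<in>F. SUP x. ennreal \<bar>pd j (\<lambda>x. \<epsilon> * P x) x\<bar>) \<le> (\<Sum>j\<in>F. if j \<in> T then M else 0)"
      by (intro sum_mono sup1)
    also have "\<dots> = of_nat (card (F \<inter> T)) * M" using F by (simp add: sum.inter_restrict[symmetric])
    also have "\<dots> \<le> of_nat (card T) * M" using c by (intro mult_right_mono) auto
    finally have 1: "(\<Sum>j\<in>F. SUP x. ennreal \<bar>pd j (\<lambda>x. \<epsilon> * P x) x\<bar>) \<le> of_nat (card T) * M" .
    have "(\<Sum>(j1, j2)\<in>F \<times> F. SUP x. ennreal \<bar>pd j1 (pd j2 (\<lambda>x. \<epsilon> * P x)) x\<bar>) \<le> (\<Sum>z\<in>F \<times> F. if z \<in> T \<times> T then M else 0)"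
    proof (rule sum_mono)
      fix z :: "(int ^ 'd) \<times> (int ^ 'd)"
      show "(case z of (j1, j2) \<Rightarrow> SUP x. ennreal \<bar>pd j1 (pd j2 (\<lambda>x. \<epsilon> * P x)) x\<bar>) \<le> (if z \<in> T \<times> T then M else 0)"
        using sup2[of "fst z" "snd z"] by (cases z) simp
    qed
    also have "\<dots> = of_nat (card ((F \<times> F) \<inter> (T \<times> T))) * M" using F by (subst sum.inter_restrict[symmetric]) auto
    also have "card ((F \<times> F) \<inter> (T \<times> T)) = card (F \<inter> T) * card (F \<inter> T)"
      by (simp add: Times_Int_Times card_cartesian_product)
    also have "of_nat (card (F \<inter> T) * card (F \<inter> T)) * M \<le> of_nat (card T * card T) * M"
      using mult_le_mono[OF c c] by (intro mult_right_mono) (auto simp del: of_nat_mult)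
    finally have 2: "(\<Sum>(j1, j2)\<in>F \<times> F. SUP x. ennreal \<bar>pd j1 (pd j2 (\<lambda>x. \<epsilon> * P x)) x\<bar>) \<le> of_nat (card T * card T) * M" .
    have "of_nat (card T) * M + of_nat (card T * card T) * M = ennreal (real (card T)) * M + ennreal (real (card T * card T)) * M"
      by (simp only: ennreal_of_nat_eq_real_of_nat)
    also have "\<dots> = ennreal (real (card T) * (\<epsilon> * C)) + ennreal (real (card T * card T) * (\<epsilon> * C))"
      unfolding M_def using e C0 by (simp only: ennreal_mult[symmetric] of_nat_0_le_iff mult_nonneg_nonneg)
    also have "\<dots> = ennreal (\<epsilon> * (C * (real (card T) + (real (card T))\<^sup>2)))"
      using e C0 by (subst ennreal_plus[symmetric]) (auto simp: power2_eq_square algebra_simps)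
    finally show ?thesis using add_mono[OF 1 2] by simp
  qed
  then show ?thesis unfolding C1_grad_norm_def by (intro SUP_least) auto
qed

section \<open>Morse approximation\<close>

lemma finite_ball1: "finite (ball1 (j :: int ^ 'd::finite) r)"
proof -
  define B where "B = \<lceil>r\<rceil> + (\<Sum>i\<in>UNIV. \<bar>j $ i\<bar>)"
  have "\<bar>k $ i\<bar> \<le> B" if "k \<in> ball1 j r" for k i
  proof -
    have "\<bar>(k - j) $ i\<bar> \<le> l1norm (k - j)" unfolding l1norm_def by (intro member_le_sum) auto
    moreover have "\<bar>j $ i\<bar> \<le> (\<Sum>i\<in>UNIV. \<bar>j $ i\<bar>)" by (intro member_le_sum) auto
    moreover have "l1norm (k - j) \<le> \<lceil>r\<rceil>" using that by (simp add: ball1_def) linarith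
    ultimately show ?thesis by (simp add: B_def)
  qed
  then show ?thesis by (rule finite_bounded_vec)
qed

context periods
begin

lemma morse_approximation:
  fixes S :: "'d potentials"
  assumes S: "local_potentials S r"
  shows "\<exists>Sn :: nat \<Rightarrow> 'd potentials.
           (\<exists>R. \<forall>n. local_potentials (Sn n) R)
         \<and> (\<forall>n. morse_on_X p q (\<lambda>x. \<Sum>j\<in>Bp p. Sn n j x))
         \<and> ((\<lambda>n. C1_grad_norm (\<lambda>x. Sn n 0 x - S 0 x)) \<longlonglongrightarrow> 0)
         \<and> (\<forall>j. uniform_limit (birkhoff \<inter> Xpq p q) (\<lambda>n. Sn n j) (S j) sequentially)"
proof -
  \<comment> \<open>\<open>Bp p\<close> represents all sites modulo the periods, as
    \<open>gen_separates\<close> needs; 0 is the reference site of the generators.\<close>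
  define T where "T = insert 0 (Bp p)"
  have T: "finite T" "Bp p \<subseteq> T" "0 \<in> T" using finite_Bp by (auto simp: T_def)
  define A where "A = words T (1 + 2 * card (Bp p))"
  have A: "finite A" using finite_words[OF T(1)] by (simp add: A_def)
  have tm: "tame T (mon L)" if "L \<in> A" for L
    using that by (intro tame_mon T) (simp add: A_def words_def)
  obtain \<delta> C where \<delta>: "\<delta> > 0" and adm: "\<And>c. (\<forall>L\<in>A. \<bar>c L\<bar> < \<delta>) \<Longrightarrow>
      admissible T C (\<lambda>x. twist T x + (\<Sum>L\<in>A. c L * mon L x)) \<and> (\<forall>x. \<bar>\<Sum>L\<in>A. c L * mon L x\<bar> \<le> 1)"
    using admissible_twist_plus_small[OF T(1) A, of mon] tm by blast
  define \<epsilon> where "\<epsilon> n = inverse (real (Suc n))" for n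
  have \<epsilon>: "\<epsilon> n > 0" for n by (simp add: \<epsilon>_def)
  have \<epsilon>lim: "\<epsilon> \<longlonglongrightarrow> 0" unfolding \<epsilon>_def[abs_def] by (rule LIMSEQ_inverse_real_of_nat)
  have "\<forall>j. C2 (S j)" "\<forall>j x y. (\<forall>k\<in>ball1 j r. x k = y k) \<longrightarrow> S j x = S j y"
    using S unfolding local_potentials_def by - (elim conjE, assumption)+
  then have C2S: "C2 (S j)" and depS: "depends_on (ball1 j r) (S j)" for j
    by (simp_all add: depends_on_def)
  have smS: "smooth (S j)" for j by (rule smoothI[OF C2S finite_ball1 depS])
  have smtw: "smooth (twist T)" by (rule smoothI[OF C2_twist T(1) twist_dep])
  have smm: "smooth (mon L)" if "L \<in> A" for L by (rule smooth_tame[OF T(1) tm[OF that]])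
  have ex: "\<exists>c. (\<forall>L\<in>A. \<bar>c L\<bar> < \<delta>) \<and>
      morse_on_X p q (\<lambda>x. \<Sum>j\<in>Bp p. S j x + \<epsilon> n * (twist T (shift j 0 x) + (\<Sum>L\<in>A. c L * mon L (shift j 0 x))))" for n
  proof -
    \<comment> \<open>The twist belongs to the unperturbed function and the monomials carry the same
      factor \<open>\<epsilon> n\<close>. The bound \<open>\<delta>\<close> on the coefficients is
      thus relative to the twist and the same for every \<open>n\<close>.\<close>
    let ?W = "\<lambda>x. \<Sum>j\<in>Bp p. S j x + \<epsilon> n * twist T (shift j 0 x)"
    let ?F = "\<lambda>L x. \<epsilon> n * (\<Sum>j\<in>Bp p. mon L (shift j 0 x))"
    have smF: "smooth (\<lambda>x. \<Sum>j\<in>Bp p. mon L (shift j 0 x))" if "L \<in> A" for L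
      by (intro smooth_sum smooth_shift smm that)
    have span: "\<exists>c. \<forall>k\<in>Bp p. (\<Sum>L\<in>A. c L * grd (?F L) k x) = (if i = k then 1 else 0)"
      if x: "x \<in> Xpq p q" and i: "i \<in> Bp p" for x i
    proof -
      obtain c where c: "\<forall>k\<in>Bp p. (\<Sum>L\<in>A. c L * grd (\<lambda>x. \<Sum>j\<in>Bp p. mon L (shift j 0 x)) k x) = (if i = k then 1 else 0)"
        using gradients_span[OF T x i] unfolding A_def by blast
      have "(\<Sum>L\<in>A. c L / \<epsilon> n * grd (?F L) k x) = (\<Sum>L\<in>A. c L * grd (\<lambda>x. \<Sum>j\<in>Bp p. mon L (shift j 0 x)) k x)" for k
        using \<epsilon>[of n] by (intro sum.cong refl) (simp add: grd_def dderiv_cmult[OF smF])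
      then show ?thesis using c by (intro exI[of _ "\<lambda>L. c L / \<epsilon> n"]) simp
    qed
    have "\<exists>c. (\<forall>L\<in>A. \<bar>c L\<bar> < \<delta>) \<and> morse_on_X p q (\<lambda>x. ?W x + (\<Sum>L\<in>A. c L * ?F L x))"
    proof (rule morse_perturbation[OF _ _ A span \<delta>])
      show "smooth ?W" by (intro smooth_sum smooth_add smS smooth_cmult smooth_shift smtw)
      show "\<forall>L\<in>A. smooth (?F L)" by (intro ballI smooth_cmult smF)
    qed
    then obtain c where c: "\<forall>L\<in>A. \<bar>c L\<bar> < \<delta>" "morse_on_X p q (\<lambda>x. ?W x + (\<Sum>L\<in>A. c L * ?F L x))" by blast
    have "?W x + (\<Sum>L\<in>A. c L * ?F L x) =
        (\<Sum>j\<in>Bp p. S j x + \<epsilon> n * (twist T (shift j 0 x) + (\<Sum>L\<in>A. c L * mon L (shift j 0 x))))" for x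
    proof -
      have "(\<Sum>L\<in>A. c L * ?F L x) = (\<Sum>L\<in>A. \<Sum>j\<in>Bp p. \<epsilon> n * (c L * mon L (shift j 0 x)))"
        by (simp add: sum_distrib_left mult_ac)
      also have "\<dots> = (\<Sum>j\<in>Bp p. \<epsilon> n * (\<Sum>L\<in>A. c L * mon L (shift j 0 x)))"
        by (subst sum.swap) (simp add: sum_distrib_left)
      finally show ?thesis by (simp add: sum.distrib distrib_left)
    qed
    with c show ?thesis by auto
  qed
  obtain c where cm: "\<forall>n. (\<forall>L\<in>A. \<bar>c n L\<bar> < \<delta>) \<and>
      morse_on_X p q (\<lambda>x. \<Sum>j\<in>Bp p. S j x + \<epsilon> n * (twist T (shift j 0 x) + (\<Sum>L\<in>A. c n L * mon L (shift j 0 x))))"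
    using choice[OF allI[OF ex]] ..
  then have c: "\<forall>L\<in>A. \<bar>c n L\<bar> < \<delta>"
    and morse: "morse_on_X p q (\<lambda>x. \<Sum>j\<in>Bp p. S j x + \<epsilon> n * (twist T (shift j 0 x) + (\<Sum>L\<in>A. c n L * mon L (shift j 0 x))))" for n
    by simp_all
  define P where "P n x = twist T x + (\<Sum>L\<in>A. c n L * mon L x)" for n x
  have P: "admissible T C (P n)" and P1: "\<bar>P n x - twist T x\<bar> \<le> 1" for n x
    using adm[OF c[of n]] by (simp_all add: P_def[abs_def])
  define Sn where "Sn n j x = S j x + \<epsilon> n * P n (shift j 0 x)" for n j x
  \<comment> \<open>A crude radius for \<open>T\<close>; like \<open>T\<close>, it does not depend
    on \<open>n\<close>, so the ranges are uniform.\<close>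
  define r' where "r' = (\<Sum>t\<in>T. real_of_int (l1norm t))"
  have "T \<subseteq> ball1 0 r'"
  proof
    fix t assume t: "t \<in> T"
    have "real_of_int (l1norm t) \<le> r'" unfolding r'_def
      using t T by (intro member_le_sum) (auto simp: l1norm_def intro: sum_nonneg)
    then show "t \<in> ball1 0 r'" by (simp add: ball1_def)
  qed
  then have lp: "local_potentials (Sn n) (max r r')" for n
    unfolding Sn_def[abs_def] by (rule local_potentials_add[OF S P _ less_imp_le[OF \<epsilon>]])
  have norm: "(\<lambda>n. C1_grad_norm (\<lambda>x. Sn n 0 x - S 0 x)) \<longlonglongrightarrow> 0"
  proof (rule tendsto_sandwich[OF _ _ tendsto_const])
    let ?K = "C * (real (card T) + (real (card T))\<^sup>2)"
    have "shift 0 0 x = x" for x :: "'d config" by (simp add: shift_def)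
    then have "C1_grad_norm (\<lambda>x. Sn n 0 x - S 0 x) \<le> ennreal (\<epsilon> n * ?K)" for n
      using C1_grad_norm_admissible[OF P T(1) less_imp_le[OF \<epsilon>], of n n] by (simp add: Sn_def)
    then show "\<forall>\<^sub>F n in sequentially. C1_grad_norm (\<lambda>x. Sn n 0 x - S 0 x) \<le> ennreal (\<epsilon> n * ?K)" by simp
    have "(\<lambda>n. \<epsilon> n * ?K) \<longlonglongrightarrow> 0 * ?K" by (intro tendsto_mult \<epsilon>lim tendsto_const)
    then show "(\<lambda>n. ennreal (\<epsilon> n * ?K)) \<longlonglongrightarrow> 0" using tendsto_ennrealI by fastforce
  qed simp
  have unif: "uniform_limit (birkhoff \<inter> Xpq p q) (\<lambda>n. Sn n j) (S j) sequentially" for j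
  proof -
    have "\<forall>z\<in>T \<times> T. \<exists>B. \<forall>x\<in>birkhoff \<inter> Xpq p q. \<bar>x (fst z + j) - x (snd z + j)\<bar> \<le> B"
      using birkhoff_bounded by blast
    from bchoice[OF this] obtain B where B: "\<And>s t x. s \<in> T \<Longrightarrow> t \<in> T \<Longrightarrow> x \<in> birkhoff \<inter> Xpq p q \<Longrightarrow> \<bar>x (s + j) - x (t + j)\<bar> \<le> B (s, t)"
      by fastforce
    \<comment> \<open>\<open>B\<close> bounds the differences between sites by
      \<open>birkhoff_bounded\<close>, the factor 2 is the slope from
      \<open>arctan_int_bounds\<close>, and the 1 accounts for the monomials.\<close>
    define D where "D = (\<Sum>s\<in>T. \<Sum>t\<in>T. 2 * B (s, t)) + 1"
    have le: "\<bar>P n (shift j 0 x)\<bar> \<le> D" if x: "x \<in> birkhoff \<inter> Xpq p q" for n x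
    proof -
      have "twist T (shift j 0 x) \<le> (\<Sum>s\<in>T. \<Sum>t\<in>T. 2 * B (s, t))"
        unfolding twist_def
      proof (intro sum_mono)
        fix s t assume "s \<in> T" "t \<in> T"
        then show "arctan_int (shift j 0 x s - shift j 0 x t) \<le> 2 * B (s, t)"
          using B[of s t x] x arctan_int_bounds(2)[of "x (s + j) - x (t + j)"] by (simp add: shift_def)
      qed
      then show ?thesis using P1[of n "shift j 0 x"] twist_nonneg[of T "shift j 0 x"] unfolding D_def by linarith
    qed
    show ?thesis
      unfolding uniform_limit_iff
    proof (intro allI impI)
      fix e :: real assume e: "e > 0"
      have "(\<lambda>n. \<epsilon> n * D) \<longlonglongrightarrow> 0 * D" by (intro tendsto_mult \<epsilon>lim tendsto_const)
      then have "\<forall>\<^sub>F n in sequentially. \<epsilon> n * D < e" using e by (intro order_tendstoD(2)) auto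
      then show "\<forall>\<^sub>F n in sequentially. \<forall>x\<in>birkhoff \<inter> Xpq p q. dist (Sn n j x) (S j x) < e"
      proof (rule eventually_mono, intro ballI)
        fix n x assume n: "\<epsilon> n * D < e" and x: "x \<in> birkhoff \<inter> Xpq p q"
        have "dist (Sn n j x) (S j x) = \<epsilon> n * \<bar>P n (shift j 0 x)\<bar>"
          using \<epsilon>[of n] by (simp add: Sn_def dist_real_def abs_mult)
        also have "\<dots> \<le> \<epsilon> n * D" by (intro mult_left_mono le x less_imp_le[OF \<epsilon>])
        finally show "dist (Sn n j x) (S j x) < e" using n by linarith
      qed
    qed
  qed
  have "morse_on_X p q (\<lambda>x. \<Sum>j\<in>Bp p. Sn n j x)" for n
    using morse[of n] by (simp add: Sn_def P_def)
  then show ?thesis using lp norm unif by (intro exI[of _ Sn]) blast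
qed

end

theorem mainTheorem14:
  fixes S :: "'d::finite potentials"
    and \<omega> :: "real ^ 'd"
    and p :: "'d \<Rightarrow> int ^ 'd" and q :: "'d \<Rightarrow> int"
  assumes "\<exists>r. local_potentials S r"
    and "\<forall>m. \<omega> $ m \<in> \<rat>"
    and "principal_periods \<omega> p q"
  shows "\<exists>Sn :: nat \<Rightarrow> 'd potentials.
           (\<forall>n. \<exists>r. local_potentials (Sn n) r)
         \<and> (\<exists>R. \<forall>n. \<exists>r. r \<le> R \<and> local_potentials (Sn n) r)
         \<and> (\<forall>n. morse_on_X p q (\<lambda>x. \<Sum>j\<in>Bp p. Sn n j x))
         \<and> ((\<lambda>n. C1_grad_norm (\<lambda>x. Sn n 0 x - S 0 x)) \<longlonglongrightarrow> 0)
         \<and> (\<forall>j. uniform_limit (birkhoff \<inter> Xpq p q) (\<lambda>n. Sn n j) (S j) sequentially)"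
proof -
  interpret periods \<omega> p q using assms(2,3) by unfold_locales
  obtain r where "local_potentials S r" using assms(1) by blast
  from morse_approximation[OF this] show ?thesis by (meson order.refl)
qed

end
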